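(* Let $k\ge 1$ and let $S$ be an aperiodic $k$-monoid whose $k$ associated alphabets $X_1,\dots,X_k$ are all finite and each have cardinality at least $2$. Then the group $\mathscr{G}(S)=\mathsf{R}(S)^{e}/\sigma$ is countable, is isomorphic to a subgroup of the group of self-homeomorphisms of the Cantor space, has simple commutator subgroup, and is (isomorphic to) the topological full group of a Boolean étale groupoid, namely the groupoid $\mathcal{G}(S)$ associated with $S$.
   Context: $\mathbb{N}^k$ denotes $k$-tuples of non-negative integers with componentwise addition and order; $\mathbf{e}_i$ is the tuple with $1$ in position $i$ and $0$ elsewhere. A $k$-monoid is a countable monoid $S$ with a monoid homomorphism $d\colon S\to\mathbb{N}^k$ such that whenever $d(x)=\mathbf{m}+\mathbf{n}$ there are unique $x_1,x_2\in S$ with $x=x_1x_2$, $d(x_1)=\mathbf{m}$, $d(x_2)=\mathbf{n}$. Its alphabets are $X_i=d^{-1}(\mathbf{e}_i)$, $1\le i\le k$. Tilings. A $k$-tiling is a function $w$ assigning to each pair $(\mathbf{m},\mathbf{n})$ in $\mathbb{N}^k$ with $\mathbf{m}\le\mathbf{n}$ an element $w(\mathbf{m},\mathbf{n})\in S$ with $w(\mathbf{m},\mathbf{m})=1$, $w(\mathbf{m},\mathbf{n})w(\mathbf{n},\mathbf{p})=w(\mathbf{m},\mathbf{p})$ and $d(w(\mathbf{m},\mathbf{n}))=\mathbf{n}-\mathbf{m}$. $S^\infty$ is the set of all $k$-tilings. For $\mathbf{p}\in\mathbb{N}^k$ the shift is $\sigma^{\mathbf{p}}(w)(\mathbf{m},\mathbf{n})=w(\mathbf{m}+\mathbf{p},\mathbf{n}+\mathbf{p})$.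 A tiling $w$ has period $\mathbf{p}\in\mathbb{Z}^k$ if $w(\mathbf{m}+\mathbf{p},\mathbf{n}+\mathbf{p})=w(\mathbf{m},\mathbf{n})$ for all $\mathbf{m}\le\mathbf{n}$ in $\mathbb{N}^k$ with $\mathbf{m}+\mathbf{p}\ge\mathbf{0}$; it is periodic if it has a non-zero period, eventually periodic if $\sigma^{\mathbf{q}}(w)$ is periodic for some $\mathbf{q}\in\mathbb{N}^k$, and aperiodic if it is not eventually periodic. $S$ is aperiodic if it has at least one aperiodic $k$-tiling. For $a\in S$, $w\in S^\infty$, $aw$ is the unique tiling with $(aw)(\mathbf{0},d(a))=a$ and $\sigma^{d(a)}(aw)=w$; the sets $aS^\infty=\{aw: w\in S^\infty\}$ form a basis of the topology on $S^\infty$. The group. $\mathsf{R}(S)$ is the inverse monoid, under composition of partial functions, of all bijective morphisms $\alpha\colon XS\to YS$ between finitely generated right ideals of $S$ ($X,Y$ finite, the empty ideal and empty function included), where a morphism satisfies $\alpha(as)=\alpha(a)s$ for all $a\in XS$, $s\in S$. In an inverse semigroup $T$ with zero, a non-zero idempotent $e$ is essential if $ef\neq 0$ for every non-zero idempotent $f$; $T^e$ is the inverse subsemigroup of all $s$ with $s^{-1}s$ and $ss^{-1}$ essential. $\sigma$ is the minimum group congruence: $s\,\sigma\,t$ iff there is $u\le s,t$ in the natural partial order (restriction of partial functions in $\mathsf{R}(S)$). The groupoid. $\mathcal{G}(S)$ consists of the triples $(w_2,\mathbf{n},w_1)\in S^\infty\times\mathbb{Z}^k\times S^\infty$ for which there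 are $\mathbf{l},\mathbf{m}\in\mathbb{N}^k$ with $\sigma^{\mathbf{l}}(w_2)=\sigma^{\mathbf{m}}(w_1)$ and $\mathbf{n}=\mathbf{l}-\mathbf{m}$; the product is $(w_3,\mathbf{n}',w_2)(w_2,\mathbf{n},w_1)=(w_3,\mathbf{n}'+\mathbf{n},w_1)$, the inverse is $(w_2,\mathbf{n},w_1)^{-1}=(w_1,-\mathbf{n},w_2)$, and the topology has basis the sets $Z(x,y)=\{(xw,d(x)-d(y),yw): w\in S^\infty\}$, $x,y\in S$. An étale groupoid is Boolean if its space of identities is compact Hausdorff with a basis of clopen sets. A bisection of a groupoid $G$ with set of identities $G_o$ is a subset $A$ such that for $g,h\in A$ each of $g^{-1}g=h^{-1}h$ and $gg^{-1}=hh^{-1}$ implies $g=h$, and $A^{-1}A=G_o=AA^{-1}$. The topological full group of an étale groupoid is the group of all its compact-open bisections under multiplication of subsets. *)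

theory Defs
  imports
    "HOL-Analysis.Analysis"
    "HOL-Algebra.Generated_Groups"
begin

section \<open>k-monoids and tilings\<close>

text \<open>
  The number \<open>k\<close> is \<open>CARD('k)\<close>, which is at least 1 for every type. On \<open>nat ^ 'k\<close> the order,
  sum and difference are componentwise, and the tuple \<open>e\<^sub>i\<close> is \<open>axis i 1\<close>.
\<close>

locale k_monoid = monoid S for S :: "('s, 'b) monoid_scheme" (structure) +
  fixes d :: "'s \<Rightarrow> nat ^ 'k::finite"
  assumes countable_carrier: "countable (carrier S)"
    and degree_one: "d \<one> = 0"
    and degree_mult: "\<lbrakk>x \<in> carrier S; y \<in> carrier S\<rbrakk> \<Longrightarrow> d (x \<otimes> y) = d x + d y"
    and unique_factorization:
      "\<lbrakk>x \<in> carrier S; d x = m + n\<rbrakk> \<Longrightarrow>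
        \<exists>!(p :: 's \<times> 's). case p of (x1, x2) \<Rightarrow>
          x1 \<in> carrier S \<and> x2 \<in> carrier S \<and> x = x1 \<otimes> x2 \<and> d x1 = m \<and> d x2 = n"

definition alphabet :: "('s, 'b) monoid_scheme \<Rightarrow> ('s \<Rightarrow> nat ^ 'k::finite) \<Rightarrow> 'k \<Rightarrow> 's set"
  where "alphabet S d i = {x \<in> carrier S. d x = axis i 1}"

type_synonym ('k, 's) tiling = "(nat ^ 'k) \<times> (nat ^ 'k) \<Rightarrow> 's"

definition le_pairs :: "((nat ^ 'k::finite) \<times> (nat ^ 'k)) set"
  where "le_pairs = {(m, n). m \<le> n}"

text \<open>A tiling is only defined on \<open>le_pairs\<close>; it is made extensional so that equality of
  tilings is equality of functions.\<close>

definition tilings :: "('s, 'b) monoid_scheme \<Rightarrow> ('s \<Rightarrow> nat ^ 'k::finite) \<Rightarrow> ('k, 's) tiling set"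
  where "tilings S d =
    {w \<in> le_pairs \<rightarrow>\<^sub>E carrier S.
      (\<forall>m. w (m, m) = \<one>\<^bsub>S\<^esub>) \<and>
      (\<forall>m n p. m \<le> n \<and> n \<le> p \<longrightarrow> w (m, n) \<otimes>\<^bsub>S\<^esub> w (n, p) = w (m, p)) \<and>
      (\<forall>m n. m \<le> n \<longrightarrow> d (w (m, n)) = n - m)}"

definition shift :: "nat ^ 'k::finite \<Rightarrow> ('k, 's) tiling \<Rightarrow> ('k, 's) tiling"
  where "shift p w = restrict (\<lambda>(m, n). w (m + p, n + p)) le_pairs"

definition int_vec :: "nat ^ 'k::finite \<Rightarrow> int ^ 'k"
  where "int_vec n = (\<chi> i. int (n $ i))"

text \<open>Below, \<open>m'\<close> and \<open>n'\<close> are \<open>m + p\<close> and \<open>n + p\<close>; they exist in \<open>nat ^ 'k\<close> exactly when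
  \<open>m + p \<ge> 0\<close>.\<close>

definition has_period :: "('k::finite, 's) tiling \<Rightarrow> int ^ 'k \<Rightarrow> bool"
  where "has_period w p \<longleftrightarrow>
    (\<forall>m n m' n'. m \<le> n \<and> int_vec m' = int_vec m + p \<and> int_vec n' = int_vec n + p
      \<longrightarrow> w (m', n') = w (m, n))"

definition periodic :: "('k::finite, 's) tiling \<Rightarrow> bool"
  where "periodic w \<longleftrightarrow> (\<exists>p. p \<noteq> 0 \<and> has_period w p)"

definition eventually_periodic :: "('k::finite, 's) tiling \<Rightarrow> bool"
  where "eventually_periodic w \<longleftrightarrow> (\<exists>q. periodic (shift q w))"

definition aperiodic :: "('s, 'b) monoid_scheme \<Rightarrow> ('s \<Rightarrow> nat ^ 'k::finite) \<Rightarrow> bool"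
  where "aperiodic S d \<longleftrightarrow> (\<exists>w \<in> tilings S d. \<not> eventually_periodic w)"

definition prepend ::
  "('s, 'b) monoid_scheme \<Rightarrow> ('s \<Rightarrow> nat ^ 'k::finite) \<Rightarrow> 's \<Rightarrow> ('k, 's) tiling \<Rightarrow> ('k, 's) tiling"
  where "prepend S d a w =
    (THE v. v \<in> tilings S d \<and> v (0, d a) = a \<and> shift (d a) v = w)"


section \<open>Inverse monoids and the group of a k-monoid\<close>

definition idempotents :: "('a, 'b) monoid_scheme \<Rightarrow> 'a set"
  where "idempotents T = {e \<in> carrier T. e \<otimes>\<^bsub>T\<^esub> e = e}"

definition is_zero :: "('a, 'b) monoid_scheme \<Rightarrow> 'a \<Rightarrow> bool"
  where "is_zero T z \<longleftrightarrow>
    z \<in> carrier T \<and> (\<forall>x \<in> carrier T. z \<otimes>\<^bsub>T\<^esub> x = z \<and> x \<otimes>\<^bsub>T\<^esub> z = z)"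

definition semigroup_inverse :: "('a, 'b) monoid_scheme \<Rightarrow> 'a \<Rightarrow> 'a"
  where "semigroup_inverse T s =
    (THE t. t \<in> carrier T \<and> s \<otimes>\<^bsub>T\<^esub> t \<otimes>\<^bsub>T\<^esub> s = s \<and> t \<otimes>\<^bsub>T\<^esub> s \<otimes>\<^bsub>T\<^esub> t = t)"

definition essential :: "('a, 'b) monoid_scheme \<Rightarrow> 'a \<Rightarrow> bool"
  where "essential T e \<longleftrightarrow>
    e \<in> idempotents T \<and> \<not> is_zero T e \<and>
    (\<forall>f \<in> idempotents T. \<not> is_zero T f \<longrightarrow> \<not> is_zero T (e \<otimes>\<^bsub>T\<^esub> f))"

definition essential_part :: "('a, 'b) monoid_scheme \<Rightarrow> ('a, 'b) monoid_scheme"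
  where "essential_part T = T\<lparr>carrier :=
    {s \<in> carrier T. essential T (semigroup_inverse T s \<otimes>\<^bsub>T\<^esub> s) \<and>
                    essential T (s \<otimes>\<^bsub>T\<^esub> semigroup_inverse T s)}\<rparr>"

definition natural_le :: "('a, 'b) monoid_scheme \<Rightarrow> 'a \<Rightarrow> 'a \<Rightarrow> bool"
  where "natural_le T s t \<longleftrightarrow> (\<exists>e \<in> idempotents T. s = t \<otimes>\<^bsub>T\<^esub> e)"

definition min_group_cong :: "('a, 'b) monoid_scheme \<Rightarrow> ('a \<times> 'a) set"
  where "min_group_cong T =
    {(s, t). s \<in> carrier T \<and> t \<in> carrier T \<and>
       (\<exists>u \<in> carrier T. natural_le T u s \<and> natural_le T u t)}"

definition max_group_image :: "('a, 'b) monoid_scheme \<Rightarrow> 'a set monoid"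
  where "max_group_image T =
    \<lparr>carrier = carrier T // min_group_cong T,
     mult = (\<lambda>A B. \<Union>a \<in> A. \<Union>b \<in> B. min_group_cong T `` {a \<otimes>\<^bsub>T\<^esub> b}),
     one = min_group_cong T `` {\<one>\<^bsub>T\<^esub>}\<rparr>"

definition right_ideal_gen :: "('s, 'b) monoid_scheme \<Rightarrow> 's set \<Rightarrow> 's set"
  where "right_ideal_gen S X = {x \<otimes>\<^bsub>S\<^esub> s | x s. x \<in> X \<and> s \<in> carrier S}"

definition fg_right_ideal :: "('s, 'b) monoid_scheme \<Rightarrow> 's set \<Rightarrow> bool"
  where "fg_right_ideal S I \<longleftrightarrow>
    (\<exists>X. finite X \<and> X \<subseteq> carrier S \<and> I = right_ideal_gen S X)"

text \<open>The inverse monoid \<open>R(S)\<close>. Partial functions are maps: \<open>dom \<alpha>\<close> and \<open>ran \<alpha>\<close> are the two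
  ideals, \<open>Map.empty\<close> is the zero, and \<open>\<alpha> \<circ>\<^sub>m \<beta>\<close> applies \<open>\<beta>\<close> first.\<close>

definition ideal_isos :: "('s, 'b) monoid_scheme \<Rightarrow> ('s \<rightharpoonup> 's) monoid"
  where "ideal_isos S =
    \<lparr>carrier = {\<alpha>. fg_right_ideal S (dom \<alpha>) \<and> fg_right_ideal S (ran \<alpha>) \<and>
        inj_on \<alpha> (dom \<alpha>) \<and>
        (\<forall>a \<in> dom \<alpha>. \<forall>s \<in> carrier S. \<alpha> (a \<otimes>\<^bsub>S\<^esub> s) = Some (the (\<alpha> a) \<otimes>\<^bsub>S\<^esub> s))},
     mult = (\<circ>\<^sub>m),
     one = (\<lambda>x. if x \<in> carrier S then Some x else None)\<rparr>"

definition k_monoid_group :: "('s, 'b) monoid_scheme \<Rightarrow> ('s \<rightharpoonup> 's) set monoid"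
  where "k_monoid_group S = max_group_image (essential_part (ideal_isos S))"


section \<open>Etale groupoids and topological full groups\<close>

record 'g groupoid = "'g partial_object" +
  composable :: "('g \<times> 'g) set"
  gmult :: "'g \<Rightarrow> 'g \<Rightarrow> 'g"
  ginv :: "'g \<Rightarrow> 'g"

locale groupoid =
  fixes G :: "('g, 'b) groupoid_scheme"
  assumes composable_subset: "composable G \<subseteq> carrier G \<times> carrier G"
    and gmult_closed: "(g, h) \<in> composable G \<Longrightarrow> gmult G g h \<in> carrier G"
    and ginv_closed: "g \<in> carrier G \<Longrightarrow> ginv G g \<in> carrier G"
    and assoc: "\<lbrakk>(g, h) \<in> composable G; (h, l) \<in> composable G\<rbrakk> \<Longrightarrow>
      (gmult G g h, l) \<in> composable G \<and> (g, gmult G h l) \<in> composable G \<and>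
      gmult G (gmult G g h) l = gmult G g (gmult G h l)"
    and ginv_ginv: "g \<in> carrier G \<Longrightarrow> ginv G (ginv G g) = g"
    and ginv_composable: "g \<in> carrier G \<Longrightarrow> (ginv G g, g) \<in> composable G"
    and cancel_left: "(g, h) \<in> composable G \<Longrightarrow> gmult G (ginv G g) (gmult G g h) = h"
    and cancel_right: "(g, h) \<in> composable G \<Longrightarrow> gmult G (gmult G g h) (ginv G h) = g"

definition source :: "('g, 'b) groupoid_scheme \<Rightarrow> 'g \<Rightarrow> 'g"
  where "source G g = gmult G (ginv G g) g"

definition target :: "('g, 'b) groupoid_scheme \<Rightarrow> 'g \<Rightarrow> 'g"
  where "target G g = gmult G g (ginv G g)"

definition identities :: "('g, 'b) groupoid_scheme \<Rightarrow> 'g set"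
  where "identities G = source G ` carrier G"

definition local_homeomorphism :: "'a topology \<Rightarrow> 'c topology \<Rightarrow> ('a \<Rightarrow> 'c) \<Rightarrow> bool"
  where "local_homeomorphism X Y f \<longleftrightarrow>
    (\<forall>x \<in> topspace X. \<exists>U. openin X U \<and> x \<in> U \<and> openin Y (f ` U) \<and>
      homeomorphic_map (subtopology X U) (subtopology Y (f ` U)) f)"

locale etale_groupoid = groupoid G for G :: "('g, 'b) groupoid_scheme" +
  fixes \<T> :: "'g topology"
  assumes topspace_eq: "topspace \<T> = carrier G"
    and continuous_gmult:
      "continuous_map (subtopology (prod_topology \<T> \<T>) (composable G)) \<T>
        (\<lambda>(g, h). gmult G g h)"
    and continuous_ginv: "continuous_map \<T> \<T> (ginv G)"
    and source_local_homeomorphism: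
      "local_homeomorphism \<T> (subtopology \<T> (identities G)) (source G)"

definition has_clopen_basis :: "'a topology \<Rightarrow> bool"
  where "has_clopen_basis X \<longleftrightarrow>
    (\<forall>U x. openin X U \<and> x \<in> U \<longrightarrow> (\<exists>V. openin X V \<and> closedin X V \<and> x \<in> V \<and> V \<subseteq> U))"

locale boolean_groupoid = etale_groupoid +
  assumes compact_identities: "compact_space (subtopology \<T> (identities G))"
    and Hausdorff_identities: "Hausdorff_space (subtopology \<T> (identities G))"
    and clopen_basis_identities: "has_clopen_basis (subtopology \<T> (identities G))"

definition gset_mult :: "('g, 'b) groupoid_scheme \<Rightarrow> 'g set \<Rightarrow> 'g set \<Rightarrow> 'g set"
  where "gset_mult G A B = {gmult G g h | g h. g \<in> A \<and> h \<in> B \<and> (g, h) \<in> composable G}"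

definition bisection :: "('g, 'b) groupoid_scheme \<Rightarrow> 'g set \<Rightarrow> bool"
  where "bisection G A \<longleftrightarrow>
    A \<subseteq> carrier G \<and>
    (\<forall>g \<in> A. \<forall>h \<in> A. source G g = source G h \<longrightarrow> g = h) \<and>
    (\<forall>g \<in> A. \<forall>h \<in> A. target G g = target G h \<longrightarrow> g = h) \<and>
    gset_mult G (ginv G ` A) A = identities G \<and>
    gset_mult G A (ginv G ` A) = identities G"

definition topological_full_group ::
  "('g, 'b) groupoid_scheme \<Rightarrow> 'g topology \<Rightarrow> 'g set monoid"
  where "topological_full_group G \<T> =
    \<lparr>carrier = {A. bisection G A \<and> compactin \<T> A \<and> openin \<T> A},
     mult = gset_mult G,
     one = identities G\<rparr>"


section \<open>The groupoid of a k-monoid\<close>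

type_synonym ('k, 's) tiling_arrow = "('k, 's) tiling \<times> (int ^ 'k) \<times> ('k, 's) tiling"

definition tiling_groupoid ::
  "('s, 'b) monoid_scheme \<Rightarrow> ('s \<Rightarrow> nat ^ 'k::finite) \<Rightarrow> ('k, 's) tiling_arrow groupoid"
  where "tiling_groupoid S d =
    (let C = {(w2, n, w1). w2 \<in> tilings S d \<and> w1 \<in> tilings S d \<and>
                (\<exists>l m. shift l w2 = shift m w1 \<and> n = int_vec l - int_vec m)}
     in \<lparr>carrier = C,
         composable = {((w3, n', w2'), (w2, n, w1)).
           (w3, n', w2') \<in> C \<and> (w2, n, w1) \<in> C \<and> w2' = w2},
         gmult = (\<lambda>(w3, n', _) (_, n, w1). (w3, n' + n, w1)),
         ginv = (\<lambda>(w2, n, w1). (w1, - n, w2))\<rparr>)"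

definition basic_open ::
  "('s, 'b) monoid_scheme \<Rightarrow> ('s \<Rightarrow> nat ^ 'k::finite) \<Rightarrow> 's \<Rightarrow> 's \<Rightarrow> ('k, 's) tiling_arrow set"
  where "basic_open S d x y =
    {(prepend S d x w, int_vec (d x) - int_vec (d y), prepend S d y w) | w. w \<in> tilings S d}"

text \<open>The sets \<open>basic_open S d x y\<close> form a basis and not just a subbasis of this topology: a point
  common to two of them lies in a third, obtained by extending \<open>x\<close> and \<open>y\<close> by the same element,
  that is contained in both.\<close>

definition tiling_groupoid_topology ::
  "('s, 'b) monoid_scheme \<Rightarrow> ('s \<Rightarrow> nat ^ 'k::finite) \<Rightarrow> ('k, 's) tiling_arrow topology"
  where "tiling_groupoid_topology S d =
    topology_generated_by {basic_open S d x y | x y. x \<in> carrier S \<and> y \<in> carrier S}"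


section \<open>Simple groups and homeomorphism groups\<close>

text \<open>The library locale \<open>simple_group\<close> requires \<open>order G > 1\<close>, where \<open>order\<close> is \<open>card\<close>; it thus
  excludes all infinite groups and cannot be used here.\<close>

definition is_simple :: "('a, 'b) monoid_scheme \<Rightarrow> bool"
  where "is_simple G \<longleftrightarrow>
    group G \<and> carrier G \<noteq> {\<one>\<^bsub>G\<^esub>} \<and>
    (\<forall>N. N \<lhd> G \<longrightarrow> N = carrier G \<or> N = {\<one>\<^bsub>G\<^esub>})"

definition homeo_group :: "'a topology \<Rightarrow> ('a \<Rightarrow> 'a) monoid"
  where "homeo_group X =
    \<lparr>carrier = {f \<in> extensional (topspace X). homeomorphic_map X X f},
     mult = compose (topspace X),
     one = (\<lambda>x \<in> topspace X. x)\<rparr>"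

definition cantor_space :: "(nat \<Rightarrow> bool) topology"
  where "cantor_space = product_topology (\<lambda>_. discrete_topology UNIV) UNIV"

end

theory Submission
  imports Defs
begin

text \<open>
  An element \<open>\<alpha>\<close> of \<open>R(S)\<close> whose domain and range are essential acts on tilings by replacing a prefix
  \<open>y\<close> in its domain by \<open>\<alpha>(y)\<close>. Essential ideals are exactly those finitely generated ideals that contain
  all elements of some degree \<open>n\<close> (\<open>dense_level\<close>, \<open>level_dense\<close>), so every tiling has a prefix in the
  domain, and two elements are congruent under \<open>\<sigma>\<close> iff they agree on all elements of some degree
  (\<open>min_group_cong_T\<close>). The quotient by \<open>\<sigma>\<close> is therefore isomorphic to the image of any multiplicative
  map that remembers precisely these values (\<open>kernel_quotient\<close>), and it is studied through two such
  maps.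

  The first, \<open>bisection_of\<close>, sends \<open>\<alpha>\<close> to the union of the sets \<open>Z(\<alpha>(y), y)\<close>. Its image is the full group
  (\<open>bisection_of_surj\<close>): by compactness a compact-open bisection is a finite union of sets \<open>Z(x, y)\<close>; each
  of them is the disjoint union of the \<open>Z(xs, ys)\<close> with \<open>s\<close> of a fixed degree, so all \<open>y\<close> may be taken of
  the same degree \<open>n\<close>; injectivity of the source map then makes \<open>x\<close> a function of \<open>y\<close>, and the target map
  and the degree component of the arrows make its extension to the ideal of all elements of degree at
  least \<open>n\<close> injective. Compactness of \<open>Z(x, y)\<close>, and with it of the space of identities, is Koenig's
  lemma for the finitely branching tree of prefixes (\<open>compact_Z\<close>).

  The second, \<open>act\<close>, sends \<open>\<alpha>\<close> to the permutation of tilings it induces. This is where an aperiodic tiling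
  \<open>w\<close> enters: if \<open>xw = yw\<close> and \<open>d(x) \<noteq> d(y)\<close> then \<open>w\<close> has period \<open>d(x) - d(y)\<close>; hence the permutation
  determines \<open>\<alpha>\<close> up to \<open>\<sigma>\<close> (\<open>faithful\<close>, \<open>act_eq_iff\<close>). The simplicity of the commutator subgroup is proved
  for an abstract group \<open>F\<close> of permutations preserving a Boolean algebra of sets (\<open>vigorous_group\<close>), in
  which any proper set can be pushed into any disjoint nonempty one. Let \<open>N\<close> be a normal subgroup of
  \<open>F'\<close> and \<open>1 \<noteq> g \<in> N\<close>. Some nonempty set \<open>B\<close> is disjoint from \<open>g(B)\<close>. For \<open>f\<close>, \<open>h\<close> supported in a small
  piece of \<open>B\<close>, the commutator \<open>[f, h]\<close> does not change when \<open>f\<close> is multiplied by elements whose support is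
  disjoint from that of \<open>h\<close>; in this way \<open>f\<close> and \<open>h\<close> can be replaced by elements of \<open>F'\<close>,
  and then \<open>f\<close> by an element of \<open>N\<close>, so \<open>[f, h] \<in> N\<close>. Conjugating by \<open>F'\<close> carries this to \<open>f\<close>, \<open>h\<close> supported in any common
  proper set, and finally these local commutators generate all of \<open>F'\<close>, because \<open>F\<close> is generated by
  elements with proper support and any two of those commute modulo local commutators.

  Countability holds because an element of \<open>R(S)\<close> is determined by its values on finitely many
  generators. A countable group \<open>G\<close> embeds into the homeomorphism group of the Cantor space
  \<open>{0, 1}\<^bsup>G \<times> \<nat>\<^esup>\<close> by permuting coordinates (\<open>countable_group_embeds_homeo_cantor\<close>).
\<close>

section \<open>Quotients by the minimum group congruence\<close>

text \<open>
  A first isomorphism theorem for the maximal group image: \<open>h\<close> is multiplicative onto a group \<open>H\<close>, and two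
  elements have the same image iff they are congruent. The group laws of the quotient are pulled back
  from \<open>H\<close>.
\<close>

locale kernel_quotient =
  fixes T :: "('a, 'm) monoid_scheme" and H :: "('c, 'n) monoid_scheme" and h :: "'a \<Rightarrow> 'c"
  assumes one_closed: "\<one>\<^bsub>T\<^esub> \<in> carrier T"
    and mult_closed: "\<lbrakk>s \<in> carrier T; t \<in> carrier T\<rbrakk> \<Longrightarrow> s \<otimes>\<^bsub>T\<^esub> t \<in> carrier T"
    and surj: "h ` carrier T = carrier H"
    and mult: "\<lbrakk>s \<in> carrier T; t \<in> carrier T\<rbrakk> \<Longrightarrow> h (s \<otimes>\<^bsub>T\<^esub> t) = h s \<otimes>\<^bsub>H\<^esub> h t"
    and one: "h \<one>\<^bsub>T\<^esub> = \<one>\<^bsub>H\<^esub>"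
    and kernel: "min_group_cong T = {(s, t). s \<in> carrier T \<and> t \<in> carrier T \<and> h s = h t}"
    and group_H: "group H"
begin

lemma class_eq: "min_group_cong T `` {s} = {t. s \<in> carrier T \<and> t \<in> carrier T \<and> h s = h t}"
  unfolding kernel by auto

lemma image_class: "s \<in> carrier T \<Longrightarrow> h ` (min_group_cong T `` {s}) = {h s}"
  unfolding class_eq by auto

lemma mult_classes:
  assumes "s \<in> carrier T" "t \<in> carrier T"
  shows "min_group_cong T `` {s} \<otimes>\<^bsub>max_group_image T\<^esub> min_group_cong T `` {t}
    = min_group_cong T `` {s \<otimes>\<^bsub>T\<^esub> t}"
  using assms mult mult_closed unfolding max_group_image_def class_eq by auto

lemma carrier_quotient: "carrier (max_group_image T) = (\<lambda>s. min_group_cong T `` {s}) ` carrier T"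
  by (auto simp: max_group_image_def quotient_def)

lemma quotient_iso: "(\<lambda>A. the_elem (h ` A)) \<in> iso (max_group_image T) H"
  unfolding iso_iff
proof (intro conjI)
  show "(\<lambda>A. the_elem (h ` A)) \<in> hom (max_group_image T) H"
  proof (rule homI)
    show "the_elem (h ` A) \<in> carrier H" if "A \<in> carrier (max_group_image T)" for A
      using that surj image_class unfolding carrier_quotient by fastforce
    show "the_elem (h ` (A \<otimes>\<^bsub>max_group_image T\<^esub> B)) = the_elem (h ` A) \<otimes>\<^bsub>H\<^esub> the_elem (h ` B)"
      if "A \<in> carrier (max_group_image T)" "B \<in> carrier (max_group_image T)" for A B
    proof -
      obtain s t where "s \<in> carrier T" "A = min_group_cong T `` {s}"
        "t \<in> carrier T" "B = min_group_cong T `` {t}" using \<open>A \<in> _\<close> \<open>B \<in> _\<close> unfolding carrier_quotient by blast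
      then show ?thesis by (simp add: mult_classes image_class mult_closed mult)
    qed
  qed
  show "(\<lambda>A. the_elem (h ` A)) ` carrier (max_group_image T) = carrier H"
    unfolding carrier_quotient image_image surj[symmetric]
    by (rule image_cong) (simp_all add: image_class)
  show "inj_on (\<lambda>A. the_elem (h ` A)) (carrier (max_group_image T))"
    unfolding carrier_quotient
  proof (rule inj_onI)
    fix A B assume "A \<in> (\<lambda>s. min_group_cong T `` {s}) ` carrier T"
      "B \<in> (\<lambda>s. min_group_cong T `` {s}) ` carrier T" and eq: "the_elem (h ` A) = the_elem (h ` B)"
    then obtain s t where st: "s \<in> carrier T" "A = min_group_cong T `` {s}"
      "t \<in> carrier T" "B = min_group_cong T `` {t}" by blast
    then have "h s = h t" using eq image_class by simp
    then show "A = B" using st by (simp add: class_eq)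
  qed
qed

lemma quotient_group: "group (max_group_image T)"
proof -
  interpret H: group H by (rule group_H)
  let ?Q = "max_group_image T" and ?c = "\<lambda>s. min_group_cong T `` {s}"
  have one_Q: "\<one>\<^bsub>?Q\<^esub> = ?c \<one>\<^bsub>T\<^esub>" by (simp add: max_group_image_def)
  have eq: "?c s = ?c t" if "s \<in> carrier T" "t \<in> carrier T" "h s = h t" for s t
    using that by (auto simp: class_eq)
  show ?thesis
  proof (rule groupI)
    fix A assume "A \<in> carrier ?Q"
    then obtain s where s: "s \<in> carrier T" "A = ?c s" unfolding carrier_quotient by blast
    then have hs: "h s \<in> carrier H" using surj by blast
    then have "inv\<^bsub>H\<^esub> h s \<in> h ` carrier T" using surj by simp
    then obtain t where t: "t \<in> carrier T" "h t = inv\<^bsub>H\<^esub> h s" by force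
    have "?c t \<otimes>\<^bsub>?Q\<^esub> A = \<one>\<^bsub>?Q\<^esub>"
      unfolding s(2) one_Q mult_classes[OF t(1) s(1)]
      by (rule eq) (simp_all add: mult_closed one_closed s t mult one hs)
    then show "\<exists>B \<in> carrier ?Q. B \<otimes>\<^bsub>?Q\<^esub> A = \<one>\<^bsub>?Q\<^esub>" using t carrier_quotient by blast
    show "\<one>\<^bsub>?Q\<^esub> \<otimes>\<^bsub>?Q\<^esub> A = A"
      unfolding s(2) one_Q mult_classes[OF one_closed s(1)]
      by (rule eq) (simp_all add: mult_closed one_closed s mult one hs)
    fix B assume "B \<in> carrier ?Q"
    then obtain t where t: "t \<in> carrier T" "B = ?c t" unfolding carrier_quotient by blast
    then show "A \<otimes>\<^bsub>?Q\<^esub> B \<in> carrier ?Q"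
      using s mult_classes mult_closed unfolding carrier_quotient by auto
    fix C assume "C \<in> carrier ?Q"
    then obtain u where u: "u \<in> carrier T" "C = ?c u" unfolding carrier_quotient by blast
    have hh: "h t \<in> carrier H" "h u \<in> carrier H" using surj t u by auto
    show "A \<otimes>\<^bsub>?Q\<^esub> B \<otimes>\<^bsub>?Q\<^esub> C = A \<otimes>\<^bsub>?Q\<^esub> (B \<otimes>\<^bsub>?Q\<^esub> C)"
      unfolding s(2) t(2) u(2)
      using s(1) t(1) u(1) hs hh
      by (simp add: mult_classes mult_closed, intro eq)
        (simp_all add: mult_closed mult H.m_assoc)
  next
    show "\<one>\<^bsub>?Q\<^esub> \<in> carrier ?Q" using one_closed one_Q carrier_quotient by blast
  qed
qed

end

section \<open>Simple commutator subgroups and isomorphisms\<close>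

lemma is_simple_iso:
  assumes phi: "\<phi> \<in> iso G H" and G: "group G" and H: "is_simple H"
  shows "is_simple G"
proof -
  have gH: "group H" using H by (simp add: is_simple_def)
  interpret group_hom G H \<phi>
    using phi G gH by (auto simp: group_hom_def group_hom_axioms_def iso_def)
  have inj: "inj_on \<phi> (carrier G)" and surj: "\<phi> ` carrier G = carrier H"
    using phi by (auto simp: Group.iso_iff)
  have "N = carrier G \<or> N = {\<one>\<^bsub>G\<^esub>}" if N: "N \<lhd> G" for N
  proof -
    have NG: "N \<subseteq> carrier G" using N by (simp add: normal_imp_subgroup subgroup.subset)
    have "\<phi> ` N \<lhd> H" using iso_normal_subgroup[OF phi G gH N] .
    then have "\<phi> ` N = \<phi> ` carrier G \<or> \<phi> ` N = \<phi> ` {\<one>\<^bsub>G\<^esub>}"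
      using H surj by (auto simp: is_simple_def)
    then show ?thesis
      using inj_on_image_eq_iff[OF inj NG, of "carrier G"] inj_on_image_eq_iff[OF inj NG, of "{\<one>\<^bsub>G\<^esub>}"]
      by blast
  qed
  moreover have "carrier G \<noteq> {\<one>\<^bsub>G\<^esub>}"
  proof
    assume "carrier G = {\<one>\<^bsub>G\<^esub>}"
    then have "carrier H = {\<one>\<^bsub>H\<^esub>}" using surj by force
    then show False using H by (simp add: is_simple_def)
  qed
  ultimately show ?thesis using G by (simp add: is_simple_def)
qed

lemma simple_derived_iso:
  assumes phi: "\<phi> \<in> iso G H" and G: "group G" and H: "group H"
    and simple: "is_simple (H\<lparr>carrier := derived H (carrier H)\<rparr>)"
  shows "is_simple (G\<lparr>carrier := derived G (carrier G)\<rparr>)"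
proof (rule is_simple_iso[OF _ _ simple])
  interpret group_hom G H \<phi>
    using phi G H by (auto simp: group_hom_def group_hom_axioms_def iso_def)
  have inj: "inj_on \<phi> (carrier G)" and surj: "\<phi> ` carrier G = carrier H"
    using phi by (auto simp: Group.iso_iff)
  have sub: "derived G (carrier G) \<subseteq> carrier G" using G.derived_in_carrier by simp
  have img: "\<phi> ` derived G (carrier G) = derived H (carrier H)"
    using derived_img[of "carrier G"] surj by simp
  have hom: "\<phi> (x \<otimes>\<^bsub>G\<^esub> y) = \<phi> x \<otimes>\<^bsub>H\<^esub> \<phi> y" if "x \<in> derived G (carrier G)" "y \<in> derived G (carrier G)" for x y
    using that sub by (simp add: subset_iff)
  show "\<phi> \<in> iso (G\<lparr>carrier := derived G (carrier G)\<rparr>) (H\<lparr>carrier := derived H (carrier H)\<rparr>)"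
    unfolding Group.iso_iff hom_def using img hom inj_on_subset[OF inj sub] by auto
  show "group (G\<lparr>carrier := derived G (carrier G)\<rparr>)"
    using G.subgroup_imp_group[OF G.derived_is_subgroup] by simp
qed

section \<open>Countable groups and the Cantor space\<close>

lemma topspace_cantor_space [simp]: "topspace cantor_space = UNIV"
  by (simp add: cantor_space_def)

lemma group_homeo_cantor: "group (homeo_group cantor_space)"
proof -
  have comp: "compose UNIV f g = f \<circ> g" for f g :: "(nat \<Rightarrow> bool) \<Rightarrow> (nat \<Rightarrow> bool)"
    by (simp add: compose_def fun_eq_iff)
  have restr: "(\<lambda>x \<in> UNIV. x) = (id :: (nat \<Rightarrow> bool) \<Rightarrow> (nat \<Rightarrow> bool))" by (simp add: fun_eq_iff)
  have id_homeo: "homeomorphic_map cantor_space cantor_space id" by simp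
  show ?thesis
  proof (rule groupI)
    fix f assume "f \<in> carrier (homeo_group cantor_space)"
    then have "homeomorphic_map cantor_space cantor_space f" by (simp add: homeo_group_def)
    then obtain g where "homeomorphic_maps cantor_space cantor_space f g"
      unfolding homeomorphic_map_maps by blast
    then show "\<exists>g \<in> carrier (homeo_group cantor_space).
        g \<otimes>\<^bsub>homeo_group cantor_space\<^esub> f = \<one>\<^bsub>homeo_group cantor_space\<^esub>"
      unfolding homeomorphic_maps_map
      by (intro bexI[of _ g]) (auto simp: homeo_group_def extensional_def comp restr fun_eq_iff)
  qed (use id_homeo in \<open>auto simp: homeo_group_def extensional_def comp restr comp_assoc
      intro: homeomorphic_map_compose\<close>)
qed

lemma homeomorphic_map_reindex:
  assumes "\<And>i. \<rho> (\<pi> i) = i" "\<And>i. \<pi> (\<rho> i) = i"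
  shows "homeomorphic_map cantor_space cantor_space (\<lambda>x i. x (\<pi> i))"
proof -
  have cont: "continuous_map cantor_space cantor_space (\<lambda>x i. x (\<tau> i))" for \<tau> :: "nat \<Rightarrow> nat"
    unfolding cantor_space_def continuous_map_componentwise_UNIV
    by (intro allI continuous_map_product_projection) simp
  have "homeomorphic_maps cantor_space cantor_space (\<lambda>x i. x (\<pi> i)) (\<lambda>x i. x (\<rho> i))"
    unfolding homeomorphic_maps_def using cont assms by simp
  then show ?thesis unfolding homeomorphic_map_maps by blast
qed

text \<open>
  A countable group \<open>G\<close> acts by left translation on the first factor of the countably infinite set
  \<open>G \<times> \<nat>\<close>; a bijection \<open>e\<close> from that set to \<open>\<nat>\<close> turns this into a faithful action \<open>\<pi>\<close> on \<open>\<nat>\<close>, hence on the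
  coordinates of the Cantor space. The factor \<open>\<nat>\<close> covers finite groups \<open>G\<close> as well.
\<close>

lemma countable_group_embeds_homeo_cantor:
  assumes G: "group G" and countable: "countable (carrier G)"
  shows "\<exists>H. subgroup H (homeo_group cantor_space) \<and> G \<cong> (homeo_group cantor_space)\<lparr>carrier := H\<rparr>"
proof -
  interpret G: group G by (rule G)
  define A where "A = carrier G \<times> (UNIV :: nat set)"
  have A: "countable A" "infinite A"
    using countable G.one_closed by (auto simp: A_def finite_cartesian_product_iff)
  define e where "e = to_nat_on A"
  have e: "bij_betw e A UNIV" unfolding e_def by (rule to_nat_on_infinite[OF A])
  define e' where "e' = inv_into A e"
  have e'e: "e' (e a) = a" if "a \<in> A" for a
    using bij_betw_inv_into_left[OF e that] by (simp add: e'_def)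
  have ee': "e (e' i) = i" for i using bij_betw_inv_into_right[OF e] by (simp add: e'_def)
  have e'A: "e' i \<in> A" for i using e unfolding e'_def by (metis bij_betw_imp_surj_on inv_into_into UNIV_I)
  define \<pi> where "\<pi> g i = e (g \<otimes>\<^bsub>G\<^esub> fst (e' i), snd (e' i))" for g i
  have fstA: "fst (e' i) \<in> carrier G" for i using e'A[of i] by (auto simp: A_def)
  have \<pi>_comp: "\<pi> g (\<pi> k i) = \<pi> (g \<otimes>\<^bsub>G\<^esub> k) i" if "g \<in> carrier G" "k \<in> carrier G" for g k i
    using that fstA by (simp add: \<pi>_def e'e A_def G.m_assoc)
  have \<pi>_one: "\<pi> \<one>\<^bsub>G\<^esub> i = i" for i using fstA by (simp add: \<pi>_def ee')
  \<comment> \<open>Reindexing reverses composition, so the inverse is needed to obtain a homomorphism.\<close>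
  define \<Phi> :: "'a \<Rightarrow> (nat \<Rightarrow> bool) \<Rightarrow> (nat \<Rightarrow> bool)"
    where "\<Phi> g x i = x (\<pi> (inv\<^bsub>G\<^esub> g) i)" for g x i
  have \<Phi>_homeo: "\<Phi> g \<in> carrier (homeo_group cantor_space)" if "g \<in> carrier G" for g
  proof -
    have "homeomorphic_map cantor_space cantor_space (\<lambda>x i. x (\<pi> (inv\<^bsub>G\<^esub> g) i))"
      by (rule homeomorphic_map_reindex[of "\<pi> g"]) (simp_all add: that \<pi>_comp \<pi>_one)
    then show ?thesis by (simp add: homeo_group_def \<Phi>_def[abs_def] extensional_def)
  qed
  have \<Phi>_mult: "\<Phi> (g \<otimes>\<^bsub>G\<^esub> k) = \<Phi> g \<otimes>\<^bsub>homeo_group cantor_space\<^esub> \<Phi> k"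
    if "g \<in> carrier G" "k \<in> carrier G" for g k
    using that by (simp add: homeo_group_def compose_def \<Phi>_def fun_eq_iff G.inv_mult_group \<pi>_comp)
  have \<Phi>_inj: "inj_on \<Phi> (carrier G)"
  proof (rule inj_onI)
    fix g k assume gk: "g \<in> carrier G" "k \<in> carrier G" "\<Phi> g = \<Phi> k"
    let ?i = "e (\<one>\<^bsub>G\<^esub>, 0)"
    \<comment> \<open>Evaluate at the indicator function of a single coordinate, at the coordinate of the identity.\<close>
    have "\<Phi> g (\<lambda>j. j = \<pi> (inv\<^bsub>G\<^esub> k) ?i) ?i" unfolding gk(3) by (simp add: \<Phi>_def)
    then have "\<pi> (inv\<^bsub>G\<^esub> g) ?i = \<pi> (inv\<^bsub>G\<^esub> k) ?i" by (simp add: \<Phi>_def)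
    then have "e (inv\<^bsub>G\<^esub> g, 0) = e (inv\<^bsub>G\<^esub> k, 0)" using gk by (simp add: \<pi>_def e'e A_def)
    then have "(inv\<^bsub>G\<^esub> g, 0::nat) = (inv\<^bsub>G\<^esub> k, 0)"
      using e'e gk by (metis A_def G.inv_closed SigmaI UNIV_I)
    then show "g = k" using gk G.inv_inv by (metis prod.inject)
  qed
  have "\<Phi> \<in> hom G (homeo_group cantor_space)" using \<Phi>_homeo \<Phi>_mult by (simp add: hom_def)
  then interpret group_hom G "homeo_group cantor_space" \<Phi>
    using G group_homeo_cantor by (simp add: group_hom_def group_hom_axioms_def)
  have "\<Phi> \<in> iso G ((homeo_group cantor_space)\<lparr>carrier := \<Phi> ` carrier G\<rparr>)"
    unfolding Group.iso_iff hom_def using \<Phi>_inj \<Phi>_mult by auto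
  then show ?thesis using img_is_subgroup is_isoI by blast
qed

section \<open>Permutation groups with simple commutator subgroup\<close>

abbreviation inv_fun :: "('x \<Rightarrow> 'x) \<Rightarrow> ('x \<Rightarrow> 'x)"
  where "inv_fun \<equiv> inv_into UNIV"

definition commutator :: "('x \<Rightarrow> 'x) \<Rightarrow> ('x \<Rightarrow> 'x) \<Rightarrow> ('x \<Rightarrow> 'x)"
  where "commutator f h = f \<circ> h \<circ> inv_fun f \<circ> inv_fun h"

definition permutation_group :: "('x \<Rightarrow> 'x) set \<Rightarrow> ('x \<Rightarrow> 'x) monoid"
  where "permutation_group F = \<lparr>carrier = F, mult = (\<circ>), one = id\<rparr>"

text \<open>
  The model is the full group of an effective, minimal and purely infinite groupoid: \<open>X\<close> is its unit
  space, \<open>\<B>\<close> the algebra of compact-open sets, and \<open>F\<close> the group of homeomorphisms that are locally given by the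
  groupoid. The condition \<open>swap\<close> expresses that \<open>F\<close> is closed under pasting: from \<open>f\<close> on \<open>B\<close> and
  its inverse on \<open>f(B)\<close> one obtains an element of \<open>F\<close>. The condition \<open>compress\<close> is pure infiniteness together with
  minimality.
\<close>

locale vigorous_group =
  fixes F :: "('x \<Rightarrow> 'x) set" and \<B> :: "'x set set" and X :: "'x set"
  assumes bij: "f \<in> F \<Longrightarrow> bij f"
    and id_mem: "id \<in> F"
    and comp_mem: "\<lbrakk>f \<in> F; g \<in> F\<rbrakk> \<Longrightarrow> f \<circ> g \<in> F"
    and inv_mem: "f \<in> F \<Longrightarrow> inv_fun f \<in> F"
    and fixes_outside: "\<lbrakk>f \<in> F; v \<notin> X\<rbrakk> \<Longrightarrow> f v = v"
    and space_mem: "X \<in> \<B>"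
    and space_nonempty: "X \<noteq> {}"
    and clopen_subset: "B \<in> \<B> \<Longrightarrow> B \<subseteq> X"
    and clopen_Un: "\<lbrakk>A \<in> \<B>; B \<in> \<B>\<rbrakk> \<Longrightarrow> A \<union> B \<in> \<B>"
    and clopen_Diff: "\<lbrakk>A \<in> \<B>; B \<in> \<B>\<rbrakk> \<Longrightarrow> A - B \<in> \<B>"
    and clopen_image: "\<lbrakk>f \<in> F; B \<in> \<B>\<rbrakk> \<Longrightarrow> f ` B \<in> \<B>"
    and atomless: "\<lbrakk>B \<in> \<B>; B \<noteq> {}\<rbrakk> \<Longrightarrow> \<exists>C \<in> \<B>. C \<subset> B \<and> C \<noteq> {}"
    and displaced: "\<lbrakk>f \<in> F; f \<noteq> id\<rbrakk> \<Longrightarrow> \<exists>B \<in> \<B>. B \<noteq> {} \<and> f ` B \<inter> B = {}"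
    and swap: "\<lbrakk>f \<in> F; B \<in> \<B>; f ` B \<inter> B = {}\<rbrakk> \<Longrightarrow>
      \<exists>s \<in> F. (\<forall>v \<in> B. s v = f v) \<and> (\<forall>v. v \<notin> B \<union> f ` B \<longrightarrow> s v = v)"
    and compress: "\<lbrakk>P \<in> \<B>; C \<in> \<B>; P \<noteq> {}; C \<noteq> {}; P \<inter> C = {}\<rbrakk> \<Longrightarrow>
      \<exists>t \<in> F. t ` P \<subseteq> C \<and> (\<forall>v. v \<notin> P \<union> C \<longrightarrow> t v = v)"
begin

definition supported :: "'x set \<Rightarrow> ('x \<Rightarrow> 'x) set"
  where "supported V = {f \<in> F. \<forall>v. v \<notin> V \<longrightarrow> f v = v}"

lemma supportedD: "f \<in> supported V \<Longrightarrow> f \<in> F" "f \<in> supported V \<Longrightarrow> v \<notin> V \<Longrightarrow> f v = v"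
  by (auto simp: supported_def)

lemma supported_mono: "f \<in> supported V \<Longrightarrow> V \<subseteq> W \<Longrightarrow> f \<in> supported W"
  by (auto simp: supported_def)

lemma inv_apply_left [simp]: "f \<in> F \<Longrightarrow> inv_fun f (f v) = v"
  by (rule inv_f_f) (rule bij_is_inj[OF bij])

lemma inv_apply_right:
  assumes "f \<in> F"
  shows "f (inv_fun f v) = v"
  using surj_f_inv_f[OF bij_is_surj[OF bij[OF assms]]] .

lemma inv_comp: "f \<in> F \<Longrightarrow> g \<in> F \<Longrightarrow> inv_fun (f \<circ> g) = inv_fun g \<circ> inv_fun f"
  by (simp add: bij o_inv_distrib)

lemma inv_inv [simp]: "f \<in> F \<Longrightarrow> inv_fun (inv_fun f) = f"
  by (simp add: bij inv_inv_eq)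

lemma apply_eq_iff: "f \<in> F \<Longrightarrow> f v = f w \<longleftrightarrow> v = w"
  by (metis inv_apply_left)

lemma commutator_mem: "f \<in> F \<Longrightarrow> h \<in> F \<Longrightarrow> commutator f h \<in> F"
  by (simp add: commutator_def comp_mem inv_mem)

lemma supported_id: "id \<in> supported V"
  by (simp add: supported_def id_mem)

lemma supported_comp: "f \<in> supported V \<Longrightarrow> g \<in> supported V \<Longrightarrow> f \<circ> g \<in> supported V"
  by (auto simp: supported_def comp_mem)

lemma supported_inv: "f \<in> supported V \<Longrightarrow> inv_fun f \<in> supported V"
  by (auto simp: supported_def inv_mem) (metis inv_apply_left)

lemma supported_conj: "f \<in> supported V \<Longrightarrow> g \<in> F \<Longrightarrow> g \<circ> f \<circ> inv_fun g \<in> supported (g ` V)"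
proof -
  assume f: "f \<in> supported V" and g: "g \<in> F"
  have "g (f (inv_fun g v)) = v" if v: "v \<notin> g ` V" for v
  proof -
    have "inv_fun g v \<notin> V"
      using v imageI[of "inv_fun g v" V g] inv_apply_right[OF g] by auto
    then show ?thesis using supportedD(2)[OF f] inv_apply_right[OF g] by simp
  qed
  moreover have "g \<circ> f \<circ> inv_fun g \<in> F" using supportedD(1)[OF f] g by (intro comp_mem inv_mem)
  ultimately show ?thesis by (simp add: supported_def)
qed

text \<open>
  A permutation that fixes everything outside \<open>V\<close> cannot send a point of \<open>V\<close> outside, since that point would
  then have two preimages.
\<close>

lemma supported_stable: "f \<in> supported V \<Longrightarrow> v \<in> V \<Longrightarrow> f v \<in> V"
  by (metis supportedD apply_eq_iff)

lemma disjoint_support_commute: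
  assumes "f \<in> supported V" "h \<in> supported W" "V \<inter> W = {}"
  shows "f \<circ> h = h \<circ> f"
proof
  fix v
  show "(f \<circ> h) v = (h \<circ> f) v"
    using assms supported_stable[OF assms(1), of v] supported_stable[OF assms(2), of v]
      supportedD(2)[OF assms(1)] supportedD(2)[OF assms(2)]
    by (cases "v \<in> V"; cases "v \<in> W") (auto simp: disjoint_iff)
qed

lemma commuteD: "f \<circ> h = h \<circ> f \<Longrightarrow> f (h v) = h (f v)"
  by (metis comp_apply)

lemma commutator_left_absorb:
  assumes "f \<in> F" "c \<in> F" "h \<in> F" "c \<circ> h = h \<circ> c"
  shows "commutator (f \<circ> c) h = commutator f h"
proof
  fix v
  have "c (h (inv_fun c (inv_fun f (inv_fun h v)))) = h (inv_fun f (inv_fun h v))"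
    using commuteD[OF assms(4)] inv_apply_right[OF assms(2)] by simp
  then show "commutator (f \<circ> c) h v = commutator f h v"
    using assms by (simp add: commutator_def inv_comp)
qed

lemma commutator_inv: "f \<in> F \<Longrightarrow> h \<in> F \<Longrightarrow> inv_fun (commutator f h) = commutator h f"
  by (simp add: commutator_def inv_comp comp_mem inv_mem comp_assoc)

lemma commutator_right_absorb:
  assumes "f \<in> F" "c \<in> F" "h \<in> F" "c \<circ> f = f \<circ> c"
  shows "commutator f (h \<circ> c) = commutator f h"
  using commutator_left_absorb[OF assms(3,2,1,4)] assms
  by (metis commutator_inv comp_mem)

lemma commutator_conj:
  assumes "f \<in> F" "h \<in> F" "g \<in> F"
  shows "g \<circ> commutator f h \<circ> inv_fun g = commutator (g \<circ> f \<circ> inv_fun g) (g \<circ> h \<circ> inv_fun g)"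
  using assms by (simp add: commutator_def inv_comp comp_mem inv_mem fun_eq_iff)

lemma commutator_comp_left:
  assumes "f \<in> F" "g \<in> F" "h \<in> F"
  shows "commutator (f \<circ> g) h = f \<circ> commutator g h \<circ> inv_fun f \<circ> commutator f h"
  using assms by (simp add: commutator_def inv_comp comp_mem inv_mem fun_eq_iff)

lemma split_clopen:
  assumes "B \<in> \<B>" "B \<noteq> {}"
  obtains C D where "C \<in> \<B>" "D \<in> \<B>" "C \<noteq> {}" "D \<noteq> {}" "C \<inter> D = {}" "C \<union> D = B"
proof -
  obtain C where "C \<in> \<B>" "C \<subset> B" "C \<noteq> {}" using atomless[OF assms] by blast
  then show ?thesis using that[of C "B - C"] clopen_Diff[OF assms(1)] by blast
qed

text \<open>
  The subgroup generated by the commutators of pairs of elements that are supported in a common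
  proper member of \<open>\<B>\<close>; it turns out to be the whole commutator subgroup of \<open>F\<close>. It is normal in \<open>F\<close>, because
  \<open>F\<close> permutes the proper members of \<open>\<B>\<close>.
\<close>

inductive_set local_commutators :: "('x \<Rightarrow> 'x) set" where
  id: "id \<in> local_commutators"
| step: "\<lbrakk>n \<in> local_commutators; P \<in> \<B>; P \<noteq> X; f \<in> supported P; h \<in> supported P\<rbrakk>
    \<Longrightarrow> n \<circ> commutator f h \<in> local_commutators"

lemma local_commutators_mem: "n \<in> local_commutators \<Longrightarrow> n \<in> F"
proof (induction rule: local_commutators.induct)
  case id
  show ?case by (rule id_mem)
next
  case (step n P f h)
  then show ?case by (intro comp_mem commutator_mem supportedD(1)[of f P] supportedD(1)[of h P])
qed

lemma local_commutators_gen: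
  "\<lbrakk>P \<in> \<B>; P \<noteq> X; f \<in> supported P; h \<in> supported P\<rbrakk> \<Longrightarrow> commutator f h \<in> local_commutators"
  using local_commutators.step[OF local_commutators.id] by fastforce

lemma local_commutators_comp:
  "m \<in> local_commutators \<Longrightarrow> n \<in> local_commutators \<Longrightarrow> n \<circ> m \<in> local_commutators"
  by (induction rule: local_commutators.induct)
    (auto simp: comp_assoc[symmetric] intro: local_commutators.step)

lemma local_commutators_inv: "n \<in> local_commutators \<Longrightarrow> inv_fun n \<in> local_commutators"
proof (induction rule: local_commutators.induct)
  case id
  show ?case unfolding inv_id by (rule local_commutators.id)
next
  case (step n P f h)
  then have "inv_fun (n \<circ> commutator f h) = commutator h f \<circ> inv_fun n"
    by (metis commutator_inv commutator_mem inv_comp local_commutators_mem supportedD(1))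
  then show ?case
    using local_commutators_comp[OF step(6) local_commutators_gen[OF step(2,3,5,4)]] by metis
qed

lemma image_proper: "g \<in> F \<Longrightarrow> P \<in> \<B> \<Longrightarrow> P \<noteq> X \<Longrightarrow> g ` P \<noteq> X"
proof
  assume a: "g \<in> F" "P \<in> \<B>" "P \<noteq> X" "g ` P = X"
  then obtain v where v: "v \<in> X" "v \<notin> P" using clopen_subset by blast
  have "g v \<in> X" using a v fixes_outside by (metis apply_eq_iff)
  then obtain p where "p \<in> P" "g v = g p" using a(4) by blast
  then show False using v apply_eq_iff[OF a(1)] by simp
qed

lemma local_commutators_conj:
  "n \<in> local_commutators \<Longrightarrow> g \<in> F \<Longrightarrow> g \<circ> n \<circ> inv_fun g \<in> local_commutators"
proof (induction rule: local_commutators.induct)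
  case id
  then have "g \<circ> id \<circ> inv_fun g = id" using inv_apply_right[of g] by (simp add: fun_eq_iff)
  then show ?case by (metis local_commutators.id)
next
  case (step n P f h)
  have fh: "f \<in> F" "h \<in> F" using step supportedD by auto
  have "g \<circ> (n \<circ> commutator f h) \<circ> inv_fun g = (g \<circ> n \<circ> inv_fun g) \<circ> (g \<circ> commutator f h \<circ> inv_fun g)"
    using step by (simp add: fun_eq_iff)
  also have "\<dots> = (g \<circ> n \<circ> inv_fun g) \<circ> commutator (g \<circ> f \<circ> inv_fun g) (g \<circ> h \<circ> inv_fun g)"
    using commutator_conj[OF fh \<open>g \<in> F\<close>] by simp
  finally show ?case
    using local_commutators.step[OF step(6)[OF step(7)] clopen_image[OF step(7,2)]
        image_proper[OF step(7,2,3)] supported_conj[OF step(4,7)] supported_conj[OF step(5,7)]]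
    by metis
qed

text \<open>
  Elements that commute with \<open>h\<close> modulo a normal subgroup are closed under composition.
\<close>

lemma commutator_mem_comp_left:
  assumes "f \<in> F" "g \<in> F" "h \<in> F" "commutator f h \<in> local_commutators"
    "commutator g h \<in> local_commutators"
  shows "commutator (f \<circ> g) h \<in> local_commutators"
  unfolding commutator_comp_left[OF assms(1-3)]
  using assms local_commutators_comp local_commutators_conj by simp

lemma commutator_mem_sym:
  "\<lbrakk>f \<in> F; h \<in> F; commutator f h \<in> local_commutators\<rbrakk> \<Longrightarrow> commutator h f \<in> local_commutators"
  using local_commutators_inv commutator_inv by metis

text \<open>
  If \<open>P \<union> Q\<close> is not proper, \<open>f\<close> is first moved out of the way. A set \<open>C\<close> in the complement of \<open>P\<close> can be chosen so
  small that \<open>P \<union> C\<close> and \<open>C \<union> Q\<close> are both proper. Conjugating \<open>f\<close> by a \<open>t\<close> supported in \<open>P \<union> C\<close> with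
  \<open>t(P) \<subseteq> C\<close> changes it only by the local commutator \<open>[f, t]\<close>, and the conjugate and \<open>h\<close> are supported in \<open>C \<union> Q\<close>.
\<close>

lemma commutator_proper_supports:
  assumes P: "P \<in> \<B>" "P \<noteq> X" and Q: "Q \<in> \<B>" "Q \<noteq> X"
    and f: "f \<in> supported P" and h: "h \<in> supported Q"
  shows "commutator f h \<in> local_commutators"
proof (cases "P = {}")
  case True
  then have "f = id" using f by (auto simp: supported_def)
  then have "commutator f h = id"
    using inv_apply_right[OF supportedD(1)[OF h]] unfolding commutator_def \<open>f = id\<close> inv_id
    by (simp add: fun_eq_iff)
  then show ?thesis by (metis local_commutators.id)
next
  case False
  have XP: "X - P \<in> \<B>" "X - P \<noteq> {}" using P clopen_Diff space_mem clopen_subset by auto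
  obtain C1 C2 where C12: "C1 \<in> \<B>" "C2 \<in> \<B>" "C1 \<noteq> {}" "C2 \<noteq> {}" "C1 \<inter> C2 = {}" "C1 \<union> C2 = X - P"
    using split_clopen[OF XP] by metis
  \<comment> \<open>The two halves cannot both cover the complement of \<open>Q\<close>, for they are disjoint.\<close>
  have "\<exists>C \<in> \<B>. C \<noteq> {} \<and> C \<inter> P = {} \<and> P \<union> C \<noteq> X \<and> C \<union> Q \<noteq> X"
  proof (cases "C1 \<union> Q = X")
    case True
    have "C2 \<union> Q \<noteq> X" using True C12 Q clopen_subset by blast
    moreover have "P \<union> C2 \<noteq> X" using C12 by blast
    ultimately show ?thesis using C12 by blast
  next
    case False
    moreover have "P \<union> C1 \<noteq> X" using C12 by blast
    ultimately show ?thesis using C12 by blast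
  qed
  then obtain C where C: "C \<in> \<B>" "C \<noteq> {}" "C \<inter> P = {}" "P \<union> C \<noteq> X" "C \<union> Q \<noteq> X" by blast
  obtain t where t: "t \<in> F" "t ` P \<subseteq> C" "\<forall>v. v \<notin> P \<union> C \<longrightarrow> t v = v"
    using compress[OF P(1) C(1) False C(2)] C(3) by (metis inf_commute)
  have fF: "f \<in> F" and hF: "h \<in> F" using f h supportedD by auto
  define f' where "f' = t \<circ> f \<circ> inv_fun t"
  have f'F: "f' \<in> F" using fF t by (simp add: f'_def comp_mem inv_mem)
  have a: "commutator f t \<in> local_commutators"
    using local_commutators_gen[OF clopen_Un[OF P(1) C(1)] C(4)] supported_mono[OF f] t
    by (auto simp: supported_def)
  have "f' \<in> supported C" using supported_mono[OF supported_conj[OF f t(1)] t(2)] by (simp add: f'_def)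
  then have b: "commutator f' h \<in> local_commutators"
    using local_commutators_gen[OF clopen_Un[OF C(1) Q(1)] C(5)] supported_mono h by (metis Un_upper1 Un_upper2)
  have feq: "f = commutator f t \<circ> f'"
    using fF t inv_apply_right[OF t(1)]
    by (simp add: commutator_def f'_def fun_eq_iff inv_comp comp_mem inv_mem)
  have c: "commutator (commutator f t) h \<in> local_commutators"
  proof -
    have "commutator (commutator f t) h = commutator f t \<circ> (h \<circ> inv_fun (commutator f t) \<circ> inv_fun h)"
      by (simp add: commutator_def[of "commutator f t"] comp_assoc)
    then show ?thesis
      using a hF local_commutators_comp local_commutators_conj local_commutators_inv by simp
  qed
  show ?thesis
    using commutator_mem_comp_left[OF commutator_mem[OF fF t(1)] f'F hF c b] feq by simp
qed

text \<open>
  On a small set \<open>V\<close> that \<open>f\<close> displaces, \<open>f\<close> agrees with an element \<open>s\<close> of \<open>F\<close> supported in \<open>V \<union> f(V)\<close>; then \<open>inv_fun s \<circ> f\<close>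
  fixes \<open>V\<close> pointwise.
\<close>

lemma proper_factorization:
  assumes f: "f \<in> F"
  obtains f1 f2 P Q where "f = f1 \<circ> f2" "P \<in> \<B>" "P \<noteq> X" "f1 \<in> supported P"
    "Q \<in> \<B>" "Q \<noteq> X" "f2 \<in> supported Q"
proof (cases "f = id")
  case True
  have "{} \<in> \<B>" using clopen_Diff[OF space_mem space_mem] by simp
  then show ?thesis using that[of id id "{}" "{}"] True space_nonempty supported_id by simp
next
  case False
  obtain B where B: "B \<in> \<B>" "B \<noteq> {}" "f ` B \<inter> B = {}" using displaced[OF f False] by blast
  obtain V V' where V: "V \<in> \<B>" "V' \<in> \<B>" "V \<noteq> {}" "V' \<noteq> {}" "V \<inter> V' = {}" "V \<union> V' = B"
    using split_clopen[OF B(1,2)] by metis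
  have disj: "f ` V \<inter> V = {}" using V B by blast
  obtain s where s: "s \<in> F" "\<forall>v \<in> V. s v = f v" "\<forall>v. v \<notin> V \<union> f ` V \<longrightarrow> s v = v"
    using swap[OF f V(1) disj] by blast
  have "inv_fun s \<circ> f \<in> supported (X - V)"
    using s f fixes_outside by (auto simp: supported_def comp_mem inv_mem) (metis inv_apply_left)+
  moreover have "f = s \<circ> (inv_fun s \<circ> f)" using inv_apply_right[OF s(1)] by (simp add: fun_eq_iff)
  moreover have "V \<union> f ` V \<in> \<B>" using clopen_Un clopen_image V f by simp
  \<comment> \<open>It misses the other half of \<open>B\<close>, which is why \<open>B\<close> was split.\<close>
  moreover have "V \<union> f ` V \<noteq> X" using V B clopen_subset by blast
  moreover have "s \<in> supported (V \<union> f ` V)" using s by (auto simp: supported_def)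
  moreover have "X - V \<in> \<B>" "X - V \<noteq> X"
    using clopen_Diff space_mem V(1,3) clopen_subset[OF V(1)] by blast+
  ultimately show ?thesis using that by metis
qed

lemma commutator_in_local_commutators:
  assumes f: "f \<in> F" and h: "h \<in> F"
  shows "commutator f h \<in> local_commutators"
proof -
  obtain f1 f2 P Q where f12: "f = f1 \<circ> f2" "P \<in> \<B>" "P \<noteq> X" "f1 \<in> supported P"
    "Q \<in> \<B>" "Q \<noteq> X" "f2 \<in> supported Q" using proper_factorization[OF f] by metis
  obtain h1 h2 P' Q' where h12: "h = h1 \<circ> h2" "P' \<in> \<B>" "P' \<noteq> X" "h1 \<in> supported P'"
    "Q' \<in> \<B>" "Q' \<noteq> X" "h2 \<in> supported Q'" using proper_factorization[OF h] by metis
  have F: "f1 \<in> F" "f2 \<in> F" "h1 \<in> F" "h2 \<in> F" using f12 h12 supportedD by auto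
  have "commutator h f1 \<in> local_commutators" "commutator h f2 \<in> local_commutators"
    unfolding h12(1) using f12 h12 F commutator_proper_supports
    by (metis commutator_mem_comp_left)+
  then show ?thesis unfolding f12(1)
    using F h commutator_mem_sym commutator_mem_comp_left by metis
qed

definition commutator_group :: "('x \<Rightarrow> 'x) set"
  where "commutator_group = derived (permutation_group F) F"

lemma group_permutation_group: "group (permutation_group F)"
  by (rule groupI) (auto simp: permutation_group_def comp_mem id_mem comp_assoc fun_eq_iff intro!: bexI[OF _ inv_mem])

lemma m_inv_permutation_group:
  assumes "f \<in> F"
  shows "inv\<^bsub>permutation_group F\<^esub> f = inv_fun f"
  using group.inv_equality[OF group_permutation_group, of "inv_fun f" f] assms inv_mem
  by (simp add: permutation_group_def fun_eq_iff)

lemma subgroup_commutator_group: "subgroup commutator_group (permutation_group F)"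
  unfolding commutator_group_def
  by (rule group.derived_is_subgroup[OF group_permutation_group]) (simp add: permutation_group_def)

lemma commutator_eq:
  assumes "f \<in> F" "h \<in> F"
  shows "f \<otimes>\<^bsub>permutation_group F\<^esub> h \<otimes>\<^bsub>permutation_group F\<^esub> inv\<^bsub>permutation_group F\<^esub> f
    \<otimes>\<^bsub>permutation_group F\<^esub> inv\<^bsub>permutation_group F\<^esub> h = commutator f h"
  using assms by (simp add: m_inv_permutation_group commutator_def) (simp add: permutation_group_def)

lemma commutator_in_commutator_group: "f \<in> F \<Longrightarrow> h \<in> F \<Longrightarrow> commutator f h \<in> commutator_group"
  unfolding commutator_group_def derived_def
  using commutator_eq by (intro generate.incl) auto

lemma commutator_group_least:
  assumes N: "subgroup N (permutation_group F)" and "\<And>f h. f \<in> F \<Longrightarrow> h \<in> F \<Longrightarrow> commutator f h \<in> N"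
  shows "commutator_group \<subseteq> N"
  unfolding commutator_group_def derived_def
  by (rule group.generate_subgroup_incl[OF group_permutation_group _ N])
    (use assms(2) commutator_eq in auto)

lemma commutator_group_mem: "f \<in> commutator_group \<Longrightarrow> f \<in> F"
  using subgroup.subset[OF subgroup_commutator_group] by (auto simp: permutation_group_def)

lemma commutator_group_comp: "f \<in> commutator_group \<Longrightarrow> g \<in> commutator_group \<Longrightarrow> f \<circ> g \<in> commutator_group"
  using subgroup.m_closed[OF subgroup_commutator_group] by (auto simp: permutation_group_def)

text \<open>
  To compress by an element of the commutator subgroup, take \<open>t\<close> supported in \<open>P \<union> C\<close> and \<open>s\<close> moving \<open>P \<union> C\<close> off
  itself: \<open>[t, s]\<close> is \<open>t\<close> times an element supported in \<open>s(P \<union> C)\<close>, so it agrees with \<open>t\<close> on \<open>P\<close>.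
\<close>

lemma compress_derived:
  assumes "P \<in> \<B>" "C \<in> \<B>" "P \<noteq> {}" "C \<noteq> {}" "P \<inter> C = {}" "P \<union> C \<noteq> X"
  obtains t where "t \<in> commutator_group" "t ` P \<subseteq> C"
proof -
  obtain t where t: "t \<in> F" "t ` P \<subseteq> C" "\<forall>v. v \<notin> P \<union> C \<longrightarrow> t v = v"
    using compress[OF assms(1-5)] by metis
  have PC: "P \<union> C \<in> \<B>" "P \<union> C \<noteq> {}" using assms clopen_Un by auto
  have R: "X - (P \<union> C) \<in> \<B>" "X - (P \<union> C) \<noteq> {}"
    using assms clopen_Diff[OF space_mem PC(1)] clopen_subset by auto
  obtain s where s: "s \<in> F" "s ` (P \<union> C) \<subseteq> X - (P \<union> C)"
    using compress[OF PC(1) R(1) PC(2) R(2)] by blast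
  have "inv_fun t \<in> supported (P \<union> C)" by (intro supported_inv) (use t in \<open>simp add: supported_def\<close>)
  then have st: "s \<circ> inv_fun t \<circ> inv_fun s \<in> supported (s ` (P \<union> C))" using supported_conj s by blast
  have "commutator t s v = t v" if "v \<in> P" for v
  proof -
    have "v \<notin> s ` (P \<union> C)" using that s by blast
    then have "(s \<circ> inv_fun t \<circ> inv_fun s) v = v" using st supportedD(2) by blast
    then show ?thesis by (simp add: commutator_def)
  qed
  then have "commutator t s ` P \<subseteq> C" using t by auto
  then show ?thesis using that commutator_in_commutator_group t s by blast
qed

text \<open>
  The commutator subgroup still moves every proper set into every nonempty one. If \<open>V\<close> lies inside \<open>P\<close>,
  two moves through a set outside \<open>P\<close> are needed, as a single compression wants disjoint sets.
\<close>

lemma derived_moves_into: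
  assumes P: "P \<in> \<B>" "P \<noteq> X" and V: "V \<in> \<B>" "V \<noteq> {}"
  obtains t where "t \<in> commutator_group" "t ` P \<subseteq> V"
proof (cases "P = {}")
  case True
  then show ?thesis using that commutator_in_commutator_group id_mem by blast
next
  case False
  show ?thesis
  proof (cases "V \<subseteq> P")
    case False
    then have "V - P \<in> \<B>" "V - P \<noteq> {}" using clopen_Diff P V by auto
    then obtain C C' where C: "C \<in> \<B>" "C \<noteq> {}" "C' \<noteq> {}" "C \<inter> C' = {}" "C \<union> C' = V - P"
      using split_clopen by metis
    then have "P \<inter> C = {}" "P \<union> C \<noteq> X" using clopen_subset[OF V(1)] by blast+
    then show ?thesis using compress_derived[OF P(1) C(1) \<open>P \<noteq> {}\<close> C(2)] that C(5)
      by (metis Diff_subset Un_upper1 order_trans)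
  next
    case True
    have "X - P \<in> \<B>" "X - P \<noteq> {}" using clopen_Diff space_mem P clopen_subset by auto
    then obtain C C' where C: "C \<in> \<B>" "C \<noteq> {}" "C' \<noteq> {}" "C \<inter> C' = {}" "C \<union> C' = X - P"
      using split_clopen by metis
    then have "P \<inter> C = {}" "P \<union> C \<noteq> X" by blast+
    then obtain t1 where t1: "t1 \<in> commutator_group" "t1 ` P \<subseteq> C"
      using compress_derived[OF P(1) C(1) \<open>P \<noteq> {}\<close> C(2)] by metis
    have "C \<inter> V = {}" "C \<union> V \<noteq> X" using C True by blast+
    then obtain t2 where t2: "t2 \<in> commutator_group" "t2 ` C \<subseteq> V"
      using compress_derived[OF C(1) V(1) C(2) V(2)] by metis
    have "(t2 \<circ> t1) ` P \<subseteq> V" using t1 t2 by auto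
    then show ?thesis using that commutator_group_comp t1 t2 by blast
  qed
qed

text \<open>
  The heart of the simplicity proof: a nontrivial normal subgroup \<open>N\<close> of the commutator subgroup
  contains every commutator of \<open>F\<close>. Normality is only available under conjugation by the commutator
  subgroup, so the elements \<open>f\<close> and \<open>h\<close> are first replaced by the commutators \<open>f'\<close> and \<open>h'\<close>.
\<close>

lemma normal_contains_commutators:
  assumes sub: "N \<subseteq> commutator_group"
    and cmp: "\<And>m n. m \<in> N \<Longrightarrow> n \<in> N \<Longrightarrow> m \<circ> n \<in> N"
    and iv: "\<And>n. n \<in> N \<Longrightarrow> inv_fun n \<in> N"
    and conj: "\<And>n f. n \<in> N \<Longrightarrow> f \<in> commutator_group \<Longrightarrow> f \<circ> n \<circ> inv_fun f \<in> N"
    and g: "g \<in> N" "g \<noteq> id"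
    and fh: "f \<in> F" "h \<in> F"
  shows "commutator f h \<in> N"
proof -
  have gF: "g \<in> F" using g sub commutator_group_mem by blast
  have invD: "inv_fun n \<in> commutator_group" if "n \<in> commutator_group" for n
    using subgroup.m_inv_closed[OF subgroup_commutator_group that]
      m_inv_permutation_group[OF commutator_group_mem[OF that]] by simp
  have commN: "commutator n f \<in> N" if "n \<in> N" "f \<in> commutator_group" for n f
  proof -
    have "commutator n f = n \<circ> (f \<circ> inv_fun n \<circ> inv_fun f)" by (simp add: commutator_def comp_assoc)
    then show ?thesis using cmp[OF that(1) conj[OF iv[OF that(1)] that(2)]] by simp
  qed
  obtain B where B: "B \<in> \<B>" "B \<noteq> {}" "g ` B \<inter> B = {}" using displaced[OF gF g(2)] by blast
  obtain V W where V: "V \<in> \<B>" "V \<noteq> {}" and W: "W \<in> \<B>" "W \<noteq> {}" "V \<inter> W = {}" "V \<union> W = B"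
    using split_clopen[OF B(1,2)] by metis
  obtain P1 P2 where P12: "P1 \<in> \<B>" "P2 \<in> \<B>" "P1 \<noteq> {}" "P2 \<noteq> {}" "P1 \<inter> P2 = {}" "P1 \<union> P2 = W"
    using split_clopen[OF W(1,2)] by metis
  \<comment> \<open>\<open>B\<close> is cut into \<open>V\<close>, which carries \<open>f\<close> and \<open>h\<close>, and \<open>P1\<close>, \<open>P2\<close>, which give room for conjugates of each.\<close>
  have base: "commutator f h \<in> N" if f: "f \<in> supported V" and h: "h \<in> supported V" for f h
  proof -
    have fF: "f \<in> F" and hF: "h \<in> F" using f h supportedD by auto
    obtain t where t: "t \<in> F" "t ` V \<subseteq> P1"
      using compress[OF V(1) P12(1) V(2) P12(3)] P12 W by blast
    obtain s where s: "s \<in> F" "s ` V \<subseteq> P2"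
      using compress[OF V(1) P12(2) V(2) P12(4)] P12 W by blast
    define e1 where "e1 = t \<circ> inv_fun f \<circ> inv_fun t"
    define e2 where "e2 = s \<circ> inv_fun h \<circ> inv_fun s"
    have e1: "e1 \<in> supported P1" unfolding e1_def
      using supported_mono[OF supported_conj[OF supported_inv[OF f] t(1)] t(2)] .
    have e2: "e2 \<in> supported P2" unfolding e2_def
      using supported_mono[OF supported_conj[OF supported_inv[OF h] s(1)] s(2)] .
    have eF: "e1 \<in> F" "e2 \<in> F" using e1 e2 supportedD by auto
    define f' where "f' = commutator f t"
    define h' where "h' = commutator h s"
    have f'eq: "f' = f \<circ> e1" and h'eq: "h' = h \<circ> e2"
      by (simp_all add: f'_def h'_def e1_def e2_def commutator_def comp_assoc)
    have D: "f' \<in> commutator_group" "h' \<in> commutator_group"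
      using fF hF t s commutator_in_commutator_group by (simp_all add: f'_def h'_def)
    have F': "f' \<in> F" "h' \<in> F" using D commutator_group_mem by auto
    have "f' \<in> supported B" "h' \<in> supported B"
      unfolding f'eq h'eq using e1 e2 f h P12 W
      by (meson Un_upper1 Un_upper2 order_trans subsetI supported_comp supported_mono equalityD1)+
    note sB = this
    \<comment> \<open>\<open>f'\<close> is replaced by the commutator of \<open>f'\<close> and \<open>g\<close>, which lies in \<open>N\<close>: the extra factor lives on \<open>g ` B\<close>.\<close>
    define c where "c = g \<circ> inv_fun f' \<circ> inv_fun g"
    have c: "c \<in> supported (g ` B)" unfolding c_def
      using supported_conj[OF supported_inv[OF sB(1)] gF] .
    have cF: "c \<in> F" using c supportedD by auto
    have "commutator f' g \<in> N"
    proof -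
      have "commutator f' g = inv_fun (commutator g f')" using commutator_inv F' gF by simp
      then show ?thesis using commN[OF g(1) D(1)] iv by simp
    qed
    moreover have "commutator f' g = f' \<circ> c" by (simp add: c_def commutator_def comp_assoc)
    ultimately have "commutator (f' \<circ> c) h' \<in> N" using commN D by simp
    then have "commutator f' h' \<in> N"
      using commutator_left_absorb[OF F'(1) cF F'(2) disjoint_support_commute[OF c sB(2) B(3)]] by simp
    moreover have "commutator f' h' = commutator f h"
    proof -
      have "e1 \<circ> h' = h' \<circ> e1"
      proof (rule disjoint_support_commute[OF e1])
        show "h' \<in> supported (V \<union> P2)" unfolding h'eq
          using e2 h supported_comp supported_mono by (meson Un_upper1 Un_upper2)
        show "P1 \<inter> (V \<union> P2) = {}" using P12 W by blast
      qed
      then have "commutator f' h' = commutator f h'"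
        unfolding f'eq using commutator_left_absorb fF eF F' by blast
      moreover have "e2 \<circ> f = f \<circ> e2"
        by (rule disjoint_support_commute[OF e2 f]) (use P12 W in blast)
      ultimately show ?thesis unfolding h'eq using commutator_right_absorb fF hF eF by metis
    qed
    ultimately show ?thesis by simp
  qed
  \<comment> \<open>Conjugation by the commutator subgroup spreads this from \<open>V\<close> to all proper sets.\<close>
  have proper: "commutator f h \<in> N"
    if P: "P \<in> \<B>" "P \<noteq> X" and f: "f \<in> supported P" and h: "h \<in> supported P" for f h P
  proof -
    have fF: "f \<in> F" and hF: "h \<in> F" using f h supportedD by auto
    obtain t where t: "t \<in> commutator_group" "t ` P \<subseteq> V" using derived_moves_into[OF P V] by metis
    have tF: "t \<in> F" using t commutator_group_mem by blast
    have "t \<circ> f \<circ> inv_fun t \<in> supported V" "t \<circ> h \<circ> inv_fun t \<in> supported V"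
      using supported_mono[OF supported_conj[OF _ tF] t(2)] f h by auto
    then have "t \<circ> commutator f h \<circ> inv_fun t \<in> N"
      using base commutator_conj[OF fF hF tF] by simp
    from conj[OF this invD[OF t(1)]] show ?thesis
      using tF by (simp add: fun_eq_iff comp_def)
  qed
  have idN: "id \<in> N"
  proof -
    have "g \<circ> inv_fun g = id" using inv_apply_right[OF gF] by (simp add: fun_eq_iff)
    then show ?thesis using cmp[OF g(1) iv[OF g(1)]] by simp
  qed
  have "n \<in> local_commutators \<Longrightarrow> n \<in> N" for n
  proof (induction rule: local_commutators.induct)
    case id
    show ?case by (rule idN)
  next
    case (step n P f h)
    show ?case by (rule cmp[OF step(6) proper[OF step(2-5)]])
  qed
  then show ?thesis using commutator_in_local_commutators fh by blast
qed

text \<open>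
  If \<open>t\<close> moves \<open>A\<close> into \<open>B\<close> and \<open>s\<close> moves \<open>B\<close> into \<open>C\<close> while fixing \<open>A\<close>, then \<open>s\<close> and \<open>t\<close> do not commute.
\<close>

lemma commutator_group_nontrivial: "commutator_group \<noteq> {id}"
proof
  assume triv: "commutator_group = {id}"
  obtain A Y where A: "A \<in> \<B>" "A \<noteq> {}" and Y: "Y \<in> \<B>" "Y \<noteq> {}" "A \<inter> Y = {}"
    using split_clopen[OF space_mem space_nonempty] by metis
  obtain B C where B: "B \<in> \<B>" "B \<noteq> {}" and C: "C \<in> \<B>" "C \<noteq> {}" "B \<inter> C = {}" "B \<union> C = Y"
    using split_clopen[OF Y(1,2)] by metis
  obtain t where t: "t \<in> F" "t ` A \<subseteq> B" using compress[OF A(1) B(1) A(2) B(2)] C Y by blast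
  obtain s where s: "s \<in> F" "s ` B \<subseteq> C" "\<forall>v. v \<notin> B \<union> C \<longrightarrow> s v = v"
    using compress[OF B(1) C(1) B(2) C(2)] C by blast
  obtain v where v: "v \<in> A" using A by blast
  have "commutator s t = id" using triv commutator_in_commutator_group s t by blast
  then have "commutator s t (t v) = t v" by simp
  moreover have "commutator s t (t v) = s (t (inv_fun s v))" using s t by (simp add: commutator_def)
  moreover have "s v = v" using s v C Y by blast
  then have "inv_fun s v = v" using s(1) by (metis inv_apply_left)
  ultimately have "s (t v) = t v" by simp
  then show False using s t v C by blast
qed

theorem simple_commutator_group:
  "is_simple ((permutation_group F)\<lparr>carrier := derived (permutation_group F) F\<rparr>)"
proof -
  define D where "D = (permutation_group F)\<lparr>carrier := commutator_group\<rparr>"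
  have gD: "group D" unfolding D_def
    by (rule group.subgroup_imp_group[OF group_permutation_group subgroup_commutator_group])
  have Dsimps: "carrier D = commutator_group" "\<one>\<^bsub>D\<^esub> = id" "mult D = (\<circ>)"
    by (simp_all add: D_def permutation_group_def)
  have Dinv: "inv\<^bsub>D\<^esub> f = inv_fun f" if "f \<in> commutator_group" for f
    using group.m_inv_consistent[OF group_permutation_group subgroup_commutator_group that]
      m_inv_permutation_group[OF commutator_group_mem[OF that]] by (simp add: D_def)
  have "N = carrier D" if N: "N \<lhd> D" and ne: "N \<noteq> {\<one>\<^bsub>D\<^esub>}" for N
  proof -
    have sN: "subgroup N D" using N by (simp add: normal_imp_subgroup)
    have sub: "N \<subseteq> commutator_group" using subgroup.subset[OF sN] Dsimps by simp
    have "\<one>\<^bsub>D\<^esub> \<in> N" using subgroup.one_closed[OF sN] .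
    then obtain g where g: "g \<in> N" "g \<noteq> id" using ne Dsimps by auto
    have "commutator f h \<in> N" if "f \<in> F" "h \<in> F" for f h
    proof (rule normal_contains_commutators[OF sub _ _ _ g that])
      fix m n assume "m \<in> N" "n \<in> N"
      then show "m \<circ> n \<in> N" using subgroup.m_closed[OF sN] Dsimps by metis
    next
      fix n assume "n \<in> N"
      then show "inv_fun n \<in> N" using subgroup.m_inv_closed[OF sN] Dinv sub by fastforce
    next
      fix n f assume "n \<in> N" "f \<in> commutator_group"
      then show "f \<circ> n \<circ> inv_fun f \<in> N"
        using normal.inv_op_closed2[OF N] Dinv Dsimps by metis
    qed
    moreover have "subgroup N (permutation_group F)"
      using group.incl_subgroup[OF group_permutation_group subgroup_commutator_group] sN
      unfolding D_def by blast
    ultimately show ?thesis using commutator_group_least sub Dsimps by blast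
  qed
  then have "is_simple D"
    unfolding is_simple_def using gD commutator_group_nontrivial Dsimps by auto
  then show ?thesis by (simp add: D_def commutator_group_def)
qed

end

section \<open>Degrees and prefixes\<close>

lemma vec_add_diff: "(m :: nat ^ 'k) \<le> n \<Longrightarrow> m + (n - m) = n"
  by (simp add: less_eq_vec_def vec_eq_iff)

lemma vec_le_add [simp]: "(m :: nat ^ 'k) \<le> m + n"
  by (simp add: less_eq_vec_def)

lemma vec_le_add2 [simp]: "(m :: nat ^ 'k) \<le> n + m"
  by (simp add: less_eq_vec_def)

lemma vec_zero_le [simp]: "(0 :: nat ^ 'k) \<le> n"
  by (simp add: less_eq_vec_def)

lemma vec_add_diff_cancel [simp]: "(m :: nat ^ 'k) + n - m = n"
  by (simp add: vec_eq_iff)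

lemma vec_diff_add_cancel: "(m :: nat ^ 'k) + p \<le> n + p \<longleftrightarrow> m \<le> n" "(n + p) - (m + p) = n - m"
  by (simp_all add: less_eq_vec_def vec_eq_iff)

lemma vec_le_const: "\<exists>j. (n :: nat ^ 'k) \<le> vec j"
proof -
  have "n $ i \<le> (\<Sum>i \<in> UNIV. n $ i)" for i by (rule member_le_sum) auto
  then have "n \<le> vec (\<Sum>i \<in> UNIV. n $ i)" by (simp add: less_eq_vec_def)
  then show ?thesis ..
qed

lemma finite_vec_bounded:
  assumes "finite A"
  shows "\<exists>n :: nat ^ 'k. \<forall>a \<in> A. f a \<le> n"
  using assms
proof (induction rule: finite_induct)
  case (insert a A)
  then obtain n where n: "\<forall>a \<in> A. f a \<le> n" by blast
  have "f b \<le> n + f a" if "b \<in> insert a A" for b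
    using that n vec_le_add2[of "f a" n] order_trans[OF _ vec_le_add[of n "f a"]] by auto
  then show ?case by blast
qed simp

lemma int_vec_inject: "int_vec m = int_vec n \<longleftrightarrow> m = n"
  by (simp add: int_vec_def vec_eq_iff)

lemma int_vec_add: "int_vec (m + n) = int_vec m + int_vec n"
  by (simp add: int_vec_def vec_eq_iff)

context k_monoid
begin

lemma factor:
  assumes "x \<in> carrier S" "m \<le> d x"
  obtains y z where "y \<in> carrier S" "z \<in> carrier S" "x = y \<otimes> z" "d y = m" "d z = d x - m"
  using unique_factorization[OF assms(1), of m "d x - m"] vec_add_diff[OF assms(2)] that by auto

text \<open>
  This form of unique factorization is the source of all cancellation arguments: a product together
  with the degree of its left factor determines both factors.
\<close>

lemma factor_unique:
  assumes "y \<in> carrier S" "z \<in> carrier S" "y' \<in> carrier S" "z' \<in> carrier S"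
    and eq: "y \<otimes> z = y' \<otimes> z'" and deg: "d y = d y'"
  shows "y = y'" "z = z'"
proof -
  have "d y + d z = d y' + d z'" using degree_mult[OF assms(1,2)] degree_mult[OF assms(3,4)] eq by simp
  then have "d z = d z'" using deg by simp
  define Q where "Q p \<longleftrightarrow> (case p of (x1, x2) \<Rightarrow> x1 \<in> carrier S \<and> x2 \<in> carrier S \<and>
    y \<otimes> z = x1 \<otimes> x2 \<and> d x1 = d y \<and> d x2 = d z)" for p
  have "\<exists>!p. Q p" unfolding Q_def
    by (rule unique_factorization) (simp_all add: assms(1,2) degree_mult)
  moreover have "Q (y, z)" "Q (y', z')" using assms \<open>d z = d z'\<close> by (simp_all add: Q_def)
  ultimately have "(y, z) = (y', z')" by blast
  then show "y = y'" "z = z'" by auto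
qed

lemma left_cancel: "\<lbrakk>x \<in> carrier S; y \<in> carrier S; z \<in> carrier S; x \<otimes> y = x \<otimes> z\<rbrakk> \<Longrightarrow> y = z"
  using factor_unique(2)[of x y x z] by blast

lemma degree_zero: "x \<in> carrier S \<Longrightarrow> d x = 0 \<Longrightarrow> x = \<one>"
  using factor_unique(1)[of x \<one> \<one> x] degree_one by simp

definition is_prefix :: "'s \<Rightarrow> 's \<Rightarrow> bool"  (infix \<open>\<preceq>\<close> 50)
  where "x \<preceq> y \<longleftrightarrow> (\<exists>s \<in> carrier S. y = x \<otimes> s)"

lemma prefixI: "s \<in> carrier S \<Longrightarrow> x \<preceq> x \<otimes> s"
  by (auto simp: is_prefix_def)

lemma prefix_refl: "x \<in> carrier S \<Longrightarrow> x \<preceq> x"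
  using prefixI[OF one_closed, of x] by simp

lemma prefix_trans: "x \<in> carrier S \<Longrightarrow> x \<preceq> y \<Longrightarrow> y \<preceq> z \<Longrightarrow> x \<preceq> z"
  unfolding is_prefix_def by (metis m_assoc m_closed)

lemma prefix_degree: "x \<in> carrier S \<Longrightarrow> x \<preceq> y \<Longrightarrow> d x \<le> d y"
  by (auto simp: is_prefix_def degree_mult)

text \<open>
  Unlike for words, two prefixes of the same element are comparable only if their degrees are.
\<close>

lemma prefix_total:
  assumes "x \<in> carrier S" "y \<in> carrier S" "x \<preceq> z" "y \<preceq> z" "d x \<le> d y"
  shows "x \<preceq> y"
proof -
  obtain s t where st: "s \<in> carrier S" "t \<in> carrier S" "z = x \<otimes> s" "z = y \<otimes> t"
    using assms by (auto simp: is_prefix_def)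
  obtain x' s' where f: "x' \<in> carrier S" "s' \<in> carrier S" "y = x' \<otimes> s'" "d x' = d x"
    using factor[OF assms(2,5)] by metis
  have "x \<otimes> s = x' \<otimes> (s' \<otimes> t)" using st f m_assoc by metis
  then have "x = x'" using factor_unique(1)[of x s x' "s' \<otimes> t"] f st assms by simp
  then show ?thesis using f by (auto simp: is_prefix_def)
qed

lemma prefix_unique:
  assumes "x \<in> carrier S" "y \<in> carrier S" "x \<preceq> z" "y \<preceq> z" "d x = d y"
  shows "x = y"
  using assms factor_unique(1) unfolding is_prefix_def by metis

definition level :: "nat ^ 'k \<Rightarrow> 's set"
  where "level n = {x \<in> carrier S. d x = n}"

lemma levelD: "x \<in> level n \<Longrightarrow> x \<in> carrier S" "x \<in> level n \<Longrightarrow> d x = n"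
  by (auto simp: level_def)

lemma level_zero: "level 0 = {\<one>}"
  using degree_zero degree_one by (auto simp: level_def)

lemma level_mult: "x \<in> level m \<Longrightarrow> y \<in> level n \<Longrightarrow> x \<otimes> y \<in> level (m + n)"
  by (auto simp: level_def degree_mult)

lemma level_prefix:
  assumes "x \<in> level n" "m \<le> n"
  obtains y s where "y \<in> level m" "s \<in> level (n - m)" "x = y \<otimes> s"
proof -
  have x: "x \<in> carrier S" "d x = n" using assms levelD by auto
  have "m \<le> d x" using x assms by simp
  then obtain y s where "y \<in> carrier S" "s \<in> carrier S" "x = y \<otimes> s" "d y = m" "d s = d x - m"
    by (rule factor[OF x(1)])
  then show ?thesis using that x(2) by (simp add: level_def)
qed

lemma level_add: "level (m + n) = (\<lambda>(x, y). x \<otimes> y) ` (level m \<times> level n)"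
proof
  show "level (m + n) \<subseteq> (\<lambda>(x, y). x \<otimes> y) ` (level m \<times> level n)"
  proof
    fix x assume x: "x \<in> level (m + n)"
    obtain y s where "y \<in> level m" "s \<in> level (m + n - m)" "x = y \<otimes> s"
      using level_prefix[OF x vec_le_add] by metis
    then show "x \<in> (\<lambda>(x, y). x \<otimes> y) ` (level m \<times> level n)" by force
  qed
  show "(\<lambda>(x, y). x \<otimes> y) ` (level m \<times> level n) \<subseteq> level (m + n)"
    using level_mult by auto
qed

lemma inj_on_level_mult: "inj_on (\<lambda>(x, y). x \<otimes> y) (level m \<times> level n)"
proof (rule inj_onI, clarify)
  fix x y x' y' assume "x \<in> level m" "y \<in> level n" "x' \<in> level m" "y' \<in> level n" "x \<otimes> y = x' \<otimes> y'"
  then show "x = x' \<and> y = y'" using factor_unique[of x y x' y'] by (simp add: level_def)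
qed

lemma card_level_add: "card (level (m + n)) = card (level m) * card (level n)"
  unfolding level_add by (simp add: card_image[OF inj_on_level_mult] card_cartesian_product)

section \<open>Tilings\<close>

abbreviation X :: "('k, 's) tiling set"
  where "X \<equiv> tilings S d"

lemma tiling_closed: "w \<in> X \<Longrightarrow> m \<le> n \<Longrightarrow> w (m, n) \<in> carrier S"
  by (auto simp: tilings_def le_pairs_def)

lemma tiling_degree: "w \<in> X \<Longrightarrow> m \<le> n \<Longrightarrow> d (w (m, n)) = n - m"
  by (auto simp: tilings_def)

lemma tiling_mult: "w \<in> X \<Longrightarrow> m \<le> n \<Longrightarrow> n \<le> p \<Longrightarrow> w (m, n) \<otimes> w (n, p) = w (m, p)"
  by (auto simp: tilings_def)

lemma head_level [simp]: "w \<in> X \<Longrightarrow> w (0, n) \<in> level n"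
  by (simp add: level_def tiling_closed tiling_degree)

lemma head_closed [simp]: "w \<in> X \<Longrightarrow> w (0, n) \<in> carrier S"
  by (simp add: tiling_closed)

lemma head_degree [simp]: "w \<in> X \<Longrightarrow> d (w (0, n)) = n"
  by (simp add: tiling_degree)

lemma head_mono: "w \<in> X \<Longrightarrow> m \<le> n \<Longrightarrow> w (0, m) \<preceq> w (0, n)"
  using prefixI[OF tiling_closed[of w m n], of "w (0, m)"] tiling_mult[of w 0 m n] by simp

lemma head_eq_mono:
  assumes "w \<in> X" "v \<in> X" "w (0, n) = v (0, n)" "m \<le> n"
  shows "w (0, m) = v (0, m)"
  using prefix_unique[of "w (0, m)" "v (0, m)" "w (0, n)"] head_mono[OF assms(1,4)]
    head_mono[OF assms(2,4)] assms by simp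

text \<open>
  A tiling is determined by the elements \<open>w (0, n)\<close> for all large \<open>n\<close>; these are the prefixes of \<open>w\<close>.
\<close>

lemma tiling_eqI:
  assumes w: "w \<in> X" and v: "v \<in> X" and eq: "\<And>n. m \<le> n \<Longrightarrow> w (0, n) = v (0, n)"
  shows "w = v"
proof -
  have head: "w (0, n) = v (0, n)" for n
    using head_eq_mono[OF w v eq[of "m + n"]] by simp
  have "w (m, n) = v (m, n)" if "m \<le> n" for m n
  proof (rule left_cancel[of "w (0, m)"])
    show "w (0, m) \<otimes> w (m, n) = w (0, m) \<otimes> v (m, n)"
      using tiling_mult[OF w vec_zero_le that] tiling_mult[OF v vec_zero_le that] head by simp
  qed (use w v that tiling_closed in auto)
  moreover have "w \<in> extensional le_pairs" "v \<in> extensional le_pairs"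
    using w v by (auto simp: tilings_def PiE_def)
  ultimately show ?thesis
    by (intro extensionalityI[of w le_pairs v]) (auto simp: le_pairs_def)
qed

lemma shift_apply: "m \<le> n \<Longrightarrow> shift p w (m, n) = w (m + p, n + p)"
  by (simp add: shift_def le_pairs_def)

lemma shift_closed:
  assumes "w \<in> X"
  shows "shift p w \<in> X"
  unfolding tilings_def
proof (intro CollectI conjI allI impI)
  show "shift p w \<in> le_pairs \<rightarrow>\<^sub>E carrier S"
    using tiling_closed[OF assms]
    by (auto simp: shift_def le_pairs_def vec_diff_add_cancel split: if_splits)
  show "shift p w (m, m) = \<one>" for m using assms by (auto simp: shift_apply tilings_def)
  show "shift p w (m, n) \<otimes> shift p w (n, q) = shift p w (m, q)" if "m \<le> n \<and> n \<le> q" for m n q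
    using that tiling_mult[OF assms, of "m + p" "n + p" "q + p"] order_trans[of m n q]
    by (simp add: shift_apply vec_diff_add_cancel)
  show "d (shift p w (m, n)) = n - m" if "m \<le> n" for m n
    using that tiling_degree[OF assms, of "m + p" "n + p"]
    by (simp add: shift_apply vec_diff_add_cancel)
qed

lemma shift_shift: "shift p (shift q w) = shift (p + q) w"
  by (rule ext) (auto simp: shift_def le_pairs_def vec_diff_add_cancel ac_simps split: prod.split)

lemma shift_head: "w \<in> X \<Longrightarrow> w (0, m) \<otimes> shift m w (0, n) = w (0, m + n)"
  using tiling_mult[of w 0 m "m + n"] by (simp add: shift_apply add.commute)

text \<open>
  Conversely, any coherent family of prefixes comes from a tiling; \<open>w (m, n)\<close> is the cofactor of the
  prefix of degree \<open>m\<close> in the one of degree \<open>n\<close>.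
\<close>

lemma tiling_of_heads:
  assumes f: "\<And>n. f n \<in> level n" and mono: "\<And>m n. m \<le> n \<Longrightarrow> f m \<preceq> f n"
  obtains w where "w \<in> X" "\<And>n. w (0, n) = f n"
proof -
  define g where "g m n = (SOME s. s \<in> carrier S \<and> f n = f m \<otimes> s)" for m n
  have g: "g m n \<in> carrier S \<and> f n = f m \<otimes> g m n" if "m \<le> n" for m n
  proof -
    have "\<exists>s. s \<in> carrier S \<and> f n = f m \<otimes> s" using mono[OF that] by (auto simp: is_prefix_def)
    then show ?thesis unfolding g_def by (rule someI_ex)
  qed
  have fS: "f n \<in> carrier S" "d (f n) = n" for n using f levelD by blast+
  define w where "w = restrict (\<lambda>(m, n). g m n) le_pairs"
  have w_app: "w (m, n) = g m n" if "m \<le> n" for m n using that by (simp add: w_def le_pairs_def)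
  have w: "w \<in> X" unfolding tilings_def
  proof (intro CollectI conjI allI impI)
    show "w \<in> le_pairs \<rightarrow>\<^sub>E carrier S" using g by (auto simp: w_def le_pairs_def split: if_splits)
    show "w (m, m) = \<one>" for m
      using left_cancel[of "f m" "g m m" \<one>] g[of m m] fS by (simp add: w_app)
    show "w (m, n) \<otimes> w (n, p) = w (m, p)" if a: "m \<le> n \<and> n \<le> p" for m n p
    proof -
      have le: "m \<le> p" using a by auto
      have "f m \<otimes> (g m n \<otimes> g n p) = f p"
        using a g[of m n] g[of n p] fS by (simp flip: m_assoc)
      then have "f m \<otimes> (g m n \<otimes> g n p) = f m \<otimes> g m p" using g[OF le] by simp
      then show ?thesis using a le left_cancel[of "f m"] g fS by (simp add: w_app)
    qed
    show "d (w (m, n)) = n - m" if "m \<le> n" for m n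
    proof -
      have "n = m + d (g m n)" using g[OF that] fS degree_mult by metis
      then show ?thesis using that by (metis vec_add_diff_cancel w_app)
    qed
  qed
  moreover have "w (0, n) = f n" for n
  proof -
    have "f 0 = \<one>" using f[of 0] level_zero by simp
    then show ?thesis using g[of 0 n] by (simp add: w_app)
  qed
  ultimately show ?thesis using that by blast
qed

text \<open>
  The constant degrees \<open>vec j\<close> are cofinal, so a chain of elements of these degrees suffices; the prefix of
  degree \<open>n\<close> is cut out of any \<open>c j\<close> with \<open>n \<le> vec j\<close>.
\<close>

lemma tiling_of_chain:
  assumes c: "\<And>j. c j \<in> level (vec j)" and chain: "\<And>j. c j \<preceq> c (Suc j)"
  obtains w where "w \<in> X" "\<And>j. w (0, vec j) = c j"
proof -
  have cS: "c j \<in> carrier S" "d (c j) = vec j" for j using c levelD by blast+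
  have mono: "c i \<preceq> c j" if "i \<le> j" for i j
    using that
  proof (induction rule: dec_induct)
    case base then show ?case using prefix_refl cS by simp
  next
    case (step n) then show ?case using prefix_trans chain cS by blast
  qed
  have "\<exists>y. y \<in> level n \<and> (\<forall>j. n \<le> vec j \<longrightarrow> y \<preceq> c j)" for n
  proof -
    obtain i where i: "n \<le> vec i" using vec_le_const by blast
    obtain y s where y: "y \<in> level n" "s \<in> carrier S" "c i = y \<otimes> s"
      using level_prefix[OF c i] levelD by metis
    have yi: "y \<preceq> c i" using y prefixI by simp
    have "y \<preceq> c j" if nj: "n \<le> vec j" for j
    proof (cases "i \<le> j")
      case True then show ?thesis using prefix_trans[OF _ yi mono] y levelD by blast
    next
      case False
      then have "c j \<preceq> c i" using mono by simp
      then show ?thesis using prefix_total[OF _ _ yi] y levelD cS nj by metis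
    qed
    then show ?thesis using y by blast
  qed
  then obtain f where f: "\<And>n. f n \<in> level n" "\<And>n j. n \<le> vec j \<Longrightarrow> f n \<preceq> c j" by metis
  have fS: "f n \<in> carrier S" "d (f n) = n" for n using f levelD by blast+
  have "f m \<preceq> f n" if mn: "m \<le> n" for m n
  proof -
    obtain j where j: "n \<le> vec j" using vec_le_const by blast
    show ?thesis using prefix_total[OF _ _ f(2)[OF order_trans[OF mn j]] f(2)[OF j]] fS mn by simp
  qed
  then obtain w where w: "w \<in> X" "\<And>n. w (0, n) = f n" using tiling_of_heads f(1) by metis
  have "f (vec j) = c j" for j
    using prefix_unique[of "f (vec j)" "c j" "c j"] f(2)[of "vec j" j] prefix_refl fS cS by simp
  then show ?thesis using that w by simp
qed

lemma tiling_split_unique: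
  assumes "v \<in> X" "v' \<in> X" "v (0, m) = v' (0, m)" "shift m v = shift m v'"
  shows "v = v'"
proof (rule tiling_eqI[OF assms(1,2), of m])
  fix n assume "m \<le> n"
  then show "v (0, n) = v' (0, n)"
    using shift_head[OF assms(1), of m "n - m"] shift_head[OF assms(2), of m "n - m"] assms
    by (simp add: vec_add_diff)
qed

text \<open>
  The prefix of degree \<open>n\<close> of \<open>aw\<close> is the prefix of degree \<open>n\<close> of \<open>a \<otimes> w (0, n)\<close>, whose degree is at least \<open>n\<close>.
\<close>

lemma prepend_exists:
  assumes a: "a \<in> carrier S" and w: "w \<in> X"
  obtains v where "v \<in> X" "v (0, d a) = a" "shift (d a) v = w"
proof -
  have "\<exists>y. y \<in> level n \<and> y \<preceq> a \<otimes> w (0, n)" for n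
  proof -
    have "a \<otimes> w (0, n) \<in> level (d a + n)" using a w by (simp add: level_def degree_mult)
    then obtain y s where "y \<in> level n" "s \<in> carrier S" "a \<otimes> w (0, n) = y \<otimes> s"
      using level_prefix[of _ "d a + n" n] levelD by (metis vec_le_add2)
    then show ?thesis using prefixI by metis
  qed
  then obtain f where f: "\<And>n. f n \<in> level n" "\<And>n. f n \<preceq> a \<otimes> w (0, n)" by metis
  have fS: "f n \<in> carrier S" "d (f n) = n" for n using f levelD by blast+
  have aw: "a \<otimes> w (0, m) \<preceq> a \<otimes> w (0, n)" if "m \<le> n" for m n
    using head_mono[OF w that] a w unfolding is_prefix_def by (metis head_closed m_assoc)
  have mono: "f m \<preceq> f n" if "m \<le> n" for m n
    using prefix_total[OF _ _ prefix_trans[OF _ f(2) aw[OF that]] f(2)] fS that by simp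
  obtain v where v: "v \<in> X" "\<And>n. v (0, n) = f n" using tiling_of_heads f(1) mono by metis
  have fa: "f (d a + n) = a \<otimes> w (0, n)" for n
    using prefix_unique[OF _ _ f(2) aw[of n "d a + n"]] fS a w by (simp add: degree_mult)
  have fa0: "f (d a) = a" using fa[of 0] head_level[OF w, of 0] a by (simp add: level_zero)
  have "shift (d a) v = w"
  proof (rule tiling_eqI[OF shift_closed[OF v(1)] w])
    fix n
    have "a \<otimes> shift (d a) v (0, n) = a \<otimes> w (0, n)" using shift_head[OF v(1), of "d a" n] v fa fa0 by simp
    then show "shift (d a) v (0, n) = w (0, n)" using left_cancel a w v shift_closed by (metis head_closed)
  qed
  then show ?thesis using that v fa0 by simp
qed

abbreviation prepended :: "'s \<Rightarrow> ('k, 's) tiling \<Rightarrow> ('k, 's) tiling"  (infixr \<open>\<rhd>\<close> 75)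
  where "a \<rhd> w \<equiv> prepend S d a w"

lemma prepend_props:
  assumes "a \<in> carrier S" "w \<in> X"
  shows "a \<rhd> w \<in> X" "(a \<rhd> w) (0, d a) = a" "shift (d a) (a \<rhd> w) = w"
proof -
  have "\<exists>!v. v \<in> X \<and> v (0, d a) = a \<and> shift (d a) v = w"
    using prepend_exists[OF assms] tiling_split_unique by metis
  from theI'[OF this] show "a \<rhd> w \<in> X" "(a \<rhd> w) (0, d a) = a" "shift (d a) (a \<rhd> w) = w"
    unfolding prepend_def by auto
qed

lemmas prepend_closed [simp] = prepend_props(1)

lemma prepend_eqI:
  "\<lbrakk>a \<in> carrier S; v \<in> X; v (0, d a) = a; shift (d a) v = w\<rbrakk> \<Longrightarrow> a \<rhd> w = v"
  using tiling_split_unique prepend_props shift_closed by metis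

lemma head_shift: "v \<in> X \<Longrightarrow> v (0, n) \<rhd> shift n v = v"
  by (rule prepend_eqI) simp_all

lemma prepend_head_add: "a \<in> carrier S \<Longrightarrow> w \<in> X \<Longrightarrow> (a \<rhd> w) (0, d a + n) = a \<otimes> w (0, n)"
  using shift_head[of "a \<rhd> w" "d a" n] by (simp add: prepend_props)

lemma prepend_mult:
  assumes "a \<in> carrier S" "b \<in> carrier S" "w \<in> X"
  shows "(a \<otimes> b) \<rhd> w = a \<rhd> b \<rhd> w"
proof (rule prepend_eqI)
  show "(a \<rhd> b \<rhd> w) (0, d (a \<otimes> b)) = a \<otimes> b"
    using assms by (simp add: degree_mult prepend_head_add prepend_props)
  have "shift (d (a \<otimes> b)) (a \<rhd> b \<rhd> w) = shift (d b) (shift (d a) (a \<rhd> b \<rhd> w))"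
    using assms by (simp add: degree_mult shift_shift add.commute)
  then show "shift (d (a \<otimes> b)) (a \<rhd> b \<rhd> w) = w" using assms by (simp add: prepend_props)
qed (use assms in auto)

lemma prepend_one [simp]: "w \<in> X \<Longrightarrow> \<one> \<rhd> w = w"
proof (rule prepend_eqI)
  assume w: "w \<in> X"
  show "w (0, d \<one>) = \<one>" using head_level[OF w, of 0] by (simp add: degree_one level_zero)
  show "shift (d \<one>) w = w"
    using shift_head[OF w, of 0] head_level[OF w, of 0] w
    by (intro tiling_eqI[OF shift_closed]) (auto simp: degree_one level_zero shift_closed)
qed simp_all

lemma prepend_inject:
  assumes "a \<in> carrier S" "b \<in> carrier S" "w \<in> X" "v \<in> X" "a \<rhd> w = b \<rhd> v" "d a = d b"
  shows "a = b" "w = v"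
  using assms prepend_props by metis+

lemma prepend_inject_same [simp]:
  "a \<in> carrier S \<Longrightarrow> w \<in> X \<Longrightarrow> v \<in> X \<Longrightarrow> a \<rhd> w = a \<rhd> v \<longleftrightarrow> w = v"
  using prepend_inject by blast

lemma prepend_prefix: "a \<in> carrier S \<Longrightarrow> w \<in> X \<Longrightarrow> d a \<le> n \<Longrightarrow> a \<preceq> (a \<rhd> w) (0, n)"
  using head_mono[of "a \<rhd> w" "d a" n] by (simp add: prepend_props)

lemma refine:
  assumes "a \<in> carrier S" "w \<in> X" "d a \<le> n"
  obtains s w' where "s \<in> level (n - d a)" "w' \<in> X" "w = s \<rhd> w'" "(a \<rhd> w) (0, n) = a \<otimes> s"
proof
  show "w (0, n - d a) \<in> level (n - d a)" "shift (n - d a) w \<in> X" "w = w (0, n - d a) \<rhd> shift (n - d a) w"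
    using assms by (auto simp: shift_closed head_shift)
  show "(a \<rhd> w) (0, n) = a \<otimes> w (0, n - d a)"
    using prepend_head_add[OF assms(1,2), of "n - d a"] vec_add_diff[OF assms(3)] by simp
qed

text \<open>
  Two ways of writing one tiling as prefix and tail have a common refinement, whose prefix may have
  any degree \<open>n\<close> above the two given ones.
\<close>

lemma common_tail:
  assumes "a \<in> carrier S" "b \<in> carrier S" "w \<in> X" "v \<in> X" "a \<rhd> w = b \<rhd> v" "d a \<le> n" "d b \<le> n"
  obtains s t u where "s \<in> carrier S" "t \<in> carrier S" "u \<in> X" "w = s \<rhd> u" "v = t \<rhd> u"
    "a \<otimes> s = b \<otimes> t" "d (a \<otimes> s) = n"
proof -
  obtain s u where s: "s \<in> level (n - d a)" "u \<in> X" "w = s \<rhd> u" "(a \<rhd> w) (0, n) = a \<otimes> s"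
    using refine[OF assms(1,3,6)] by metis
  obtain t u' where t: "t \<in> level (n - d b)" "u' \<in> X" "v = t \<rhd> u'" "(b \<rhd> v) (0, n) = b \<otimes> t"
    using refine[OF assms(2,4,7)] by metis
  have st: "s \<in> carrier S" "t \<in> carrier S" using s t levelD by auto
  have eq: "a \<otimes> s = b \<otimes> t" using s t assms by simp
  have deg: "d (a \<otimes> s) = n" using assms st levelD(2)[OF s(1)] by (simp add: degree_mult vec_add_diff)
  have "(a \<otimes> s) \<rhd> u = (b \<otimes> t) \<rhd> u'"
    using prepend_mult[OF assms(1) st(1) s(2)] prepend_mult[OF assms(2) st(2) t(2)] assms s t by simp
  then have "u = u'" using eq assms st s t by simp
  then show ?thesis using that[OF st s(2,3) _ eq deg] t by simp
qed

end

locale branching_k_monoid = k_monoid S d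
  for S :: "('s, 'b) monoid_scheme" (structure) and d :: "'s \<Rightarrow> nat ^ 'k::finite" +
  assumes finite_alphabet: "finite (alphabet S d i)"
    and card_alphabet: "card (alphabet S d i) \<ge> 2"
begin

lemma alphabet_level: "alphabet S d i = level (axis i 1)"
  by (simp add: alphabet_def level_def)

text \<open>
  By unique factorization the number of elements of degree \<open>n\<close> is multiplicative in \<open>n\<close>, so it is the product of
  the alphabet sizes, each taken to the power \<open>n $ i\<close>; and these sizes are at least 2.
\<close>

lemma finite_card_level:
  fixes n :: "nat ^ 'k"
  shows "finite (level n) \<and> card (level n) \<ge> 2 ^ (\<Sum>i \<in> UNIV. n $ i)"
proof (induction "\<Sum>i \<in> UNIV. n $ i" arbitrary: n)
  case 0
  then have "n = 0" by (simp add: vec_eq_iff)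
  then show ?case using 0 by (simp add: level_zero)
next
  case (Suc k)
  then obtain i where "n $ i \<noteq> 0" by (metis (no_types, lifting) Zero_not_Suc sum.neutral)
  then have n: "n = axis i 1 + (n - axis i 1)" by (auto simp: vec_eq_iff axis_def)
  define m where "m = n - axis i 1"
  have n': "n = axis i 1 + m" using n by (simp add: m_def)
  have "(\<Sum>j \<in> UNIV. n $ j) = (\<Sum>j \<in> UNIV. axis i 1 $ j) + (\<Sum>j \<in> UNIV. m $ j)"
    unfolding n' by (simp add: sum.distrib)
  also have "(\<Sum>j \<in> UNIV. axis i 1 $ j) = (1::nat)" by (simp add: axis_def)
  finally have k: "k = (\<Sum>j \<in> UNIV. m $ j)" using Suc(2) by simp
  have IH: "finite (level m)" "card (level m) \<ge> 2 ^ k" using Suc(1)[OF k] k by auto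
  have fin: "finite (level n)"
    unfolding n' level_add using IH finite_alphabet[of i] by (simp add: alphabet_level)
  have "2 * 2 ^ k \<le> card (level (axis i 1)) * card (level m)"
    using IH card_alphabet[of i] by (intro mult_mono) (auto simp: alphabet_level)
  then have "2 ^ Suc k \<le> card (level n)" unfolding n' card_level_add by simp
  then show ?case using fin Suc(2) by metis
qed

lemma finite_level [simp]: "finite (level n)"
  using finite_card_level by blast

lemma level_nonempty: "level n \<noteq> {}"
proof
  assume "level n = {}"
  then have "2 ^ (\<Sum>i \<in> UNIV. n $ i) \<le> (0::nat)" using finite_card_level[of n] by simp
  then show False by simp
qed

lemma card_level_large: "card (level (vec j)) \<ge> j"
proof -
  define k where "k = (\<Sum>i \<in> (UNIV :: 'k set). (vec j :: nat ^ 'k) $ i)"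
  have "(vec j :: nat ^ 'k) $ i \<le> k" for i unfolding k_def by (rule member_le_sum) auto
  then have "j \<le> k" by simp
  also have "k < 2 ^ k" by (rule less_exp)
  also have "2 ^ k \<le> card (level (vec j))" using finite_card_level[of "vec j"] by (simp add: k_def)
  finally show ?thesis by simp
qed

lemma level_extend:
  obtains s where "s \<in> level n"
  using level_nonempty by blast

lemma tilings_nonempty: "X \<noteq> {}"
proof -
  obtain a where a: "a \<in> level (vec 1)" using level_nonempty by blast
  define c where "c j = ((\<lambda>x. x \<otimes> a) ^^ j) \<one>" for j
  have c: "c j \<in> level (vec j)" for j
  proof (induction j)
    case 0
    have "vec 0 = (0 :: nat ^ 'k)" by (simp add: vec_eq_iff)
    then show ?case by (simp add: c_def level_zero)
  next
    case (Suc j)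
    have "vec (Suc j) = vec j + (vec 1 :: nat ^ 'k)" by (simp add: vec_eq_iff)
    then show ?case using level_mult[OF Suc a] by (simp add: c_def)
  qed
  have "c j \<preceq> c (Suc j)" for j using prefixI levelD(1)[OF a] by (simp add: c_def)
  then show ?thesis using tiling_of_chain c by (metis empty_iff)
qed

section \<open>Finitely generated right ideals\<close>

definition ideal :: "'s set \<Rightarrow> bool"
  where "ideal I \<longleftrightarrow> fg_right_ideal S I"

text \<open>
  The combinatorial form of essential idempotents of \<open>R(S)\<close>: the ideal meets every principal right ideal.
\<close>

definition dense :: "'s set \<Rightarrow> bool"
  where "dense I \<longleftrightarrow> (\<forall>a \<in> carrier S. \<exists>s \<in> carrier S. a \<otimes> s \<in> I)"

definition partial_id :: "'s set \<Rightarrow> ('s \<rightharpoonup> 's)"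
  where "partial_id I = (\<lambda>x. if x \<in> I then Some x else None)"

definition converse_map :: "('s \<rightharpoonup> 's) \<Rightarrow> ('s \<rightharpoonup> 's)"
  where "converse_map \<alpha> = (\<lambda>y. if y \<in> ran \<alpha> then Some (THE x. \<alpha> x = Some y) else None)"

abbreviation RS :: "('s \<rightharpoonup> 's) set"
  where "RS \<equiv> carrier (ideal_isos S)"

lemma mem_right_ideal_gen: "z \<in> right_ideal_gen S Y \<longleftrightarrow> (\<exists>y \<in> Y. y \<preceq> z)"
  by (auto simp: right_ideal_gen_def is_prefix_def)

lemma idealI: "finite Y \<Longrightarrow> Y \<subseteq> carrier S \<Longrightarrow> ideal (right_ideal_gen S Y)"
  by (auto simp: ideal_def fg_right_ideal_def)

lemma idealE:
  assumes "ideal I"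
  obtains Y where "finite Y" "Y \<subseteq> carrier S" "Y \<subseteq> I" "\<And>z. z \<in> I \<longleftrightarrow> (\<exists>y \<in> Y. y \<preceq> z)"
proof -
  obtain Y where Y: "finite Y" "Y \<subseteq> carrier S" "I = right_ideal_gen S Y"
    using assms by (auto simp: ideal_def fg_right_ideal_def)
  have "\<And>z. z \<in> I \<longleftrightarrow> (\<exists>y \<in> Y. y \<preceq> z)" using Y mem_right_ideal_gen by simp
  moreover from this have "Y \<subseteq> I" using prefix_refl Y by blast
  ultimately show ?thesis using that Y by blast
qed

lemma ideal_subset: "ideal I \<Longrightarrow> I \<subseteq> carrier S"
  by (auto simp: ideal_def fg_right_ideal_def right_ideal_gen_def)

lemma ideal_prefix: "ideal I \<Longrightarrow> a \<in> I \<Longrightarrow> a \<preceq> b \<Longrightarrow> b \<in> I"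
  by (elim idealE) (meson prefix_trans subsetD)

lemma ideal_mult: "ideal I \<Longrightarrow> a \<in> I \<Longrightarrow> s \<in> carrier S \<Longrightarrow> a \<otimes> s \<in> I"
  using ideal_prefix prefixI by blast

text \<open>
  A common extension of \<open>y\<close> and \<open>z\<close> has a prefix of degree \<open>max (d y) (d z)\<close> that already extends both. There are
  finitely many elements of that degree, and they generate the intersection.
\<close>

lemma ideal_Int:
  assumes "ideal I" "ideal J"
  shows "ideal (I \<inter> J)"
proof -
  obtain Y where Y: "finite Y" "Y \<subseteq> carrier S" "\<And>z. z \<in> I \<longleftrightarrow> (\<exists>y \<in> Y. y \<preceq> z)"
    using idealE[OF assms(1)] by metis
  obtain Z where Z: "finite Z" "Z \<subseteq> carrier S" "\<And>z. z \<in> J \<longleftrightarrow> (\<exists>y \<in> Z. y \<preceq> z)"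
    using idealE[OF assms(2)] by metis
  define join where "join m n = (\<chi> i. max (m $ i) (n $ i))" for m n :: "nat ^ 'k"
  have join: "m \<le> join m n" "n \<le> join m n" for m n :: "nat ^ 'k"
    by (simp_all add: join_def less_eq_vec_def)
  have join_least: "join m n \<le> p" if "m \<le> p" "n \<le> p" for m n p :: "nat ^ 'k"
    using that by (simp add: join_def less_eq_vec_def)
  define W where "W = (\<Union>y \<in> Y. \<Union>z \<in> Z. level (join (d y) (d z))) \<inter> I \<inter> J"
  have "finite W" "W \<subseteq> carrier S" using Y Z ideal_subset[OF assms(1)] by (auto simp: W_def)
  moreover have "I \<inter> J = right_ideal_gen S W"
  proof
    show "right_ideal_gen S W \<subseteq> I \<inter> J"
      using ideal_prefix[OF assms(1)] ideal_prefix[OF assms(2)] by (auto simp: mem_right_ideal_gen W_def)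
    show "I \<inter> J \<subseteq> right_ideal_gen S W"
    proof
      fix x assume x: "x \<in> I \<inter> J"
      then have xS: "x \<in> carrier S" using ideal_subset[OF assms(1)] by blast
      obtain y z where yz: "y \<in> Y" "y \<preceq> x" "z \<in> Z" "z \<preceq> x" using x Y Z by blast
      have yzS: "y \<in> carrier S" "z \<in> carrier S" using yz Y Z by auto
      have "join (d y) (d z) \<le> d x" using join_least prefix_degree yz yzS by blast
      then obtain u s where u: "u \<in> level (join (d y) (d z))" "s \<in> level (d x - join (d y) (d z))" "x = u \<otimes> s"
        using level_prefix[of x "d x"] xS by (auto simp: level_def)
      then have ux: "u \<preceq> x" "u \<in> carrier S" "d u = join (d y) (d z)" using prefixI levelD by auto
      have "y \<preceq> u" "z \<preceq> u"
        using prefix_total[OF yzS(1) ux(2) yz(2) ux(1)] prefix_total[OF yzS(2) ux(2) yz(4) ux(1)]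
          join ux(3) by auto
      then have "u \<in> W" using yz u Y(3) Z(3) by (auto simp: W_def)
      then show "x \<in> right_ideal_gen S W" using ux mem_right_ideal_gen by blast
    qed
  qed
  ultimately show ?thesis using idealI by simp
qed

section \<open>The inverse monoid of ideal isomorphisms\<close>

lemma RS_iff: "\<alpha> \<in> RS \<longleftrightarrow> ideal (dom \<alpha>) \<and> ideal (ran \<alpha>) \<and>
    (\<forall>a a' b. \<alpha> a = Some b \<longrightarrow> \<alpha> a' = Some b \<longrightarrow> a = a') \<and>
    (\<forall>a b s. \<alpha> a = Some b \<longrightarrow> s \<in> carrier S \<longrightarrow> \<alpha> (a \<otimes> s) = Some (b \<otimes> s))"
proof -
  have 1: "inj_on \<alpha> (dom \<alpha>) \<longleftrightarrow> (\<forall>a a' b. \<alpha> a = Some b \<longrightarrow> \<alpha> a' = Some b \<longrightarrow> a = a')"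
    by (auto simp: inj_on_def dom_def)
  have 2: "(\<forall>a \<in> dom \<alpha>. \<forall>s \<in> carrier S. \<alpha> (a \<otimes> s) = Some (the (\<alpha> a) \<otimes> s)) \<longleftrightarrow>
    (\<forall>a b s. \<alpha> a = Some b \<longrightarrow> s \<in> carrier S \<longrightarrow> \<alpha> (a \<otimes> s) = Some (b \<otimes> s))"
    by (metis domD domI option.sel)
  show ?thesis unfolding ideal_isos_def ideal_def using 1 2 by simp
qed

lemma RS_ideal: "\<alpha> \<in> RS \<Longrightarrow> ideal (dom \<alpha>)" "\<alpha> \<in> RS \<Longrightarrow> ideal (ran \<alpha>)"
  by (auto simp: RS_iff)

lemma RS_inj: "\<lbrakk>\<alpha> \<in> RS; \<alpha> a = Some b; \<alpha> a' = Some b\<rbrakk> \<Longrightarrow> a = a'"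
  unfolding RS_iff by blast

lemma RS_mult: "\<lbrakk>\<alpha> \<in> RS; \<alpha> a = Some b; s \<in> carrier S\<rbrakk> \<Longrightarrow> \<alpha> (a \<otimes> s) = Some (b \<otimes> s)"
  unfolding RS_iff by blast

lemma RS_closed: "\<alpha> \<in> RS \<Longrightarrow> \<alpha> a = Some b \<Longrightarrow> a \<in> carrier S"
  "\<alpha> \<in> RS \<Longrightarrow> \<alpha> a = Some b \<Longrightarrow> b \<in> carrier S"
  using RS_ideal[THEN ideal_subset] by (blast intro: domI ranI)+

lemma converse_map_iff:
  assumes "\<alpha> \<in> RS"
  shows "converse_map \<alpha> y = Some x \<longleftrightarrow> \<alpha> x = Some y"
proof
  assume "converse_map \<alpha> y = Some x"
  then have "y \<in> ran \<alpha>" and x: "x = (THE x. \<alpha> x = Some y)"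
    by (auto simp: converse_map_def split: if_splits)
  then obtain x' where x': "\<alpha> x' = Some y" by (auto simp: ran_def)
  then have "(THE x. \<alpha> x = Some y) = x'" using RS_inj[OF assms] by blast
  then show "\<alpha> x = Some y" using x x' by simp
next
  assume x: "\<alpha> x = Some y"
  then have "(THE x. \<alpha> x = Some y) = x" using RS_inj[OF assms] by blast
  then show "converse_map \<alpha> y = Some x" using x by (auto simp: converse_map_def ran_def)
qed

lemma dom_converse_map: "\<alpha> \<in> RS \<Longrightarrow> dom (converse_map \<alpha>) = ran \<alpha>"
  by (auto simp: dom_def ran_def converse_map_iff)

lemma ran_converse_map: "\<alpha> \<in> RS \<Longrightarrow> ran (converse_map \<alpha>) = dom \<alpha>"
  by (auto simp: dom_def ran_def converse_map_iff)

lemma converse_map_RS: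
  assumes a: "\<alpha> \<in> RS"
  shows "converse_map \<alpha> \<in> RS"
  unfolding RS_iff dom_converse_map[OF a] ran_converse_map[OF a]
  using RS_ideal[OF a] RS_mult[OF a] by (simp add: converse_map_iff[OF a])

lemma map_eqI:
  assumes "\<And>x y. f x = Some y \<longleftrightarrow> g x = Some y"
  shows "f = g"
proof
  fix x show "f x = g x" using assms by (metis not_Some_eq)
qed

lemma comp_iff: "(\<alpha> \<circ>\<^sub>m \<beta>) x = Some z \<longleftrightarrow> (\<exists>y. \<beta> x = Some y \<and> \<alpha> y = Some z)"
  by (rule map_comp_Some_iff)

lemma partial_id_iff: "partial_id I x = Some y \<longleftrightarrow> x \<in> I \<and> x = y"
  by (auto simp: partial_id_def)

lemma dom_partial_id [simp]: "dom (partial_id I) = I"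
  by (auto simp: dom_def partial_id_def)

lemma ran_partial_id [simp]: "ran (partial_id I) = I"
  by (auto simp: ran_def partial_id_def)

text \<open>
  Morphisms send generators to generators; applied to inverses, this shows that preimages of ideals
  are finitely generated too, as needed for the domain of a composite.
\<close>

lemma ideal_image:
  assumes a: "\<alpha> \<in> RS" and J: "ideal J" "J \<subseteq> dom \<alpha>"
  shows "ideal {b. \<exists>a \<in> J. \<alpha> a = Some b}"
proof -
  obtain Y where Y: "finite Y" "Y \<subseteq> J" "\<And>z. z \<in> J \<longleftrightarrow> (\<exists>y \<in> Y. y \<preceq> z)" using idealE[OF J(1)] by metis
  define Z where "Z = (\<lambda>y. the (\<alpha> y)) ` Y"
  have "finite Z" using Y by (simp add: Z_def)
  moreover have val: "\<alpha> y = Some (the (\<alpha> y))" if "y \<in> J" for y using that J(2) by (auto simp: dom_def)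
  then have "Z \<subseteq> carrier S" using RS_closed(2)[OF a] Y(2) by (auto simp: Z_def)
  moreover have "{b. \<exists>a \<in> J. \<alpha> a = Some b} = right_ideal_gen S Z"
  proof (intro equalityI subsetI)
    fix b assume "b \<in> {b. \<exists>a \<in> J. \<alpha> a = Some b}"
    then obtain x where x: "x \<in> J" "\<alpha> x = Some b" by blast
    then obtain y s where y: "y \<in> Y" "s \<in> carrier S" "x = y \<otimes> s" using Y(3) by (auto simp: is_prefix_def)
    have "b = the (\<alpha> y) \<otimes> s" using RS_mult[OF a val y(2)] Y(2) y x by auto
    then show "b \<in> right_ideal_gen S Z" using y by (auto simp: right_ideal_gen_def Z_def)
  next
    fix b assume "b \<in> right_ideal_gen S Z"
    then obtain y s where y: "y \<in> Y" "s \<in> carrier S" "b = the (\<alpha> y) \<otimes> s"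
      by (auto simp: right_ideal_gen_def Z_def)
    then have "\<alpha> (y \<otimes> s) = Some b" using RS_mult[OF a val y(2)] Y(2) by auto
    moreover have "y \<otimes> s \<in> J" using ideal_mult[OF J(1)] y Y(2) by blast
    ultimately show "b \<in> {b. \<exists>a \<in> J. \<alpha> a = Some b}" by blast
  qed
  ultimately show ?thesis using idealI by simp
qed

lemma comp_RS:
  assumes a: "\<alpha> \<in> RS" and b: "\<beta> \<in> RS"
  shows "\<alpha> \<circ>\<^sub>m \<beta> \<in> RS"
proof -
  have J: "ideal (ran \<beta> \<inter> dom \<alpha>)" using ideal_Int RS_ideal a b by blast
  have "dom (\<alpha> \<circ>\<^sub>m \<beta>) = {x. \<exists>y \<in> ran \<beta> \<inter> dom \<alpha>. converse_map \<beta> y = Some x}"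
    by (auto simp: dom_def ran_def comp_iff converse_map_iff[OF b])
  moreover have "ideal \<dots>"
    by (rule ideal_image[OF converse_map_RS[OF b] J]) (simp add: dom_converse_map[OF b])
  moreover have "ran (\<alpha> \<circ>\<^sub>m \<beta>) = {z. \<exists>y \<in> ran \<beta> \<inter> dom \<alpha>. \<alpha> y = Some z}"
    by (auto simp: dom_def ran_def comp_iff)
  moreover have "ideal \<dots>" by (rule ideal_image[OF a J]) simp
  moreover have "x = x'" if xz: "(\<alpha> \<circ>\<^sub>m \<beta>) x = Some z" "(\<alpha> \<circ>\<^sub>m \<beta>) x' = Some z" for x x' z
  proof -
    obtain y y' where y: "\<beta> x = Some y" "\<alpha> y = Some z" "\<beta> x' = Some y'" "\<alpha> y' = Some z"
      using xz unfolding comp_iff by blast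
    have "y = y'" using RS_inj[OF a y(2,4)] .
    then show ?thesis using RS_inj[OF b y(1)] y(3) by simp
  qed
  moreover have "(\<alpha> \<circ>\<^sub>m \<beta>) (x \<otimes> s) = Some (z \<otimes> s)" if xz: "(\<alpha> \<circ>\<^sub>m \<beta>) x = Some z" and s: "s \<in> carrier S" for x z s
  proof -
    obtain y where y: "\<beta> x = Some y" "\<alpha> y = Some z" using xz unfolding comp_iff by blast
    show ?thesis unfolding comp_iff using RS_mult[OF a y(2) s] RS_mult[OF b y(1) s] by blast
  qed
  ultimately show ?thesis unfolding RS_iff by simp
qed

lemma partial_id_RS: "ideal I \<Longrightarrow> partial_id I \<in> RS"
  unfolding RS_iff using ideal_mult by (auto simp: partial_id_iff)

lemma mult_RS: "\<alpha> \<otimes>\<^bsub>ideal_isos S\<^esub> \<beta> = \<alpha> \<circ>\<^sub>m \<beta>"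
  by (simp add: ideal_isos_def)

lemma one_RS: "\<one>\<^bsub>ideal_isos S\<^esub> = partial_id (carrier S)"
  by (simp add: ideal_isos_def partial_id_def)

lemma ideal_carrier: "ideal (carrier S)"
proof -
  have "right_ideal_gen S {\<one>} = carrier S" unfolding right_ideal_gen_def by (force intro: l_one[symmetric])
  then show ?thesis using idealI[of "{\<one>}"] by simp
qed

lemma comp_converse: "\<alpha> \<in> RS \<Longrightarrow> converse_map \<alpha> \<circ>\<^sub>m \<alpha> = partial_id (dom \<alpha>)"
  by (rule map_eqI) (auto simp: comp_iff converse_map_iff partial_id_iff dest: RS_inj)

lemma converse_comp: "\<alpha> \<in> RS \<Longrightarrow> \<alpha> \<circ>\<^sub>m converse_map \<alpha> = partial_id (ran \<alpha>)"
  by (rule map_eqI) (auto simp: comp_iff converse_map_iff partial_id_iff ran_def)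

lemma idempotent_RS: "idempotents (ideal_isos S) = partial_id ` {I. ideal I}"
proof (intro equalityI subsetI)
  fix e assume "e \<in> idempotents (ideal_isos S)"
  then have e: "e \<in> RS" "e \<circ>\<^sub>m e = e" by (auto simp: idempotents_def mult_RS)
  have "x = y" if xy: "e x = Some y" for x y
  proof -
    have "(e \<circ>\<^sub>m e) x = Some y" using e xy by simp
    then have "e y = Some y" using xy by (simp add: comp_iff)
    then show ?thesis using RS_inj[OF e(1) xy] by simp
  qed
  then have "e = partial_id (dom e)" by (intro map_eqI) (auto simp: partial_id_iff)
  then show "e \<in> partial_id ` {I. ideal I}" using RS_ideal e by blast
next
  fix e assume "e \<in> partial_id ` {I. ideal I}"
  then obtain I where I: "ideal I" "e = partial_id I" by blast
  have "e \<circ>\<^sub>m e = e" unfolding I by (rule map_eqI) (auto simp: comp_iff partial_id_iff)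
  then show "e \<in> idempotents (ideal_isos S)" using partial_id_RS I by (simp add: idempotents_def mult_RS)
qed

text \<open>
  Among partial injections an inverse in the sense of semigroups is the inverse map.
\<close>

lemma semigroup_inverse_RS:
  assumes a: "\<alpha> \<in> RS"
  shows "semigroup_inverse (ideal_isos S) \<alpha> = converse_map \<alpha>"
  unfolding semigroup_inverse_def mult_RS
proof (rule the_equality)
  show "converse_map \<alpha> \<in> RS \<and> \<alpha> \<circ>\<^sub>m converse_map \<alpha> \<circ>\<^sub>m \<alpha> = \<alpha> \<and>
      converse_map \<alpha> \<circ>\<^sub>m \<alpha> \<circ>\<^sub>m converse_map \<alpha> = converse_map \<alpha>"
  proof (intro conjI)
    show "converse_map \<alpha> \<in> RS" by (rule converse_map_RS[OF a])
    show "\<alpha> \<circ>\<^sub>m converse_map \<alpha> \<circ>\<^sub>m \<alpha> = \<alpha>"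
      unfolding converse_comp[OF a]
      by (rule map_eqI, unfold comp_iff partial_id_iff) (blast intro: ranI)
    show "converse_map \<alpha> \<circ>\<^sub>m \<alpha> \<circ>\<^sub>m converse_map \<alpha> = converse_map \<alpha>"
      unfolding comp_converse[OF a]
      by (rule map_eqI, unfold comp_iff partial_id_iff converse_map_iff[OF a]) (blast intro: domI)
  qed
next
  fix t assume "t \<in> RS \<and> \<alpha> \<circ>\<^sub>m t \<circ>\<^sub>m \<alpha> = \<alpha> \<and> t \<circ>\<^sub>m \<alpha> \<circ>\<^sub>m t = t"
  then have t: "t \<in> RS" "\<alpha> \<circ>\<^sub>m t \<circ>\<^sub>m \<alpha> = \<alpha>" "t \<circ>\<^sub>m \<alpha> \<circ>\<^sub>m t = t" by auto
  show "t = converse_map \<alpha>"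
  proof (rule map_eqI, unfold converse_map_iff[OF a], rule iffI)
    fix x y
    assume xy: "t y = Some x"
    then have "(t \<circ>\<^sub>m \<alpha> \<circ>\<^sub>m t) y = Some x" using t(3) by simp
    then obtain y' where "\<alpha> x = Some y'" "t y' = Some x" using xy by (auto simp: comp_iff)
    then show "\<alpha> x = Some y" using RS_inj[OF t(1) xy] by simp
  next
    fix x y
    assume xy: "\<alpha> x = Some y"
    then have "(\<alpha> \<circ>\<^sub>m t \<circ>\<^sub>m \<alpha>) x = Some y" using t(2) by simp
    then obtain x' where "t y = Some x'" "\<alpha> x' = Some y" using xy by (auto simp: comp_iff)
    then show "t y = Some x" using RS_inj[OF a xy] by simp
  qed
qed

lemma is_zero_RS: "is_zero (ideal_isos S) z \<longleftrightarrow> z = Map.empty"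
proof
  have e: "Map.empty \<in> RS"
  proof -
    have "ideal {}" using idealI[of "{}"] by (simp add: right_ideal_gen_def)
    then show ?thesis by (simp add: RS_iff)
  qed
  show "z = Map.empty" if "is_zero (ideal_isos S) z"
  proof -
    have "z \<circ>\<^sub>m Map.empty = z" using that e unfolding is_zero_def mult_RS by blast
    then show ?thesis by simp
  qed
  have "f \<circ>\<^sub>m Map.empty = Map.empty" "Map.empty \<circ>\<^sub>m f = Map.empty" for f :: "'s \<rightharpoonup> 's"
    by (rule map_eqI, simp add: comp_iff)+
  then show "is_zero (ideal_isos S) z" if "z = Map.empty"
    unfolding that is_zero_def mult_RS using e by simp
qed

lemma partial_id_comp: "partial_id I \<circ>\<^sub>m partial_id J = partial_id (I \<inter> J)"
  by (rule map_eqI) (auto simp: comp_iff partial_id_iff)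

lemma partial_id_empty: "partial_id I = Map.empty \<longleftrightarrow> I = {}"
  by (metis dom_empty dom_partial_id dom_eq_empty_conv)

text \<open>
  Every nonzero idempotent is the identity on a nonempty ideal, which contains a principal one; so it
  suffices to test an idempotent against principal right ideals.
\<close>

lemma essential_iff:
  assumes I: "ideal I"
  shows "essential (ideal_isos S) (partial_id I) \<longleftrightarrow> dense I"
proof
  assume ess: "essential (ideal_isos S) (partial_id I)"
  show "dense I" unfolding dense_def
  proof
    fix a assume a: "a \<in> carrier S"
    have J: "ideal (right_ideal_gen S {a})" using a idealI by simp
    have "a \<in> right_ideal_gen S {a}" using a prefix_refl by (simp add: mem_right_ideal_gen)
    then have ne: "right_ideal_gen S {a} \<noteq> {}" by blast
    then have "I \<inter> right_ideal_gen S {a} \<noteq> {}"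
      using ess J unfolding essential_def idempotent_RS is_zero_RS mult_RS
      by (auto simp: partial_id_comp partial_id_empty)
    then show "\<exists>s \<in> carrier S. a \<otimes> s \<in> I" by (auto simp: right_ideal_gen_def)
  qed
next
  assume dn: "dense I"
  have "I \<inter> J \<noteq> {}" if J: "ideal J" "J \<noteq> {}" for J
  proof -
    obtain a where a: "a \<in> J" using J by blast
    then have "a \<in> carrier S" using ideal_subset J by blast
    then obtain s where "s \<in> carrier S" "a \<otimes> s \<in> I" using dn by (auto simp: dense_def)
    then show ?thesis using ideal_mult[OF J(1) a] by blast
  qed
  moreover have "I \<noteq> {}" using dn by (auto simp: dense_def)
  ultimately show "essential (ideal_isos S) (partial_id I)"
    unfolding essential_def idempotent_RS is_zero_RS mult_RS using I
    by (auto simp: partial_id_comp partial_id_empty)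
qed

section \<open>Elements between essential ideals\<close>

abbreviation T :: "('s \<rightharpoonup> 's) monoid"
  where "T \<equiv> essential_part (ideal_isos S)"

lemma T_iff: "\<alpha> \<in> carrier T \<longleftrightarrow> \<alpha> \<in> RS \<and> dense (dom \<alpha>) \<and> dense (ran \<alpha>)"
proof (cases "\<alpha> \<in> RS")
  case True
  then show ?thesis
    unfolding essential_part_def
    by (simp add: semigroup_inverse_RS mult_RS comp_converse converse_comp essential_iff RS_ideal)
qed (simp add: essential_part_def)

lemma mult_T [simp]: "\<alpha> \<otimes>\<^bsub>T\<^esub> \<beta> = \<alpha> \<circ>\<^sub>m \<beta>"
  by (simp add: essential_part_def mult_RS)

lemma one_T [simp]: "\<one>\<^bsub>T\<^esub> = partial_id (carrier S)"
  by (simp add: essential_part_def one_RS)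

lemma T_RS: "\<alpha> \<in> carrier T \<Longrightarrow> \<alpha> \<in> RS"
  by (simp add: T_iff)

lemma converse_map_T: "\<alpha> \<in> carrier T \<Longrightarrow> converse_map \<alpha> \<in> carrier T"
  by (simp add: T_iff converse_map_RS dom_converse_map ran_converse_map)

lemma partial_id_T: "ideal I \<Longrightarrow> partial_id I \<in> carrier T \<longleftrightarrow> dense I"
  by (simp add: T_iff partial_id_RS)

lemma dense_dom_comp:
  assumes a: "\<alpha> \<in> carrier T" and b: "\<beta> \<in> carrier T"
  shows "dense (dom (\<alpha> \<circ>\<^sub>m \<beta>))"
  unfolding dense_def
proof
  fix x assume x: "x \<in> carrier S"
  have "dense (dom \<beta>)" "dense (dom \<alpha>)" using a b by (auto simp: T_iff)
  then obtain s y where s: "s \<in> carrier S" "\<beta> (x \<otimes> s) = Some y"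
    using x by (auto simp: dense_def dom_def)
  then have y: "y \<in> carrier S" using RS_closed T_RS b by blast
  then obtain t z where t: "t \<in> carrier S" "\<alpha> (y \<otimes> t) = Some z"
    using \<open>dense (dom \<alpha>)\<close> by (auto simp: dense_def dom_def)
  have "\<beta> (x \<otimes> (s \<otimes> t)) = Some (y \<otimes> t)" using RS_mult[OF T_RS[OF b] s(2) t(1)] x s t by (simp add: m_assoc)
  then have "(\<alpha> \<circ>\<^sub>m \<beta>) (x \<otimes> (s \<otimes> t)) = Some z" using t by (auto simp: comp_iff)
  then show "\<exists>s \<in> carrier S. x \<otimes> s \<in> dom (\<alpha> \<circ>\<^sub>m \<beta>)" using s t by (intro bexI[of _ "s \<otimes> t"]) auto
qed

lemma converse_comp_map:
  assumes "\<alpha> \<in> RS" "\<beta> \<in> RS"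
  shows "converse_map (\<alpha> \<circ>\<^sub>m \<beta>) = converse_map \<beta> \<circ>\<^sub>m converse_map \<alpha>"
  by (rule map_eqI) (auto simp: converse_map_iff assms comp_RS comp_iff)

lemma comp_T:
  assumes "\<alpha> \<in> carrier T" "\<beta> \<in> carrier T"
  shows "\<alpha> \<circ>\<^sub>m \<beta> \<in> carrier T"
proof -
  have r: "\<alpha> \<in> RS" "\<beta> \<in> RS" using assms T_RS by auto
  have "dense (dom (converse_map (\<alpha> \<circ>\<^sub>m \<beta>)))"
    unfolding converse_comp_map[OF r] using assms by (intro dense_dom_comp converse_map_T)
  then show ?thesis
    using dense_dom_comp[OF assms] comp_RS[OF r] by (simp add: T_iff dom_converse_map)
qed

text \<open>
  Let \<open>n\<close> bound the degrees of the generators. If \<open>d x \<ge> n\<close> and some \<open>x \<otimes> s\<close> extends a generator, then so does \<open>x\<close>,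
  since prefixes of \<open>x \<otimes> s\<close> with comparable degrees are comparable.
\<close>

lemma dense_level:
  assumes "ideal I" "dense I"
  obtains n where "\<And>m. n \<le> m \<Longrightarrow> level m \<subseteq> I"
proof -
  obtain Y where Y: "finite Y" "Y \<subseteq> carrier S" "\<And>z. z \<in> I \<longleftrightarrow> (\<exists>y \<in> Y. y \<preceq> z)"
    using idealE[OF assms(1)] by metis
  obtain n where n: "\<And>y. y \<in> Y \<Longrightarrow> d y \<le> n" using finite_vec_bounded[OF Y(1), of d] by blast
  have "level m \<subseteq> I" if m: "n \<le> m" for m
  proof
    fix x assume x: "x \<in> level m"
    then have xS: "x \<in> carrier S" "d x = m" using levelD by auto
    obtain s where s: "s \<in> carrier S" "x \<otimes> s \<in> I" using assms(2) xS by (auto simp: dense_def)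
    then obtain y where y: "y \<in> Y" "y \<preceq> x \<otimes> s" using Y(3) by blast
    have "y \<preceq> x"
      using prefix_total[of y x "x \<otimes> s"] y Y(2) xS s prefixI order_trans[OF n[OF y(1)] m] by auto
    then show "x \<in> I" using Y(3) y by blast
  qed
  then show ?thesis using that by blast
qed

lemma level_ideal: "ideal (right_ideal_gen S (level n))"
  using idealI levelD by (simp add: subset_iff)

lemma level_ideal_mem: "x \<in> right_ideal_gen S (level n) \<longleftrightarrow> x \<in> carrier S \<and> n \<le> d x"
proof
  assume "x \<in> right_ideal_gen S (level n)"
  then obtain y s where "y \<in> level n" "s \<in> carrier S" "x = y \<otimes> s" by (auto simp: right_ideal_gen_def)
  then show "x \<in> carrier S \<and> n \<le> d x" by (auto simp: level_def degree_mult)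
next
  show "x \<in> carrier S \<and> n \<le> d x \<Longrightarrow> x \<in> right_ideal_gen S (level n)"
  proof -
    assume x: "x \<in> carrier S \<and> n \<le> d x"
    then have "x \<in> level (d x)" by (simp add: level_def)
    then obtain y s where "y \<in> level n" "s \<in> level (d x - n)" "x = y \<otimes> s"
      using level_prefix x by metis
    then show ?thesis using levelD(1) unfolding right_ideal_gen_def by blast
  qed
qed

lemma level_dense: "level n \<subseteq> I \<Longrightarrow> ideal I \<Longrightarrow> dense I"
proof -
  assume I: "level n \<subseteq> I" "ideal I"
  have "\<exists>s \<in> carrier S. a \<otimes> s \<in> I" if a: "a \<in> carrier S" for a
  proof -
    obtain s where s: "s \<in> level n" using level_extend by blast
    have "a \<otimes> s \<in> level (d a + n)" using level_mult[OF _ s] a by (simp add: level_def)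
    then obtain y t where "y \<in> level n" "t \<in> level (d a + n - n)" "a \<otimes> s = y \<otimes> t"
      using level_prefix[OF _ vec_le_add2] by metis
    then have "a \<otimes> s \<in> I" using ideal_mult[OF I(2)] I(1) levelD(1) by auto
    then show ?thesis using levelD(1)[OF s] by blast
  qed
  then show "dense I" by (simp add: dense_def)
qed

lemma idempotents_T: "idempotents T = partial_id ` {I. ideal I \<and> dense I}"
proof -
  have "idempotents T = idempotents (ideal_isos S) \<inter> carrier T"
    by (auto simp: idempotents_def mult_RS T_RS)
  then show ?thesis unfolding idempotent_RS using partial_id_T by auto
qed

lemma T_dom_level:
  assumes "\<alpha> \<in> carrier T"
  obtains n where "\<And>m. n \<le> m \<Longrightarrow> level m \<subseteq> dom \<alpha>"
  using dense_level[of "dom \<alpha>"] assms by (auto simp: T_iff RS_ideal)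

lemma T_common_dom_level:
  assumes "\<alpha> \<in> carrier T" "\<beta> \<in> carrier T"
  obtains n where "\<And>m. n \<le> m \<Longrightarrow> level m \<subseteq> dom \<alpha> \<inter> dom \<beta>"
proof -
  obtain p where p: "\<And>m. p \<le> m \<Longrightarrow> level m \<subseteq> dom \<alpha>" using T_dom_level[OF assms(1)] by metis
  obtain q where q: "\<And>m. q \<le> m \<Longrightarrow> level m \<subseteq> dom \<beta>" using T_dom_level[OF assms(2)] by metis
  have "level m \<subseteq> dom \<alpha> \<inter> dom \<beta>" if "p + q \<le> m" for m
    using p[of m] q[of m] order_trans[OF vec_le_add that] order_trans[OF vec_le_add2 that] by simp
  then show ?thesis using that by blast
qed

lemma natural_le_T: "natural_le T u \<alpha> \<longleftrightarrow> (\<exists>I. ideal I \<and> dense I \<and> u = \<alpha> \<circ>\<^sub>m partial_id I)"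
  unfolding natural_le_def idempotents_T by auto

lemma restrict_iff: "(\<alpha> \<circ>\<^sub>m partial_id I) x = Some y \<longleftrightarrow> x \<in> I \<and> \<alpha> x = Some y"
  by (auto simp: comp_iff partial_id_iff)

text \<open>
  A common restriction of \<open>\<alpha>\<close> and \<open>\<beta>\<close> has an essential domain, which contains a level. Conversely, agreement on a level
  spreads to the essential ideal that the level generates.
\<close>

lemma min_group_cong_T:
  "(\<alpha>, \<beta>) \<in> min_group_cong T \<longleftrightarrow> \<alpha> \<in> carrier T \<and> \<beta> \<in> carrier T \<and>
    (\<exists>n. \<forall>y \<in> level n. \<exists>x. \<alpha> y = Some x \<and> \<beta> y = Some x)"
proof (cases "\<alpha> \<in> carrier T \<and> \<beta> \<in> carrier T")
  case True
  have "(\<alpha>, \<beta>) \<in> min_group_cong T \<longleftrightarrow> (\<exists>u \<in> carrier T. natural_le T u \<alpha> \<and> natural_le T u \<beta>)"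
    using True by (simp add: min_group_cong_def)
  also have "\<dots> \<longleftrightarrow> (\<exists>n. \<forall>y \<in> level n. \<exists>x. \<alpha> y = Some x \<and> \<beta> y = Some x)"
  proof
    assume "\<exists>u \<in> carrier T. natural_le T u \<alpha> \<and> natural_le T u \<beta>"
    then obtain u I J where u: "u \<in> carrier T" "u = \<alpha> \<circ>\<^sub>m partial_id I" "u = \<beta> \<circ>\<^sub>m partial_id J"
      unfolding natural_le_T by blast
    obtain n where "\<And>m. n \<le> m \<Longrightarrow> level m \<subseteq> dom u" using T_dom_level[OF u(1)] by metis
    then have n: "level n \<subseteq> dom u" by simp
    have "\<exists>x. \<alpha> y = Some x \<and> \<beta> y = Some x" if y: "y \<in> level n" for y
    proof -
      obtain x where x: "u y = Some x" using n y by blast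
      have "\<alpha> y = Some x" using x unfolding u(2) restrict_iff by simp
      moreover have "\<beta> y = Some x" using x unfolding u(3) restrict_iff by simp
      ultimately show ?thesis by simp
    qed
    then show "\<exists>n. \<forall>y \<in> level n. \<exists>x. \<alpha> y = Some x \<and> \<beta> y = Some x" by blast
  next
    assume "\<exists>n. \<forall>y \<in> level n. \<exists>x. \<alpha> y = Some x \<and> \<beta> y = Some x"
    then obtain n where n: "\<And>y. y \<in> level n \<Longrightarrow> \<exists>x. \<alpha> y = Some x \<and> \<beta> y = Some x" by blast
    define I where "I = right_ideal_gen S (level n)"
    have "level n \<subseteq> I"
    proof
      fix y assume "y \<in> level n"
      then show "y \<in> I" unfolding I_def level_ideal_mem by (simp add: level_def)
    qed
    then have I: "ideal I" "dense I" using level_ideal level_dense[of n I] by (auto simp: I_def)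
    have "\<alpha> \<circ>\<^sub>m partial_id I = \<beta> \<circ>\<^sub>m partial_id I"
    proof (rule map_eqI, unfold restrict_iff)
      fix x z
      show "x \<in> I \<and> \<alpha> x = Some z \<longleftrightarrow> x \<in> I \<and> \<beta> x = Some z"
      proof (cases "x \<in> I")
        case xI: True
        then obtain y s where y: "y \<in> level n" "s \<in> carrier S" "x = y \<otimes> s"
          by (auto simp: I_def right_ideal_gen_def)
        obtain u where "\<alpha> y = Some u" "\<beta> y = Some u" using n[OF y(1)] by blast
        then have "\<alpha> x = Some (u \<otimes> s)" "\<beta> x = Some (u \<otimes> s)"
          using RS_mult[OF T_RS] True y by auto
        then show ?thesis by simp
      qed simp
    qed
    moreover have "\<alpha> \<circ>\<^sub>m partial_id I \<in> carrier T" using comp_T partial_id_T I True by blast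
    ultimately show "\<exists>u \<in> carrier T. natural_le T u \<alpha> \<and> natural_le T u \<beta>"
      unfolding natural_le_T using I by metis
  qed
  finally show ?thesis using True by simp
qed (auto simp: min_group_cong_def)

lemma one_T_closed: "partial_id (carrier S) \<in> carrier T"
  using partial_id_T[OF ideal_carrier] level_dense[of 0 "carrier S"] ideal_carrier levelD by blast

lemma countable_T: "countable (carrier T)"
proof -
  define F where "F \<alpha> = (SOME Y. finite Y \<and> Y \<subseteq> dom \<alpha> \<and> (\<forall>z \<in> dom \<alpha>. \<exists>y \<in> Y. y \<preceq> z))" for \<alpha> :: "'s \<rightharpoonup> 's"
  have F: "finite (F \<alpha>) \<and> F \<alpha> \<subseteq> dom \<alpha> \<and> (\<forall>z \<in> dom \<alpha>. \<exists>y \<in> F \<alpha>. y \<preceq> z)" if a: "\<alpha> \<in> carrier T" for \<alpha>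
  proof -
    obtain Y where "finite Y" "Y \<subseteq> dom \<alpha>" "\<And>z. z \<in> dom \<alpha> \<longleftrightarrow> (\<exists>y \<in> Y. y \<preceq> z)"
      using idealE[OF RS_ideal(1)[OF T_RS[OF a]]] by metis
    then have "\<exists>Y. finite Y \<and> Y \<subseteq> dom \<alpha> \<and> (\<forall>z \<in> dom \<alpha>. \<exists>y \<in> Y. y \<preceq> z)" by blast
    then show ?thesis unfolding F_def by (rule someI_ex)
  qed
  \<comment> \<open>A morphism is coded by its finite graph on a generating set of its domain.\<close>
  define code where "code \<alpha> = (\<lambda>y. (y, the (\<alpha> y))) ` F \<alpha>" for \<alpha> :: "'s \<rightharpoonup> 's"
  have code_mem: "code \<alpha> \<in> {A. finite A \<and> A \<subseteq> carrier S \<times> carrier S}" if a: "\<alpha> \<in> carrier T" for \<alpha>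
    using F[OF a] RS_closed[OF T_RS[OF a]] by (fastforce simp: code_def)
  have sub: "\<beta> x = Some z"
    if a: "\<alpha> \<in> carrier T" and b: "\<beta> \<in> carrier T" and eq: "code \<alpha> = code \<beta>" and x: "\<alpha> x = Some z" for \<alpha> \<beta> x z
  proof -
    obtain y s where y: "y \<in> F \<alpha>" "s \<in> carrier S" "x = y \<otimes> s"
      using F[OF a] domI[of \<alpha> x, OF x] unfolding is_prefix_def by blast
    then obtain u where u: "\<alpha> y = Some u" using F[OF a] by blast
    have "(y, u) \<in> code \<alpha>" unfolding code_def using u y(1) by (intro image_eqI[of _ _ y]) simp_all
    then have "(y, u) \<in> code \<beta>" using eq by simp
    then have "\<beta> y = Some u" using F[OF b] by (auto simp: code_def)
    then have "\<beta> x = Some (u \<otimes> s)" using RS_mult[OF T_RS[OF b]] y by simp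
    moreover have "\<alpha> x = Some (u \<otimes> s)" using RS_mult[OF T_RS[OF a] u] y by simp
    ultimately show ?thesis using x by simp
  qed
  have "inj_on code (carrier T)"
    by (rule inj_onI, rule map_eqI) (metis sub)
  moreover have "code ` carrier T \<subseteq> {A. finite A \<and> A \<subseteq> carrier S \<times> carrier S}" using code_mem by blast
  moreover have "countable {A. finite A \<and> A \<subseteq> carrier S \<times> carrier S}"
    using countable_carrier by (intro countable_Collect_finite_subset) simp
  ultimately show ?thesis by (meson countable_image_inj_on countable_subset)
qed

section \<open>The groupoid of tilings\<close>

abbreviation \<G> :: "('k, 's) tiling_arrow groupoid"
  where "\<G> \<equiv> tiling_groupoid S d"

abbreviation \<O> :: "('k, 's) tiling_arrow topology"
  where "\<O> \<equiv> tiling_groupoid_topology S d"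

abbreviation Z :: "'s \<Rightarrow> 's \<Rightarrow> ('k, 's) tiling_arrow set"
  where "Z x y \<equiv> basic_open S d x y"

abbreviation arrow :: "'s \<Rightarrow> ('k, 's) tiling \<Rightarrow> 's \<Rightarrow> ('k, 's) tiling_arrow"
  where "arrow x w y \<equiv> (x \<rhd> w, int_vec (d x) - int_vec (d y), y \<rhd> w)"

lemma Z_iff: "g \<in> Z x y \<longleftrightarrow> (\<exists>w \<in> X. g = arrow x w y)"
  by (auto simp: basic_open_def)

lemma Z_I: "w \<in> X \<Longrightarrow> arrow x w y \<in> Z x y"
  by (auto simp: basic_open_def)

lemma arrow_iff: "(v, n, w) \<in> carrier \<G> \<longleftrightarrow>
    v \<in> X \<and> w \<in> X \<and> (\<exists>l m. shift l v = shift m w \<and> n = int_vec l - int_vec m)"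
  by (simp add: tiling_groupoid_def)

lemma arrowI:
  "\<lbrakk>x \<in> carrier S; y \<in> carrier S; w \<in> X\<rbrakk> \<Longrightarrow> arrow x w y \<in> carrier \<G>"
  unfolding arrow_iff using prepend_props(3)[of x w] prepend_props(3)[of y w] by force

lemma Z_subset_carrier: "x \<in> carrier S \<Longrightarrow> y \<in> carrier S \<Longrightarrow> Z x y \<subseteq> carrier \<G>"
  using arrowI by (auto simp: Z_iff)

lemma carrierE:
  assumes "g \<in> carrier \<G>"
  obtains x y where "x \<in> carrier S" "y \<in> carrier S" "g \<in> Z x y"
proof -
  obtain v n w where g: "g = (v, n, w)" by (cases g)
  obtain l m where lm: "v \<in> X" "w \<in> X" "shift l v = shift m w" "n = int_vec l - int_vec m"
    using assms unfolding g arrow_iff by blast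
  have "v = v (0, l) \<rhd> shift l v" "w = w (0, m) \<rhd> shift l v"
    using lm head_shift[of v l] head_shift[of w m] by simp_all
  then have "g \<in> Z (v (0, l)) (w (0, m))"
    unfolding Z_iff g using lm shift_closed by (intro bexI[of _ "shift l v"]) simp_all
  then show ?thesis using that lm by (metis head_closed)
qed

lemma composable_iff: "(g, h) \<in> composable \<G> \<longleftrightarrow>
    g \<in> carrier \<G> \<and> h \<in> carrier \<G> \<and> snd (snd g) = fst h"
  by (cases g; cases h) (simp add: tiling_groupoid_def)

lemma gmult_eq: "gmult \<G> g h = (fst g, fst (snd g) + fst (snd h), snd (snd h))"
  by (cases g; cases h) (simp add: tiling_groupoid_def)

lemma ginv_eq: "ginv \<G> g = (snd (snd g), - fst (snd g), fst g)"
  by (cases g) (simp add: tiling_groupoid_def)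

lemma source_eq: "source \<G> g = (snd (snd g), 0, snd (snd g))"
  by (simp add: source_def gmult_eq ginv_eq)

lemma target_eq: "target \<G> g = (fst g, 0, fst g)"
  by (simp add: target_def gmult_eq ginv_eq)

lemma unit_carrier: "w \<in> X \<Longrightarrow> (w, 0, w) \<in> carrier \<G>"
  unfolding arrow_iff by auto

lemma carrier_X: "g \<in> carrier \<G> \<Longrightarrow> fst g \<in> X" "g \<in> carrier \<G> \<Longrightarrow> snd (snd g) \<in> X"
  by (cases g, simp add: arrow_iff)+

lemma identities_eq: "identities \<G> = {(w, 0, w) | w. w \<in> X}"
  unfolding identities_def
proof (intro equalityI subsetI)
  fix g assume "g \<in> source \<G> ` carrier \<G>"
  then show "g \<in> {(w, 0, w) | w. w \<in> X}" using carrier_X by (auto simp: source_eq)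
next
  fix g assume "g \<in> {(w, 0 :: int ^ 'k, w) | w. w \<in> X}"
  then obtain w where w: "w \<in> X" "g = (w, 0, w)" by blast
  then have "g = source \<G> g" by (simp add: source_eq)
  then show "g \<in> source \<G> ` carrier \<G>" using unit_carrier[OF w(1)] w(2) by blast
qed

lemma gmult_carrier:
  assumes "(g, h) \<in> composable \<G>"
  shows "gmult \<G> g h \<in> carrier \<G>"
proof -
  obtain u n v where g: "g = (u, n, v)" by (cases g)
  obtain v' n' w where h: "h = (v', n', w)" by (cases h)
  have "v' = v" and gh: "(u, n, v) \<in> carrier \<G>" "(v, n', w) \<in> carrier \<G>"
    using assms unfolding composable_iff g h by auto
  obtain l m l' m' where lm: "shift l u = shift m v" "n = int_vec l - int_vec m"
    "shift l' v = shift m' w" "n' = int_vec l' - int_vec m'" using gh unfolding arrow_iff by blast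
  have "shift (l' + l) u = shift (l' + m) v" using lm(1) by (metis shift_shift)
  also have "\<dots> = shift (m + l') v" by (simp add: add.commute)
  also have "\<dots> = shift (m + m') w" using lm(3) by (metis shift_shift)
  finally have "shift (l' + l) u = shift (m + m') w" .
  moreover have "n + n' = int_vec (l' + l) - int_vec (m + m')" using lm by (simp add: int_vec_add)
  moreover have "u \<in> X" "w \<in> X" using gh arrow_iff by auto
  ultimately show ?thesis unfolding gmult_eq g h fst_conv snd_conv arrow_iff by blast
qed

lemma ginv_carrier:
  assumes "g \<in> carrier \<G>"
  shows "ginv \<G> g \<in> carrier \<G>"
proof -
  obtain u n v where g: "g = (u, n, v)" by (cases g)
  obtain l m where "u \<in> X" "v \<in> X" "shift l u = shift m v" "n = int_vec l - int_vec m"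
    using assms unfolding g arrow_iff by blast
  then have "v \<in> X \<and> u \<in> X \<and> (\<exists>l m. shift l v = shift m u \<and> - n = int_vec l - int_vec m)"
    by (intro conjI exI[of _ m] exI[of _ l]) simp_all
  then show ?thesis unfolding ginv_eq g fst_conv snd_conv arrow_iff .
qed

lemma groupoid_tilings: "groupoid \<G>"
proof
  fix g h l assume gh: "(g, h) \<in> composable \<G>" and hl: "(h, l) \<in> composable \<G>"
  show "(gmult \<G> g h, l) \<in> composable \<G> \<and> (g, gmult \<G> h l) \<in> composable \<G> \<and>
      gmult \<G> (gmult \<G> g h) l = gmult \<G> g (gmult \<G> h l)"
    using gh hl gmult_carrier[OF gh] gmult_carrier[OF hl]
    by (simp add: composable_iff gmult_eq add.assoc)
next
  show "composable \<G> \<subseteq> carrier \<G> \<times> carrier \<G>" by (auto simp: composable_iff)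
next
  fix g h assume gh: "(g, h) \<in> composable \<G>"
  show "gmult \<G> g h \<in> carrier \<G>" by (rule gmult_carrier[OF gh])
  show "gmult \<G> (ginv \<G> g) (gmult \<G> g h) = h" "gmult \<G> (gmult \<G> g h) (ginv \<G> h) = g"
    using gh by (simp_all add: composable_iff gmult_eq ginv_eq prod_eq_iff)
next
  fix g assume g: "g \<in> carrier \<G>"
  show "ginv \<G> g \<in> carrier \<G>" by (rule ginv_carrier[OF g])
  then show "(ginv \<G> g, g) \<in> composable \<G>" using g by (simp add: composable_iff ginv_eq)
  show "ginv \<G> (ginv \<G> g) = g" by (simp add: ginv_eq)
qed

section \<open>The topology of the groupoid\<close>

lemma Z_subset:
  assumes "x \<in> carrier S" "y \<in> carrier S" "s \<in> carrier S"
  shows "Z (x \<otimes> s) (y \<otimes> s) \<subseteq> Z x y"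
proof
  fix g assume "g \<in> Z (x \<otimes> s) (y \<otimes> s)"
  then obtain w where "w \<in> X" "g = arrow (x \<otimes> s) w (y \<otimes> s)"
    unfolding Z_iff by blast
  then show "g \<in> Z x y"
    unfolding Z_iff using assms
    by (intro bexI[of _ "s \<rhd> w"]) (simp_all add: prepend_mult degree_mult int_vec_add)
qed

lemma Z_refine:
  assumes "x \<in> carrier S" "y \<in> carrier S" "g \<in> Z x y" "d y \<le> n"
  obtains s where "s \<in> level (n - d y)" "g \<in> Z (x \<otimes> s) (y \<otimes> s)" "d (y \<otimes> s) = n"
proof -
  obtain w where w: "w \<in> X" "g = arrow x w y"
    using assms(3) unfolding Z_iff by blast
  obtain s w' where s: "s \<in> level (n - d y)" "w' \<in> X" "w = s \<rhd> w'"
    using refine[OF assms(2) w(1) assms(4)] by metis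
  have sS: "s \<in> carrier S" using s levelD by blast
  have "g \<in> Z (x \<otimes> s) (y \<otimes> s)"
    unfolding Z_iff using w s sS assms
    by (intro bexI[of _ w']) (simp_all add: prepend_mult degree_mult int_vec_add)
  moreover have "d (y \<otimes> s) = n" using assms sS levelD(2)[OF s(1)] by (simp add: degree_mult vec_add_diff)
  ultimately show ?thesis using that s by blast
qed

text \<open>
  The sets \<open>Z x y\<close> with \<open>d y\<close> fixed are pairwise disjoint: the source of an arrow determines \<open>y\<close>, the degree of the
  arrow then determines \<open>d x\<close>, and its target determines \<open>x\<close>.
\<close>

lemma Z_unique:
  assumes "x \<in> carrier S" "y \<in> carrier S" "x' \<in> carrier S" "y' \<in> carrier S"
    and "g \<in> Z x y" "g \<in> Z x' y'" "d y = d y'"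
  shows "x = x'" "y = y'"
proof -
  obtain w where w: "w \<in> X" "g = arrow x w y"
    using assms unfolding Z_iff by blast
  obtain w' where w': "w' \<in> X" "g = arrow x' w' y'"
    using assms unfolding Z_iff by blast
  have eq: "x \<rhd> w = x' \<rhd> w'" "y \<rhd> w = y' \<rhd> w'"
    "int_vec (d x) - int_vec (d y) = int_vec (d x') - int_vec (d y')" using w w' by auto
  show "y = y'" using prepend_inject(1)[OF assms(2,4) w(1) w'(1) eq(2) assms(7)] .
  have "d x = d x'" using eq(3) assms(7) by (simp add: int_vec_inject)
  then show "x = x'" using prepend_inject(1)[OF assms(1,3) w(1) w'(1) eq(1)] by simp
qed

lemma Z_compare:
  assumes "x \<in> carrier S" "y \<in> carrier S" "x' \<in> carrier S" "y' \<in> carrier S"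
    and "g \<in> Z x y" "g \<in> Z x' y'"
  obtains s where "s \<in> carrier S" "g \<in> Z (x \<otimes> s) (y \<otimes> s)" "Z (x \<otimes> s) (y \<otimes> s) \<subseteq> Z x' y'"
    "d (y \<otimes> s) = d y + d y'"
proof -
  obtain s where s: "s \<in> level (d y + d y' - d y)" "g \<in> Z (x \<otimes> s) (y \<otimes> s)" "d (y \<otimes> s) = d y + d y'"
    using Z_refine[OF assms(1,2,5) vec_le_add] by metis
  obtain t where t: "t \<in> level (d y + d y' - d y')" "g \<in> Z (x' \<otimes> t) (y' \<otimes> t)" "d (y' \<otimes> t) = d y + d y'"
    using Z_refine[OF assms(3,4,6) vec_le_add2] by metis
  have S: "s \<in> carrier S" "t \<in> carrier S" using s t levelD by auto
  have "x \<otimes> s = x' \<otimes> t" "y \<otimes> s = y' \<otimes> t"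
    using Z_unique[OF _ _ _ _ s(2) t(2)] assms S s t by simp_all
  then show ?thesis using that[OF S(1) s(2) _ s(3)] Z_subset[OF assms(3,4) S(2)] by simp
qed

text \<open>
  The basis property: a point common to two basic sets lies in a third one, by refining both to the
  same source degree, where they must coincide.
\<close>

lemma openin_iff:
  "openin \<O> U \<longleftrightarrow> (\<forall>g \<in> U. \<exists>x \<in> carrier S. \<exists>y \<in> carrier S. g \<in> Z x y \<and> Z x y \<subseteq> U)"
  (is "_ \<longleftrightarrow> ?P U")
proof
  assume "openin \<O> U"
  then have "generate_topology_on {Z x y | x y. x \<in> carrier S \<and> y \<in> carrier S} U"
    unfolding tiling_groupoid_topology_def by (rule openin_topology_generated_by)
  then show "?P U"
  proof (induction rule: generate_topology_on.induct)
    case (Int a b)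
    show ?case
    proof
      fix g assume g: "g \<in> a \<inter> b"
      obtain x y where xy: "x \<in> carrier S" "y \<in> carrier S" "g \<in> Z x y" "Z x y \<subseteq> a" using Int g by blast
      obtain x' y' where xy': "x' \<in> carrier S" "y' \<in> carrier S" "g \<in> Z x' y'" "Z x' y' \<subseteq> b" using Int g by blast
      obtain s where s: "s \<in> carrier S" "g \<in> Z (x \<otimes> s) (y \<otimes> s)" "Z (x \<otimes> s) (y \<otimes> s) \<subseteq> Z x' y'"
        using Z_compare[OF xy(1,2) xy'(1,2) xy(3) xy'(3)] by metis
      then show "\<exists>x \<in> carrier S. \<exists>y \<in> carrier S. g \<in> Z x y \<and> Z x y \<subseteq> a \<inter> b"
        using Z_subset[OF xy(1,2) s(1)] xy xy' by (intro bexI[of _ "x \<otimes> s"] bexI[of _ "y \<otimes> s"]) auto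
    qed
  next
    case (UN K)
    show ?case
    proof
      fix g assume "g \<in> \<Union>K"
      then obtain k where k: "k \<in> K" "g \<in> k" by blast
      then obtain x y where "x \<in> carrier S" "y \<in> carrier S" "g \<in> Z x y" "Z x y \<subseteq> k" using UN by blast
      then show "\<exists>x \<in> carrier S. \<exists>y \<in> carrier S. g \<in> Z x y \<and> Z x y \<subseteq> \<Union>K" using k by blast
    qed
  next
    case (Basis k)
    then obtain x y where "k = Z x y" "x \<in> carrier S" "y \<in> carrier S" by blast
    then show ?case by blast
  qed simp
next
  assume U: "?P U"
  have "U = \<Union>{Z x y | x y. x \<in> carrier S \<and> y \<in> carrier S \<and> Z x y \<subseteq> U}" using U by blast
  moreover have "openin \<O> \<dots>"
    unfolding tiling_groupoid_topology_def openin_topology_generated_by_iff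
    by (rule generate_topology_on.UN) (auto intro: generate_topology_on.Basis)
  ultimately show "openin \<O> U" by simp
qed

lemma open_Z: "x \<in> carrier S \<Longrightarrow> y \<in> carrier S \<Longrightarrow> openin \<O> (Z x y)"
  unfolding openin_iff by blast

lemma topspace_groupoid: "topspace \<O> = carrier \<G>"
proof -
  have "topspace \<O> = \<Union>{Z x y | x y. x \<in> carrier S \<and> y \<in> carrier S}"
    by (simp add: tiling_groupoid_topology_def)
  also have "\<dots> = carrier \<G>"
  proof (intro equalityI subsetI)
    fix g assume "g \<in> \<Union>{Z x y | x y. x \<in> carrier S \<and> y \<in> carrier S}"
    then show "g \<in> carrier \<G>" using Z_subset_carrier by blast
  next
    fix g assume "g \<in> carrier \<G>"
    then obtain x y where "x \<in> carrier S" "y \<in> carrier S" "g \<in> Z x y" by (rule carrierE)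
    then show "g \<in> \<Union>{Z x y | x y. x \<in> carrier S \<and> y \<in> carrier S}" by blast
  qed
  finally show ?thesis .
qed

lemma Z_nbhd:
  assumes "openin \<O> U" "g \<in> U" "x \<in> carrier S" "y \<in> carrier S" "g \<in> Z x y"
  obtains s where "s \<in> carrier S" "g \<in> Z (x \<otimes> s) (y \<otimes> s)" "Z (x \<otimes> s) (y \<otimes> s) \<subseteq> U"
proof -
  obtain p q where pq: "p \<in> carrier S" "q \<in> carrier S" "g \<in> Z p q" "Z p q \<subseteq> U"
    using assms unfolding openin_iff by blast
  obtain s where "s \<in> carrier S" "g \<in> Z (x \<otimes> s) (y \<otimes> s)" "Z (x \<otimes> s) (y \<otimes> s) \<subseteq> Z p q"
    using Z_compare[OF assms(3,4) pq(1,2) assms(5) pq(3)] by metis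
  then show ?thesis using that pq by blast
qed

text \<open>
  Koenig's lemma. Every \<open>Z (x \<otimes> s) (y \<otimes> s)\<close> is the union of its finitely many refinements by elements of degree
  \<open>vec 1\<close>. If \<open>Z x y\<close> had no finite subcover, a chain of \<open>s\<close> without finite subcover would have a limit tiling \<open>w\<close>; the
  arrow over \<open>w\<close> has a basic neighbourhood inside one member of the cover, and this contains a refinement along the chain.
\<close>

lemma compact_Z:
  assumes "x \<in> carrier S" "y \<in> carrier S"
  shows "compactin \<O> (Z x y)"
  unfolding compactin_def
proof (intro conjI allI impI)
  show "Z x y \<subseteq> topspace \<O>" using Z_subset_carrier assms topspace_groupoid by simp
  fix \<U> assume "(\<forall>U \<in> \<U>. openin \<O> U) \<and> Z x y \<subseteq> \<Union>\<U>"
  then have op: "\<And>U. U \<in> \<U> \<Longrightarrow> openin \<O> U" and cover: "Z x y \<subseteq> \<Union>\<U>" by auto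
  define good where "good s \<longleftrightarrow> (\<exists>\<F>. finite \<F> \<and> \<F> \<subseteq> \<U> \<and> Z (x \<otimes> s) (y \<otimes> s) \<subseteq> \<Union>\<F>)" for s
  have step: "\<exists>t. t \<in> level (vec 1) \<and> \<not> good (s \<otimes> t)" if s: "s \<in> carrier S" "\<not> good s" for s
  proof (rule ccontr)
    assume "\<not> ?thesis"
    then have "\<forall>t \<in> level (vec 1). \<exists>\<F>. finite \<F> \<and> \<F> \<subseteq> \<U> \<and> Z (x \<otimes> (s \<otimes> t)) (y \<otimes> (s \<otimes> t)) \<subseteq> \<Union>\<F>"
      unfolding good_def by blast
    then obtain f where f: "\<And>t. t \<in> level (vec 1) \<Longrightarrow> finite (f t) \<and> f t \<subseteq> \<U> \<and>
        Z (x \<otimes> (s \<otimes> t)) (y \<otimes> (s \<otimes> t)) \<subseteq> \<Union>(f t)" by metis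
    have xs: "x \<otimes> s \<in> carrier S" "y \<otimes> s \<in> carrier S" using assms s by auto
    have "Z (x \<otimes> s) (y \<otimes> s) \<subseteq> \<Union>(\<Union>t \<in> level (vec 1). f t)"
    proof
      fix g assume g: "g \<in> Z (x \<otimes> s) (y \<otimes> s)"
      obtain t where t: "t \<in> level (d (y \<otimes> s) + vec 1 - d (y \<otimes> s))"
        "g \<in> Z (x \<otimes> s \<otimes> t) (y \<otimes> s \<otimes> t)"
        using Z_refine[OF xs g vec_le_add] by metis
      have t1: "t \<in> level (vec 1)" using t(1) by simp
      have "g \<in> Z (x \<otimes> (s \<otimes> t)) (y \<otimes> (s \<otimes> t))"
        using t(2) m_assoc assms s levelD(1)[OF t1] by simp
      then show "g \<in> \<Union>(\<Union>t \<in> level (vec 1). f t)" using f[OF t1] t1 by blast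
    qed
    moreover have "finite (\<Union>t \<in> level (vec 1). f t)" "(\<Union>t \<in> level (vec 1). f t) \<subseteq> \<U>"
      using f by auto
    ultimately have "good s" unfolding good_def by blast
    then show False using s by simp
  qed
  have "good \<one>"
  proof (rule ccontr)
    assume bad: "\<not> good \<one>"
    define nxt where "nxt s = s \<otimes> (SOME t. t \<in> level (vec 1) \<and> \<not> good (s \<otimes> t))" for s
    define c where "c j = (nxt ^^ j) \<one>" for j
    have nxt: "\<exists>t \<in> level (vec 1). nxt s = s \<otimes> t \<and> \<not> good (nxt s)" if s: "s \<in> carrier S" "\<not> good s" for s
      using someI_ex[OF step[OF s]] unfolding nxt_def by blast
    have c: "c j \<in> level (vec j) \<and> \<not> good (c j)" for j
    proof (induction j)
      case 0
      have "vec 0 = (0 :: nat ^ 'k)" by (simp add: vec_eq_iff)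
      then show ?case using bad by (simp add: c_def level_zero)
    next
      case (Suc j)
      have v: "vec (Suc j) = vec j + (vec 1 :: nat ^ 'k)" by (simp add: vec_eq_iff)
      obtain t where "t \<in> level (vec 1)" "nxt (c j) = c j \<otimes> t" "\<not> good (nxt (c j))"
        using nxt[of "c j"] Suc levelD(1) by blast
      then show ?case using level_mult[of "c j" "vec j" t "vec 1"] Suc v by (simp add: c_def)
    qed
    have chain: "c j \<preceq> c (Suc j)" for j
    proof -
      obtain t where "t \<in> level (vec 1)" "nxt (c j) = c j \<otimes> t"
        using nxt[of "c j"] c[of j] levelD(1) by blast
      then show ?thesis using prefixI levelD(1) by (simp add: c_def)
    qed
    obtain w where w: "w \<in> X" "\<And>j. w (0, vec j) = c j" using tiling_of_chain[of c] c chain by metis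
    define g where "g = arrow x w y"
    have g: "g \<in> Z x y" unfolding g_def using w Z_I by blast
    then obtain U where U: "U \<in> \<U>" "g \<in> U" using cover by blast
    obtain p q where pq: "p \<in> carrier S" "q \<in> carrier S" "g \<in> Z p q" "Z p q \<subseteq> U"
      using op[OF U(1)] U(2) unfolding openin_iff by blast
    obtain j where j: "d q \<le> vec j" using vec_le_const by blast
    have cj: "c j \<in> carrier S" "d (c j) = vec j" using c[of j] levelD by auto
    have gj: "g \<in> Z (x \<otimes> c j) (y \<otimes> c j)"
    proof -
      have w': "w = c j \<rhd> shift (vec j) w" using head_shift[OF w(1), of "vec j"] w(2) by simp
      show ?thesis unfolding Z_iff g_def
        by (rule bexI[of _ "shift (vec j) w"], subst w', subst (2) w')
          (simp_all add: prepend_mult[OF assms(1) cj(1)] prepend_mult[OF assms(2) cj(1)]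
            shift_closed w(1) degree_mult assms cj int_vec_add)
    qed
    have "d q \<le> d (y \<otimes> c j)" using order_trans[OF j] assms cj by (simp add: degree_mult)
    then obtain t where t: "t \<in> level (d (y \<otimes> c j) - d q)" "g \<in> Z (p \<otimes> t) (q \<otimes> t)"
      "d (q \<otimes> t) = d (y \<otimes> c j)"
      using Z_refine[OF pq(1-3)] by metis
    have tS: "t \<in> carrier S" using t levelD by blast
    have S4: "x \<otimes> c j \<in> carrier S" "y \<otimes> c j \<in> carrier S" "p \<otimes> t \<in> carrier S" "q \<otimes> t \<in> carrier S"
      using assms cj tS pq by auto
    have "x \<otimes> c j = p \<otimes> t" "y \<otimes> c j = q \<otimes> t"
      using Z_unique[OF S4 gj t(2) t(3)[symmetric]] .
    then have "Z (x \<otimes> c j) (y \<otimes> c j) \<subseteq> U" using Z_subset[OF pq(1,2) tS] pq by simp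
    then have "good (c j)" unfolding good_def using U by (intro exI[of _ "{U}"]) simp
    then show False using c by blast
  qed
  then show "\<exists>\<F>. finite \<F> \<and> \<F> \<subseteq> \<U> \<and> Z x y \<subseteq> \<Union>\<F>"
    unfolding good_def using assms by simp
qed

lemma unit_Z: "w \<in> X \<Longrightarrow> (w, 0, w) \<in> Z (w (0, n)) (w (0, n))"
  using Z_I[OF shift_closed[of w n], of "w (0, n)" "w (0, n)"] by (simp add: head_shift)

lemma Z_diagonal: "y \<in> carrier S \<Longrightarrow> Z y y \<subseteq> identities \<G>"
  by (auto simp: Z_iff identities_eq)

lemma open_identities: "openin \<O> (identities \<G>)"
  unfolding openin_iff
proof
  fix g assume "g \<in> identities \<G>"
  then obtain w where w: "w \<in> X" "g = (w, 0, w)" by (auto simp: identities_eq)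
  then show "\<exists>x \<in> carrier S. \<exists>y \<in> carrier S. g \<in> Z x y \<and> Z x y \<subseteq> identities \<G>"
    using unit_Z[OF w(1), of 0] Z_diagonal head_closed[OF w(1)] by blast
qed

lemma identities_Z: "identities \<G> = Z \<one> \<one>"
  by (auto simp: identities_eq Z_iff)

lemma openin_identities: "openin (subtopology \<O> (identities \<G>)) U \<longleftrightarrow> openin \<O> U \<and> U \<subseteq> identities \<G>"
  by (rule openin_open_subtopology[OF open_identities])

text \<open>
  Identities over tilings with different prefixes of some degree are separated by the sets \<open>Z y y\<close>. These are
  clopen among the identities, because the other elements of the same degree cover the complement.
\<close>

lemma boolean_identities:
  "compact_space (subtopology \<O> (identities \<G>))"
  "Hausdorff_space (subtopology \<O> (identities \<G>))"
  "has_clopen_basis (subtopology \<O> (identities \<G>))"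
proof -
  have sub: "identities \<G> \<subseteq> topspace \<O>" using open_identities openin_subset by blast
  then have top: "topspace (subtopology \<O> (identities \<G>)) = identities \<G>" by auto
  show "compact_space (subtopology \<O> (identities \<G>))"
    using compact_Z[OF one_closed one_closed] unfolding identities_Z compactin_subspace by simp
  show "Hausdorff_space (subtopology \<O> (identities \<G>))"
    unfolding Hausdorff_space_def top openin_identities
  proof (intro allI impI)
    fix g h assume gh: "g \<in> identities \<G> \<and> h \<in> identities \<G> \<and> g \<noteq> h"
    then obtain w v where w: "w \<in> X" "g = (w, 0, w)" and v: "v \<in> X" "h = (v, 0, v)"
      by (auto simp: identities_eq)
    then have "w \<noteq> v" using gh by auto
    then obtain n where n: "w (0, n) \<noteq> v (0, n)" using tiling_eqI[OF w(1) v(1), of 0] by auto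
    let ?a = "w (0, n)" and ?b = "v (0, n)"
    have ab: "?a \<in> carrier S" "?b \<in> carrier S" "d ?a = n" "d ?b = n" using w v by auto
    have "disjnt (Z ?a ?a) (Z ?b ?b)"
      unfolding disjnt_iff using Z_unique[OF ab(1,1,2,2)] n ab by metis
    then show "\<exists>U V. (openin \<O> U \<and> U \<subseteq> identities \<G>) \<and> (openin \<O> V \<and> V \<subseteq> identities \<G>) \<and>
        g \<in> U \<and> h \<in> V \<and> disjnt U V"
      using open_Z ab Z_diagonal unit_Z w v by metis
  qed
  show "has_clopen_basis (subtopology \<O> (identities \<G>))"
    unfolding has_clopen_basis_def closedin_def top openin_identities
  proof (intro allI impI)
    fix U g assume U: "(openin \<O> U \<and> U \<subseteq> identities \<G>) \<and> g \<in> U"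
    then obtain w where w: "w \<in> X" "g = (w, 0, w)" by (auto simp: identities_eq)
    have g: "g \<in> Z \<one> \<one>" using U identities_Z by blast
    obtain s where s: "s \<in> carrier S" "g \<in> Z (\<one> \<otimes> s) (\<one> \<otimes> s)" "Z (\<one> \<otimes> s) (\<one> \<otimes> s) \<subseteq> U"
      using Z_nbhd[OF _ _ one_closed one_closed g] U by metis
    then have s': "g \<in> Z s s" "Z s s \<subseteq> U" by simp_all
    have "openin \<O> (identities \<G> - Z s s)"
      unfolding openin_iff
    proof
      fix h assume h: "h \<in> identities \<G> - Z s s"
      then obtain v where v: "v \<in> X" "h = (v, 0, v)" by (auto simp: identities_eq)
      let ?b = "v (0, d s)"
      have b: "?b \<in> carrier S" "d ?b = d s" using v by auto
      have "?b \<noteq> s" using h v unit_Z[OF v(1), of "d s"] by auto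
      then have "Z ?b ?b \<inter> Z s s = {}" using Z_unique[OF b(1,1) s(1,1)] b by auto
      then show "\<exists>x \<in> carrier S. \<exists>y \<in> carrier S. h \<in> Z x y \<and> Z x y \<subseteq> identities \<G> - Z s s"
        using b unit_Z[OF v(1)] v Z_diagonal[OF b(1)] by blast
    qed
    then show "\<exists>V. (openin \<O> V \<and> V \<subseteq> identities \<G>) \<and>
        (V \<subseteq> identities \<G> \<and> openin \<O> (identities \<G> - V) \<and> identities \<G> - V \<subseteq> identities \<G>) \<and>
        g \<in> V \<and> V \<subseteq> U"
      using s s' open_Z Z_diagonal by (intro exI[of _ "Z s s"]) auto
  qed
qed

lemma ginv_Z: "ginv \<G> ` Z x y = Z y x"
  unfolding basic_open_def image_def by (auto simp: ginv_eq) (metis minus_diff_eq fst_conv snd_conv)+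

lemma continuous_ginv: "continuous_map \<O> \<O> (ginv \<G>)"
  unfolding continuous_map_def topspace_groupoid
proof (intro conjI allI impI)
  show "ginv \<G> \<in> carrier \<G> \<rightarrow> carrier \<G>" using ginv_carrier by blast
  fix U assume U: "openin \<O> U"
  show "openin \<O> {g \<in> carrier \<G>. ginv \<G> g \<in> U}"
    unfolding openin_iff
  proof
    fix g assume g: "g \<in> {g \<in> carrier \<G>. ginv \<G> g \<in> U}"
    then obtain x y where xy: "x \<in> carrier S" "y \<in> carrier S" "ginv \<G> g \<in> Z x y" "Z x y \<subseteq> U"
      using U unfolding openin_iff by blast
    have "ginv \<G> (ginv \<G> g) = g" by (simp add: ginv_eq)
    then have "g \<in> Z y x" using xy(3) ginv_Z[of x y] by (metis imageI)
    moreover have "Z y x \<subseteq> {g \<in> carrier \<G>. ginv \<G> g \<in> U}"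
      using Z_subset_carrier[OF xy(2,1)] ginv_Z[of y x] xy(4) by blast
    ultimately show "\<exists>x \<in> carrier S. \<exists>y \<in> carrier S. g \<in> Z x y \<and> Z x y \<subseteq> {g \<in> carrier \<G>. ginv \<G> g \<in> U}"
      using xy by blast
  qed
qed

lemma Z_mult:
  assumes "x \<in> carrier S" "y \<in> carrier S" "z \<in> carrier S" "g \<in> Z x y" "h \<in> Z y z" "snd (snd g) = fst h"
  shows "gmult \<G> g h \<in> Z x z"
proof -
  obtain w where w: "w \<in> X" "g = arrow x w y" using assms unfolding Z_iff by blast
  obtain v where v: "v \<in> X" "h = arrow y v z" using assms unfolding Z_iff by blast
  have "w = v" using assms w v by simp
  then show ?thesis unfolding Z_iff gmult_eq using w v by auto
qed

lemma Z_factor_refine: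
  assumes "x \<in> carrier S" "y \<in> carrier S" "z \<in> carrier S" "s \<in> carrier S"
    and g: "g \<in> Z x y" and h: "h \<in> Z y z" and gh: "snd (snd g) = fst h"
    and m: "gmult \<G> g h \<in> Z (x \<otimes> s) (z \<otimes> s)"
  shows "g \<in> Z (x \<otimes> s) (y \<otimes> s)" "h \<in> Z (y \<otimes> s) (z \<otimes> s)"
proof -
  obtain w where w: "w \<in> X" "g = arrow x w y" using g unfolding Z_iff by blast
  obtain v where v: "v \<in> X" "h = arrow y v z" using h unfolding Z_iff by blast
  obtain u where u: "u \<in> X" "snd (snd (gmult \<G> g h)) = (z \<otimes> s) \<rhd> u" using m unfolding Z_iff by auto
  have wv: "w = v" using gh w v assms by simp
  have "z \<rhd> v = z \<rhd> s \<rhd> u" using u v prepend_mult[OF assms(3,4) u(1)] by (simp add: gmult_eq)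
  then have vu: "v = s \<rhd> u" using v u assms by simp
  have "g = arrow (x \<otimes> s) u (y \<otimes> s)"
    "h = arrow (y \<otimes> s) u (z \<otimes> s)"
    using w v wv vu assms u by (simp_all add: prepend_mult degree_mult int_vec_add)
  then show "g \<in> Z (x \<otimes> s) (y \<otimes> s)" "h \<in> Z (y \<otimes> s) (z \<otimes> s)" using Z_I u by metis+
qed

text \<open>
  Composable arrows can be placed in \<open>Z a' b'\<close> and \<open>Z b' e'\<close> with the same middle element \<open>b'\<close>; then all composable
  products of these two sets lie in \<open>Z a' e'\<close>.
\<close>

lemma Z_composableE:
  assumes g: "g \<in> Z a b" and h: "h \<in> Z c e" and S: "a \<in> carrier S" "b \<in> carrier S" "c \<in> carrier S" "e \<in> carrier S"
    and gh: "snd (snd g) = fst h"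
  obtains s t where "s \<in> carrier S" "t \<in> carrier S" "b \<otimes> s = c \<otimes> t" "g \<in> Z (a \<otimes> s) (b \<otimes> s)"
    "h \<in> Z (c \<otimes> t) (e \<otimes> t)"
proof -
  obtain w where w: "w \<in> X" "g = arrow a w b" using g unfolding Z_iff by blast
  obtain v where v: "v \<in> X" "h = arrow c v e" using h unfolding Z_iff by blast
  have bc: "b \<rhd> w = c \<rhd> v" using gh w v by simp
  obtain s t u where st: "s \<in> carrier S" "t \<in> carrier S" "u \<in> X" "w = s \<rhd> u" "v = t \<rhd> u" "b \<otimes> s = c \<otimes> t"
    using common_tail[OF S(2,3) w(1) v(1) bc vec_le_add vec_le_add2] by metis
  have "g = arrow (a \<otimes> s) u (b \<otimes> s)"
    "h = arrow (c \<otimes> t) u (e \<otimes> t)"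
    using w v S st(1-5) by (simp_all add: prepend_mult degree_mult int_vec_add)
  then have "g \<in> Z (a \<otimes> s) (b \<otimes> s)" "h \<in> Z (c \<otimes> t) (e \<otimes> t)" using Z_I st(3) by metis+
  then show ?thesis using that st by blast
qed

lemma continuous_gmult:
  "continuous_map (subtopology (prod_topology \<O> \<O>) (composable \<G>)) \<O> (\<lambda>(g, h). gmult \<G> g h)"
  (is "continuous_map ?C \<O> ?f")
proof -
  have top: "topspace ?C = composable \<G>" by (auto simp: topspace_groupoid composable_iff)
  show ?thesis unfolding continuous_map_def top topspace_groupoid
  proof (intro conjI allI impI)
    show "?f \<in> composable \<G> \<rightarrow> carrier \<G>" using gmult_carrier by auto
    fix U assume U: "openin \<O> U"
    show "openin ?C {p \<in> composable \<G>. ?f p \<in> U}"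
    proof (subst openin_subopen, intro ballI)
      fix p assume p: "p \<in> {p \<in> composable \<G>. ?f p \<in> U}"
      obtain g h where gh: "p = (g, h)" by (cases p)
      have c: "g \<in> carrier \<G>" "h \<in> carrier \<G>" "snd (snd g) = fst h" and fU: "gmult \<G> g h \<in> U"
        using p by (auto simp: gh composable_iff)
      obtain a b where ab: "a \<in> carrier S" "b \<in> carrier S" "g \<in> Z a b" using carrierE[OF c(1)] by metis
      obtain b' e where be: "b' \<in> carrier S" "e \<in> carrier S" "h \<in> Z b' e" using carrierE[OF c(2)] by metis
      obtain s t where st: "s \<in> carrier S" "t \<in> carrier S" "b \<otimes> s = b' \<otimes> t" "g \<in> Z (a \<otimes> s) (b \<otimes> s)"
        "h \<in> Z (b' \<otimes> t) (e \<otimes> t)" using Z_composableE[OF ab(3) be(3) ab(1,2) be(1,2) c(3)] by metis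
      define x y z where "x = a \<otimes> s" and "y = b \<otimes> s" and "z = e \<otimes> t"
      have xyz: "x \<in> carrier S" "y \<in> carrier S" "z \<in> carrier S" "g \<in> Z x y" "h \<in> Z y z"
        using ab be st by (simp_all add: x_def y_def z_def)
      obtain r where r: "r \<in> carrier S" "gmult \<G> g h \<in> Z (x \<otimes> r) (z \<otimes> r)" "Z (x \<otimes> r) (z \<otimes> r) \<subseteq> U"
        using Z_nbhd[OF U fU xyz(1,3) Z_mult[OF xyz c(3)]] by metis
      let ?T = "(Z (x \<otimes> r) (y \<otimes> r) \<times> Z (y \<otimes> r) (z \<otimes> r)) \<inter> composable \<G>"
      have "openin ?C ?T"
        by (rule openin_subtopology_Int) (simp add: openin_prod_Times_iff open_Z xyz r)
      moreover have "p \<in> ?T"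
        using Z_factor_refine[OF xyz(1-3) r(1) xyz(4,5) c(3) r(2)] p by (simp add: gh)
      moreover have "?T \<subseteq> {p \<in> composable \<G>. ?f p \<in> U}"
      proof
        fix q assume q: "q \<in> ?T"
        obtain g' h' where q': "q = (g', h')" by (cases q)
        have "gmult \<G> g' h' \<in> Z (x \<otimes> r) (z \<otimes> r)"
          using q xyz r by (intro Z_mult[of _ "y \<otimes> r"]) (auto simp: q' composable_iff)
        then show "q \<in> {p \<in> composable \<G>. ?f p \<in> U}" using q r by (auto simp: q')
      qed
      ultimately show "\<exists>T. openin ?C T \<and> p \<in> T \<and> T \<subseteq> {p \<in> composable \<G>. ?f p \<in> U}" by blast
    qed
  qed
qed

lemma source_Z: "source \<G> ` Z x y = Z y y"
  unfolding basic_open_def image_def by (auto simp: source_eq)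

text \<open>
  The source map identifies \<open>Z x y\<close> with \<open>Z y y\<close>, and refinements with refinements.
\<close>

lemma source_local_homeomorphism:
  "local_homeomorphism \<O> (subtopology \<O> (identities \<G>)) (source \<G>)"
  unfolding local_homeomorphism_def topspace_groupoid
proof
  fix g assume "g \<in> carrier \<G>"
  then obtain x y where xy: "x \<in> carrier S" "y \<in> carrier S" "g \<in> Z x y" using carrierE by metis
  have sub: "subtopology (subtopology \<O> (identities \<G>)) (Z y y) = subtopology \<O> (Z y y)"
    unfolding subtopology_subtopology using Z_diagonal[OF xy(2)] by (simp add: Int_absorb1)
  have top: "topspace (subtopology \<O> (Z p q)) = Z p q" if "p \<in> carrier S" "q \<in> carrier S" for p q
    using open_Z[OF that] openin_subset by (auto simp: topspace_subtopology)
  have op: "openin (subtopology \<O> (Z p q)) U \<longleftrightarrow> openin \<O> U \<and> U \<subseteq> Z p q"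
    if "p \<in> carrier S" "q \<in> carrier S" for p q U
    by (rule openin_open_subtopology[OF open_Z[OF that]])
  have "homeomorphic_map (subtopology \<O> (Z x y)) (subtopology \<O> (Z y y)) (source \<G>)"
  proof (rule bijective_open_imp_homeomorphic_map)
    show "continuous_map (subtopology \<O> (Z x y)) (subtopology \<O> (Z y y)) (source \<G>)"
      unfolding continuous_map_def top[OF xy(1,2)] top[OF xy(2,2)] op[OF xy(1,2)] op[OF xy(2,2)]
    proof (intro conjI allI impI)
      show "source \<G> \<in> Z x y \<rightarrow> Z y y" using source_Z by blast
      fix U assume U: "openin \<O> U \<and> U \<subseteq> Z y y"
      show "{g \<in> Z x y. source \<G> g \<in> U} \<subseteq> Z x y" by blast
      show "openin \<O> {g \<in> Z x y. source \<G> g \<in> U}"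
        unfolding openin_iff
      proof
        fix h assume h: "h \<in> {g \<in> Z x y. source \<G> g \<in> U}"
        then obtain w where w: "w \<in> X" "h = arrow x w y" unfolding Z_iff by blast
        have hs: "source \<G> h \<in> Z y y" using h source_Z by blast
        obtain s where s: "s \<in> carrier S" "source \<G> h \<in> Z (y \<otimes> s) (y \<otimes> s)" "Z (y \<otimes> s) (y \<otimes> s) \<subseteq> U"
          using Z_nbhd[OF _ _ xy(2,2) hs] U h by blast
        obtain u where u: "u \<in> X" "source \<G> h = ((y \<otimes> s) \<rhd> u, 0, (y \<otimes> s) \<rhd> u)" using s(2) unfolding Z_iff by auto
        have "y \<rhd> w = y \<rhd> s \<rhd> u" using u w prepend_mult[OF xy(2) s(1) u(1)] by (simp add: source_eq)
        then have "w = s \<rhd> u" using w u s xy by simp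
        then have "h = arrow (x \<otimes> s) u (y \<otimes> s)"
          using w u s xy by (simp add: prepend_mult degree_mult int_vec_add)
        then have "h \<in> Z (x \<otimes> s) (y \<otimes> s)" using Z_I u by metis
        moreover have "Z (x \<otimes> s) (y \<otimes> s) \<subseteq> {g \<in> Z x y. source \<G> g \<in> U}"
          using Z_subset[OF xy(1,2) s(1)] source_Z[of "x \<otimes> s" "y \<otimes> s"] s(3) by blast
        ultimately show "\<exists>p \<in> carrier S. \<exists>q \<in> carrier S. h \<in> Z p q \<and> Z p q \<subseteq> {g \<in> Z x y. source \<G> g \<in> U}"
          using xy s by (meson m_closed)
      qed
    qed
    show "open_map (subtopology \<O> (Z x y)) (subtopology \<O> (Z y y)) (source \<G>)"
      unfolding open_map_def op[OF xy(1,2)] op[OF xy(2,2)]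
    proof (intro allI impI conjI)
      fix U assume U: "openin \<O> U \<and> U \<subseteq> Z x y"
      then show "source \<G> ` U \<subseteq> Z y y" using source_Z by blast
      show "openin \<O> (source \<G> ` U)"
        unfolding openin_iff
      proof
        fix h assume "h \<in> source \<G> ` U"
        then obtain g where g: "g \<in> U" "h = source \<G> g" by blast
        obtain p q where pq: "p \<in> carrier S" "q \<in> carrier S" "g \<in> Z p q" "Z p q \<subseteq> U"
          using U g unfolding openin_iff by blast
        then show "\<exists>x \<in> carrier S. \<exists>y \<in> carrier S. h \<in> Z x y \<and> Z x y \<subseteq> source \<G> ` U"
          using source_Z[of p q] g by blast
      qed
    qed
    show "source \<G> ` topspace (subtopology \<O> (Z x y)) = topspace (subtopology \<O> (Z y y))"
      using top xy source_Z by simp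
    show "inj_on (source \<G>) (topspace (subtopology \<O> (Z x y)))"
      unfolding top[OF xy(1,2)] using xy by (intro inj_onI) (auto simp: Z_iff source_eq)
  qed
  then show "\<exists>U. openin \<O> U \<and> g \<in> U \<and> openin (subtopology \<O> (identities \<G>)) (source \<G> ` U) \<and>
      homeomorphic_map (subtopology \<O> U) (subtopology (subtopology \<O> (identities \<G>)) (source \<G> ` U)) (source \<G>)"
    using xy open_Z Z_diagonal
    by (intro exI[of _ "Z x y"]) (simp add: source_Z sub openin_identities)
qed

theorem boolean_groupoid_tilings: "boolean_groupoid \<G> \<O>"
proof -
  interpret groupoid \<G> by (rule groupoid_tilings)
  show ?thesis
    by unfold_locales
      (fact topspace_groupoid continuous_gmult continuous_ginv source_local_homeomorphism boolean_identities)+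
qed

section \<open>Compact-open bisections\<close>

definition bisection_of :: "('s \<rightharpoonup> 's) \<Rightarrow> ('k, 's) tiling_arrow set"
  where "bisection_of \<alpha> = {g. \<exists>x y. \<alpha> y = Some x \<and> g \<in> Z x y}"

lemma bisection_ofI: "\<alpha> y = Some x \<Longrightarrow> g \<in> Z x y \<Longrightarrow> g \<in> bisection_of \<alpha>"
  by (auto simp: bisection_of_def)

lemma bisection_ofE:
  assumes "\<alpha> \<in> RS" "g \<in> bisection_of \<alpha>"
  obtains x y where "\<alpha> y = Some x" "g \<in> Z x y" "x \<in> carrier S" "y \<in> carrier S"
  using assms RS_closed by (auto simp: bisection_of_def)

lemma bisection_of_refine:
  assumes a: "\<alpha> \<in> RS" and xy: "\<alpha> y = Some x" "g \<in> Z x y" and n: "d y \<le> n"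
  obtains x' y' where "\<alpha> y' = Some x'" "g \<in> Z x' y'" "d y' = n" "x' \<in> carrier S" "y' \<in> carrier S"
proof -
  have S: "x \<in> carrier S" "y \<in> carrier S" using RS_closed a xy by auto
  obtain s where s: "s \<in> level (n - d y)" "g \<in> Z (x \<otimes> s) (y \<otimes> s)" "d (y \<otimes> s) = n"
    using Z_refine[OF S xy(2) n] by metis
  have sS: "s \<in> carrier S" using s levelD by blast
  show ?thesis using that[OF RS_mult[OF a xy(1) sS] s(2,3)] S sS by simp
qed

text \<open>
  Two arrows with the same source can be refined to have the same \<open>y\<close>; both then have \<open>\<alpha> y\<close> as target prefix.
\<close>

lemma bisection_of_source_inj:
  assumes a: "\<alpha> \<in> RS" and gh: "g \<in> bisection_of \<alpha>" "h \<in> bisection_of \<alpha>" "snd (snd g) = snd (snd h)"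
  shows "g = h"
proof -
  obtain x y where xy: "\<alpha> y = Some x" "g \<in> Z x y" using bisection_ofE[OF a gh(1)] by metis
  obtain p q where pq: "\<alpha> q = Some p" "h \<in> Z p q" using bisection_ofE[OF a gh(2)] by metis
  obtain x' y' where xy': "\<alpha> y' = Some x'" "g \<in> Z x' y'" "d y' = d y + d q" "x' \<in> carrier S" "y' \<in> carrier S"
    using bisection_of_refine[OF a xy vec_le_add] by metis
  obtain p' q' where pq': "\<alpha> q' = Some p'" "h \<in> Z p' q'" "d q' = d y + d q" "p' \<in> carrier S" "q' \<in> carrier S"
    using bisection_of_refine[OF a pq vec_le_add2] by metis
  obtain w where w: "w \<in> X" "g = arrow x' w y'"
    using xy'(2) unfolding Z_iff by blast
  obtain v where v: "v \<in> X" "h = arrow p' v q'"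
    using pq'(2) unfolding Z_iff by blast
  have "y' \<rhd> w = q' \<rhd> v" using gh(3) w v by simp
  then have "y' = q'" "w = v" using prepend_inject[OF xy'(5) pq'(5) w(1) v(1)] xy' pq' by simp_all
  then show ?thesis using w v xy'(1) pq'(1) by simp
qed

text \<open>
  The values on a level that lies in the domain suffice, since every source has a prefix in that level and
  arrows are determined by their sources.
\<close>

lemma bisection_of_level:
  assumes a: "\<alpha> \<in> RS" and n: "level n \<subseteq> dom \<alpha>"
  shows "bisection_of \<alpha> = (\<Union>y \<in> level n. Z (the (\<alpha> y)) y)"
proof (intro equalityI subsetI)
  fix g assume g: "g \<in> bisection_of \<alpha>"
  obtain x y where xy: "\<alpha> y = Some x" "g \<in> Z x y" "x \<in> carrier S" "y \<in> carrier S"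
    using bisection_ofE[OF a g] by metis
  obtain w where w: "w \<in> X" "g = arrow x w y"
    using xy unfolding Z_iff by blast
  let ?v = "y \<rhd> w"
  have v: "?v \<in> X" using w xy by simp
  have l: "?v (0, n) \<in> level n" using v by simp
  then obtain z where z: "\<alpha> (?v (0, n)) = Some z" using n by blast
  let ?h = "arrow z (shift n ?v) (?v (0, n))"
  have h: "?h \<in> Z z (?v (0, n))" by (rule Z_I[OF shift_closed[OF v]])
  have "g = ?h"
    by (rule bisection_of_source_inj[OF a g bisection_ofI[of \<alpha>, OF z h]]) (simp add: w head_shift[OF v])
  then have "g \<in> Z (the (\<alpha> (?v (0, n)))) (?v (0, n))" using h z by simp
  then show "g \<in> (\<Union>y \<in> level n. Z (the (\<alpha> y)) y)" using l by blast
next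
  fix g assume "g \<in> (\<Union>y \<in> level n. Z (the (\<alpha> y)) y)"
  then obtain y where y: "y \<in> level n" "g \<in> Z (the (\<alpha> y)) y" by blast
  then have "\<alpha> y = Some (the (\<alpha> y))" using n by auto
  then show "g \<in> bisection_of \<alpha>" using bisection_ofI y by metis
qed

lemma bisection_of_carrier: "\<alpha> \<in> RS \<Longrightarrow> bisection_of \<alpha> \<subseteq> carrier \<G>"
  using bisection_ofE Z_subset_carrier by blast

lemma bisection_of_identity:
  assumes "ideal I" "dense I"
  shows "bisection_of (partial_id I) = identities \<G>"
proof -
  obtain n where "\<And>m. n \<le> m \<Longrightarrow> level m \<subseteq> I" using dense_level[OF assms] by metis
  then have n: "level n \<subseteq> I" by simp
  have "bisection_of (partial_id I) = (\<Union>y \<in> level n. Z (the (partial_id I y)) y)"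
    using bisection_of_level[OF partial_id_RS[OF assms(1)]] n by simp
  also have "\<dots> = (\<Union>y \<in> level n. Z y y)"
    using n by (intro SUP_cong) (auto simp: partial_id_def)
  also have "\<dots> = identities \<G>"
  proof (intro equalityI subsetI)
    fix g assume "g \<in> identities \<G>"
    then obtain w where w: "w \<in> X" "g = (w, 0, w)" by (auto simp: identities_eq)
    then show "g \<in> (\<Union>y \<in> level n. Z y y)" using unit_Z[OF w(1)] head_level[OF w(1)] by blast
  qed (use Z_diagonal levelD in blast)
  finally show ?thesis .
qed

lemma bisection_of_converse:
  assumes "\<alpha> \<in> RS"
  shows "ginv \<G> ` bisection_of \<alpha> = bisection_of (converse_map \<alpha>)"
proof (intro equalityI subsetI)
  fix g assume "g \<in> ginv \<G> ` bisection_of \<alpha>"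
  then obtain h x y where "g = ginv \<G> h" "\<alpha> y = Some x" "h \<in> Z x y"
    unfolding bisection_of_def by blast
  then show "g \<in> bisection_of (converse_map \<alpha>)"
    using ginv_Z[of x y] by (intro bisection_ofI[of _ x y]) (auto simp: converse_map_iff[OF assms])
next
  fix g assume "g \<in> bisection_of (converse_map \<alpha>)"
  then obtain x y where xy: "\<alpha> y = Some x" "g \<in> Z y x"
    unfolding bisection_of_def converse_map_iff[OF assms] by blast
  then obtain h where "h \<in> Z x y" "g = ginv \<G> h" using ginv_Z[of x y] by blast
  then show "g \<in> ginv \<G> ` bisection_of \<alpha>" using bisection_ofI[of \<alpha>, OF xy(1)] by blast
qed

lemma bisection_of_comp:
  assumes a: "\<alpha> \<in> RS" and b: "\<beta> \<in> RS"
  shows "gset_mult \<G> (bisection_of \<alpha>) (bisection_of \<beta>) = bisection_of (\<alpha> \<circ>\<^sub>m \<beta>)"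
proof (intro equalityI subsetI)
  fix l assume "l \<in> gset_mult \<G> (bisection_of \<alpha>) (bisection_of \<beta>)"
  then obtain g h where gh: "g \<in> bisection_of \<alpha>" "h \<in> bisection_of \<beta>" "snd (snd g) = fst h" "l = gmult \<G> g h"
    unfolding gset_mult_def composable_iff by blast
  obtain x y where xy: "\<alpha> y = Some x" "g \<in> Z x y" "x \<in> carrier S" "y \<in> carrier S"
    using bisection_ofE[OF a gh(1)] by metis
  obtain p q where pq: "\<beta> q = Some p" "h \<in> Z p q" "p \<in> carrier S" "q \<in> carrier S"
    using bisection_ofE[OF b gh(2)] by metis
  obtain s t where st: "s \<in> carrier S" "t \<in> carrier S" "y \<otimes> s = p \<otimes> t" "g \<in> Z (x \<otimes> s) (y \<otimes> s)"
    "h \<in> Z (p \<otimes> t) (q \<otimes> t)"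
    using Z_composableE[OF xy(2) pq(2) xy(3,4) pq(3,4) gh(3)] by metis
  have "(\<alpha> \<circ>\<^sub>m \<beta>) (q \<otimes> t) = Some (x \<otimes> s)"
    unfolding comp_iff using RS_mult[OF a xy(1) st(1)] RS_mult[OF b pq(1) st(2)] st(3) by auto
  moreover have "l \<in> Z (x \<otimes> s) (q \<otimes> t)"
    unfolding gh(4) by (rule Z_mult[OF _ _ _ st(4) _ gh(3)]) (use xy pq st in auto)
  ultimately show "l \<in> bisection_of (\<alpha> \<circ>\<^sub>m \<beta>)" by (rule bisection_ofI)
next
  fix l assume "l \<in> bisection_of (\<alpha> \<circ>\<^sub>m \<beta>)"
  then obtain x y z where xyz: "\<beta> z = Some y" "\<alpha> y = Some x" "l \<in> Z x z"
    unfolding bisection_of_def comp_iff by blast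
  have S: "x \<in> carrier S" "y \<in> carrier S" "z \<in> carrier S" using RS_closed a b xyz by blast+
  obtain w where w: "w \<in> X" "l = arrow x w z"
    using xyz(3) unfolding Z_iff by blast
  let ?g = "arrow x w y"
  let ?h = "arrow y w z"
  have "?g \<in> bisection_of \<alpha>" "?h \<in> bisection_of \<beta>" using bisection_ofI Z_I[OF w(1)] xyz by blast+
  moreover have "(?g, ?h) \<in> composable \<G>" using arrowI S w by (simp add: composable_iff)
  moreover have "l = gmult \<G> ?g ?h" by (simp add: gmult_eq w)
  ultimately show "l \<in> gset_mult \<G> (bisection_of \<alpha>) (bisection_of \<beta>)"
    unfolding gset_mult_def by blast
qed

text \<open>
  Statements about targets follow from those about sources, applied to the inverse of \<open>\<alpha>\<close>.
\<close>

lemma bisection_of_bisection: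
  assumes a: "\<alpha> \<in> carrier T"
  shows "bisection \<G> (bisection_of \<alpha>)"
  unfolding bisection_def
proof (intro conjI ballI impI)
  have r: "\<alpha> \<in> RS" "converse_map \<alpha> \<in> RS" using a converse_map_T T_RS by blast+
  show "bisection_of \<alpha> \<subseteq> carrier \<G>" by (rule bisection_of_carrier[OF r(1)])
  show "g = h" if "g \<in> bisection_of \<alpha>" "h \<in> bisection_of \<alpha>" "source \<G> g = source \<G> h" for g h
    using bisection_of_source_inj[OF r(1)] that by (simp add: source_eq)
  show "g = h" if gh: "g \<in> bisection_of \<alpha>" "h \<in> bisection_of \<alpha>" "target \<G> g = target \<G> h" for g h
  proof -
    have "ginv \<G> g = ginv \<G> h"
      by (rule bisection_of_source_inj[OF r(2)])
        (use gh in \<open>auto simp: bisection_of_converse[OF r(1), symmetric] ginv_eq target_eq\<close>)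
    then show ?thesis by (simp add: ginv_eq prod_eq_iff)
  qed
  have dd: "ideal (dom \<alpha>)" "dense (dom \<alpha>)" "ideal (ran \<alpha>)" "dense (ran \<alpha>)"
    using a RS_ideal[OF r(1)] by (auto simp: T_iff)
  show "gset_mult \<G> (ginv \<G> ` bisection_of \<alpha>) (bisection_of \<alpha>) = identities \<G>"
    by (simp only: bisection_of_converse[OF r(1)] bisection_of_comp[OF r(2,1)] comp_converse[OF r(1)]
        bisection_of_identity[OF dd(1,2)])
  show "gset_mult \<G> (bisection_of \<alpha>) (ginv \<G> ` bisection_of \<alpha>) = identities \<G>"
    by (simp only: bisection_of_converse[OF r(1)] bisection_of_comp[OF r(1,2)] converse_comp[OF r(1)]
        bisection_of_identity[OF dd(3,4)])
qed

lemma bisection_of_open: "\<alpha> \<in> RS \<Longrightarrow> openin \<O> (bisection_of \<alpha>)"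
  unfolding openin_iff
proof
  fix g assume a: "\<alpha> \<in> RS" "g \<in> bisection_of \<alpha>"
  obtain x y where "\<alpha> y = Some x" "g \<in> Z x y" "x \<in> carrier S" "y \<in> carrier S"
    using bisection_ofE[OF a] by metis
  then show "\<exists>x \<in> carrier S. \<exists>y \<in> carrier S. g \<in> Z x y \<and> Z x y \<subseteq> bisection_of \<alpha>"
    using bisection_ofI by blast
qed

lemma bisection_of_compact: "\<alpha> \<in> carrier T \<Longrightarrow> compactin \<O> (bisection_of \<alpha>)"
proof -
  assume a: "\<alpha> \<in> carrier T"
  obtain n where "\<And>m. n \<le> m \<Longrightarrow> level m \<subseteq> dom \<alpha>" using T_dom_level[OF a] by metis
  then have n: "level n \<subseteq> dom \<alpha>" by simp
  have "compactin \<O> (Z (the (\<alpha> y)) y)" if y: "y \<in> level n" for y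
  proof (rule compact_Z)
    obtain x where "\<alpha> y = Some x" using n y by blast
    then show "the (\<alpha> y) \<in> carrier S" "y \<in> carrier S" using RS_closed[OF T_RS[OF a]] by auto
  qed
  then show ?thesis unfolding bisection_of_level[OF T_RS[OF a] n]
    by (intro compactin_Union) auto
qed

text \<open>
  Elements between essential ideals are built from a prefix replacement \<open>\<xi>\<close> on one level. The hypotheses are
  injectivity of the extension \<open>y \<otimes> s \<mapsto> \<xi> y \<otimes> s\<close>, and that every tiling has some \<open>\<xi> y\<close> as a prefix, which makes the range
  essential.
\<close>

lemma extend_level:
  assumes closed: "\<And>y. y \<in> level n \<Longrightarrow> \<xi> y \<in> carrier S"
    and inj: "\<And>y y' s s'. \<lbrakk>y \<in> level n; y' \<in> level n; s \<in> carrier S; s' \<in> carrier S; \<xi> y \<otimes> s = \<xi> y' \<otimes> s'\<rbrakk>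
      \<Longrightarrow> y \<otimes> s = y' \<otimes> s'"
    and covers: "\<And>v. v \<in> X \<Longrightarrow> \<exists>y \<in> level n. \<exists>w \<in> X. v = \<xi> y \<rhd> w"
  shows "\<exists>\<alpha> \<in> carrier T. \<forall>y \<in> level n. \<alpha> y = Some (\<xi> y)"
proof -
  define I where "I = right_ideal_gen S (level n)"
  define split where "split x = (SOME p. fst p \<in> level n \<and> snd p \<in> carrier S \<and> x = fst p \<otimes> snd p)" for x
  define \<alpha> where "\<alpha> x = (if x \<in> I then Some (\<xi> (fst (split x)) \<otimes> snd (split x)) else None)" for x
  have val: "\<alpha> (y \<otimes> s) = Some (\<xi> y \<otimes> s)" if y: "y \<in> level n" "s \<in> carrier S" for y s
  proof -
    define p where "p = split (y \<otimes> s)"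
    have "fst p \<in> level n \<and> snd p \<in> carrier S \<and> y \<otimes> s = fst p \<otimes> snd p"
      unfolding p_def split_def by (rule someI[of _ "(y, s)"]) (use y in simp)
    then have p: "fst p \<in> carrier S" "d (fst p) = n" "snd p \<in> carrier S" "y \<otimes> s = fst p \<otimes> snd p"
      using levelD by auto
    have yS: "y \<in> carrier S" "d y = d (fst p)" using levelD[OF y(1)] p by auto
    have "y = fst p" "s = snd p" using factor_unique[OF yS(1) y(2) p(1,3,4) yS(2)] .
    moreover have "y \<otimes> s \<in> I" using y unfolding I_def right_ideal_gen_def by blast
    ultimately show ?thesis unfolding \<alpha>_def p_def[symmetric] by simp
  qed
  have domE: "\<exists>y s. y \<in> level n \<and> s \<in> carrier S \<and> x = y \<otimes> s \<and> z = \<xi> y \<otimes> s" if x: "\<alpha> x = Some z" for x z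
  proof -
    have "x \<in> I" using x by (simp add: \<alpha>_def split: if_splits)
    then obtain y s where "y \<in> level n" "s \<in> carrier S" "x = y \<otimes> s"
      by (auto simp: I_def right_ideal_gen_def)
    then show ?thesis using val x by auto
  qed
  have dom: "dom \<alpha> = I" by (auto simp: \<alpha>_def dom_def)
  have ran: "ran \<alpha> = right_ideal_gen S (\<xi> ` level n)"
  proof (intro equalityI subsetI)
    fix z assume "z \<in> ran \<alpha>"
    then show "z \<in> right_ideal_gen S (\<xi> ` level n)" using domE by (fastforce simp: ran_def right_ideal_gen_def)
  next
    fix z assume "z \<in> right_ideal_gen S (\<xi> ` level n)"
    then obtain y s where "y \<in> level n" "s \<in> carrier S" "z = \<xi> y \<otimes> s" by (auto simp: right_ideal_gen_def)
    then show "z \<in> ran \<alpha>" using val by (auto intro: ranI)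
  qed
  have RS: "\<alpha> \<in> RS"
    unfolding RS_iff
  proof (intro conjI allI impI)
    show "ideal (dom \<alpha>)" unfolding dom I_def by (rule level_ideal)
    show "ideal (ran \<alpha>)" unfolding ran by (rule idealI) (use closed in auto)
    show "a = a'" if "\<alpha> a = Some b" "\<alpha> a' = Some b" for a a' b
      using domE[OF that(1)] domE[OF that(2)] inj by metis
    show "\<alpha> (a \<otimes> s) = Some (b \<otimes> s)" if ab: "\<alpha> a = Some b" and s: "s \<in> carrier S" for a b s
    proof -
      obtain y t where y: "y \<in> level n" "t \<in> carrier S" "a = y \<otimes> t" "b = \<xi> y \<otimes> t" using domE[OF ab] by blast
      then show ?thesis using val[OF y(1) m_closed[OF y(2) s]] closed[OF y(1)] levelD(1)[OF y(1)] s
        by (simp add: m_assoc)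
    qed
  qed
  have "level n \<subseteq> I"
  proof
    fix y assume "y \<in> level n"
    then show "y \<in> I" unfolding I_def level_ideal_mem by (simp add: level_def)
  qed
  then have "dense (dom \<alpha>)" unfolding dom using level_dense level_ideal I_def by metis
  moreover have "dense (ran \<alpha>)" unfolding dense_def
  proof
    fix a assume a: "a \<in> carrier S"
    obtain w where w: "w \<in> X" using tilings_nonempty by blast
    obtain y v where y: "y \<in> level n" "v \<in> X" "a \<rhd> w = \<xi> y \<rhd> v" using covers[of "a \<rhd> w"] a w by auto
    obtain s t where "s \<in> carrier S" "t \<in> carrier S" "a \<otimes> s = \<xi> y \<otimes> t"
      using common_tail[OF a closed[OF y(1)] w y(2,3) vec_le_add vec_le_add2] by metis
    then show "\<exists>s \<in> carrier S. a \<otimes> s \<in> ran \<alpha>" unfolding ran using y by (auto simp: right_ideal_gen_def)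
  qed
  ultimately have "\<alpha> \<in> carrier T" using RS by (simp add: T_iff)
  moreover have "\<alpha> y = Some (\<xi> y)" if "y \<in> level n" for y
    using val[OF that one_closed] levelD(1)[OF that] closed[OF that] by simp
  ultimately show ?thesis by blast
qed

lemma compact_open_cover:
  assumes "compactin \<O> A" "openin \<O> A"
  obtains F where "finite F" "F \<subseteq> carrier S \<times> carrier S"
    "A = (\<Union>p \<in> F. Z (fst p) (snd p))"
proof -
  define P where "P = {p. fst p \<in> carrier S \<and> snd p \<in> carrier S \<and> Z (fst p) (snd p) \<subseteq> A}"
  have "A \<subseteq> \<Union>((\<lambda>p. Z (fst p) (snd p)) ` P)"
  proof
    fix g assume "g \<in> A"
    then obtain x y where "x \<in> carrier S" "y \<in> carrier S" "g \<in> Z x y" "Z x y \<subseteq> A"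
      using assms(2) unfolding openin_iff by blast
    then show "g \<in> \<Union>((\<lambda>p. Z (fst p) (snd p)) ` P)"
      by (intro UN_I[of "(x, y)"]) (auto simp: P_def)
  qed
  moreover have "openin \<O> U" if "U \<in> (\<lambda>p. Z (fst p) (snd p)) ` P" for U
    using that open_Z by (auto simp: P_def)
  ultimately have "\<exists>\<F>. finite \<F> \<and> \<F> \<subseteq> (\<lambda>p. Z (fst p) (snd p)) ` P \<and> A \<subseteq> \<Union>\<F>"
    using compactinD[OF assms(1)] by simp
  then obtain \<F> where F: "finite \<F>" "\<F> \<subseteq> (\<lambda>p. Z (fst p) (snd p)) ` P" "A \<subseteq> \<Union>\<F>" by blast
  obtain Q where Q: "Q \<subseteq> P" "finite Q" "\<F> = (\<lambda>p. Z (fst p) (snd p)) ` Q"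
    using finite_subset_image[OF F(1,2)] by blast
  have "A = (\<Union>p \<in> Q. Z (fst p) (snd p))" using F(3) Q by (auto simp: P_def)
  moreover have "Q \<subseteq> carrier S \<times> carrier S" using Q(1) by (auto simp: P_def)
  ultimately show ?thesis using that[OF Q(2)] by blast
qed

text \<open>
  Write the bisection as a finite union of sets \<open>Z x y\<close> and let \<open>n\<close> bound the degrees of all \<open>y\<close>. After refinement every
  \<open>y\<close> of degree \<open>n\<close> occurs, with exactly one \<open>x = \<xi> y\<close>.
\<close>

lemma bisection_of_surj:
  assumes bis: "bisection \<G> A" and comp: "compactin \<O> A" and op: "openin \<O> A"
  obtains \<alpha> where "\<alpha> \<in> carrier T" "bisection_of \<alpha> = A"
proof -
  have AG: "A \<subseteq> carrier \<G>" using bis by (simp add: bisection_def)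
  have s_inj: "g = h" if "g \<in> A" "h \<in> A" "snd (snd g) = snd (snd h)" for g h
    using bis that by (auto simp: bisection_def source_eq)
  have t_inj: "g = h" if "g \<in> A" "h \<in> A" "fst g = fst h" for g h
    using bis that by (auto simp: bisection_def target_eq)
  have s_cov: "\<exists>g \<in> A. snd (snd g) = v" if v: "v \<in> X" for v
  proof -
    have "(v, 0, v) \<in> gset_mult \<G> (ginv \<G> ` A) A"
      using bis v by (auto simp: bisection_def identities_eq)
    then obtain g h where "h \<in> A" "(v, 0, v) = gmult \<G> g h" unfolding gset_mult_def by blast
    then show ?thesis by (auto simp: gmult_eq)
  qed
  have t_cov: "\<exists>g \<in> A. fst g = v" if v: "v \<in> X" for v
  proof -
    have "(v, 0, v) \<in> gset_mult \<G> A (ginv \<G> ` A)"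
      using bis v by (auto simp: bisection_def identities_eq)
    then obtain g h where "g \<in> A" "(v, 0, v) = gmult \<G> g h" unfolding gset_mult_def by blast
    then show ?thesis by (auto simp: gmult_eq)
  qed
  obtain F where F: "finite F" "F \<subseteq> carrier S \<times> carrier S"
    "A = (\<Union>p \<in> F. Z (fst p) (snd p))" by (rule compact_open_cover[OF comp op])
  obtain n where n: "\<And>p. p \<in> F \<Longrightarrow> d (snd p) \<le> n" using finite_vec_bounded[OF F(1), of "\<lambda>p. d (snd p)"] by blast
  have ex: "\<exists>x. x \<in> carrier S \<and> g \<in> Z x (snd (snd g) (0, n)) \<and> Z x (snd (snd g) (0, n)) \<subseteq> A" if g: "g \<in> A" for g
  proof -
    obtain p where p: "p \<in> F" "g \<in> Z (fst p) (snd p)" using F(3) g by blast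
    have pS: "fst p \<in> carrier S" "snd p \<in> carrier S" using F(2) p(1) by auto
    obtain s where s: "s \<in> level (n - d (snd p))" "g \<in> Z (fst p \<otimes> s) (snd p \<otimes> s)" "d (snd p \<otimes> s) = n"
      using Z_refine[OF pS p(2) n[OF p(1)]] by metis
    have sS: "s \<in> carrier S" using s levelD by blast
    have sub: "Z (fst p \<otimes> s) (snd p \<otimes> s) \<subseteq> A" using Z_subset[OF pS sS] F(3) p(1) by blast
    obtain w where w: "w \<in> X" "snd (snd g) = (snd p \<otimes> s) \<rhd> w" using s(2) unfolding Z_iff by auto
    have "snd (snd g) (0, n) = snd p \<otimes> s" using prepend_props(2)[OF _ w(1)] w(2) s(3) pS sS by (metis m_closed)
    then show ?thesis using s sub pS sS by (intro exI[of _ "fst p \<otimes> s"]) simp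
  qed
  have "\<exists>x. x \<in> carrier S \<and> Z x y \<subseteq> A" if y: "y \<in> level n" for y
  proof -
    obtain w where w: "w \<in> X" using tilings_nonempty by blast
    have yS: "y \<in> carrier S" "d y = n" using y levelD by auto
    obtain g where g: "g \<in> A" "snd (snd g) = y \<rhd> w" using s_cov[of "y \<rhd> w"] w yS by auto
    have "snd (snd g) (0, n) = y" using g prepend_props(2)[OF yS(1) w] yS by simp
    then show ?thesis using ex[OF g(1)] by auto
  qed
  then obtain \<xi> where \<xi>: "\<And>y. y \<in> level n \<Longrightarrow> \<xi> y \<in> carrier S" "\<And>y. y \<in> level n \<Longrightarrow> Z (\<xi> y) y \<subseteq> A" by metis
  have A_eq: "A = (\<Union>y \<in> level n. Z (\<xi> y) y)"
  proof (intro equalityI subsetI)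
    fix g assume g: "g \<in> A"
    obtain v where gv: "snd (snd g) = v" by blast
    have v: "v \<in> X" using g AG carrier_X gv by blast
    obtain y where yv: "v (0, n) = y" by blast
    have y: "y \<in> level n" using head_level[OF v] yv by blast
    obtain h where h: "h = arrow (\<xi> y) (shift n v) y" by blast
    have hZ: "h \<in> Z (\<xi> y) y" unfolding h by (rule Z_I[OF shift_closed[OF v]])
    then have "h \<in> A" using \<xi>(2)[OF y] by blast
    moreover have "snd (snd h) = v" using head_shift[OF v, of n] by (simp add: h yv)
    ultimately have "g = h" using s_inj[OF g] gv by simp
    then show "g \<in> (\<Union>y \<in> level n. Z (\<xi> y) y)" using hZ y by blast
  qed (use \<xi> in blast)
  have "\<exists>\<alpha> \<in> carrier T. \<forall>y \<in> level n. \<alpha> y = Some (\<xi> y)"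
  proof (rule extend_level)
    show "\<xi> y \<in> carrier S" if "y \<in> level n" for y using \<xi> that by blast
    show "\<exists>y \<in> level n. \<exists>w \<in> X. v = \<xi> y \<rhd> w" if v: "v \<in> X" for v
    proof -
      obtain g where g: "g \<in> A" "fst g = v" using t_cov[OF v] by blast
      then obtain y where y: "y \<in> level n" "g \<in> Z (\<xi> y) y" using A_eq by blast
      then obtain w where "w \<in> X" "fst g = \<xi> y \<rhd> w" unfolding Z_iff by auto
      then show ?thesis using y g by blast
    qed
    show "y \<otimes> s = y' \<otimes> s'"
      if y: "y \<in> level n" "y' \<in> level n" and s: "s \<in> carrier S" "s' \<in> carrier S" and eq: "\<xi> y \<otimes> s = \<xi> y' \<otimes> s'" for y y' s s'
    proof -
      obtain w where w: "w \<in> X" using tilings_nonempty by blast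
      have yS: "y \<in> carrier S" "y' \<in> carrier S" "d y = n" "d y' = n" using y levelD by auto
      let ?g = "arrow (\<xi> y) (s \<rhd> w) y"
      let ?h = "arrow (\<xi> y') (s' \<rhd> w) y'"
      have sw: "s \<rhd> w \<in> X" "s' \<rhd> w \<in> X" using s w by auto
      \<comment> \<open>Both arrows have the same target, hence are equal; as \<open>y\<close> and \<open>y'\<close> have the same degree, so have \<open>\<xi> y\<close> and \<open>\<xi> y'\<close>.\<close>
      have "?g \<in> A" "?h \<in> A" using \<xi>(2) y Z_I[OF sw(1)] Z_I[OF sw(2)] by blast+
      moreover have "fst ?g = fst ?h"
        using prepend_mult[OF \<xi>(1)[OF y(1)] s(1) w] prepend_mult[OF \<xi>(1)[OF y(2)] s(2) w] eq by simp
      ultimately have "?g = ?h" by (rule t_inj)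
      then have gh: "d (\<xi> y) = d (\<xi> y')" "y \<rhd> s \<rhd> w = y' \<rhd> s' \<rhd> w" using yS by (simp_all add: int_vec_inject)
      have "y = y'" by (rule prepend_inject(1)[OF yS(1,2) sw gh(2)]) (simp add: yS)
      moreover have "s = s'" by (rule factor_unique(2)[OF \<xi>(1)[OF y(1)] s(1) \<xi>(1)[OF y(2)] s(2) eq gh(1)])
      ultimately show ?thesis by simp
    qed
  qed
  then obtain \<alpha> where \<alpha>: "\<alpha> \<in> carrier T" "\<And>y. y \<in> level n \<Longrightarrow> \<alpha> y = Some (\<xi> y)" by blast
  have "bisection_of \<alpha> = (\<Union>y \<in> level n. Z (the (\<alpha> y)) y)"
    by (rule bisection_of_level[OF T_RS[OF \<alpha>(1)]]) (use \<alpha>(2) in auto)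
  also have "\<dots> = A" unfolding A_eq using \<alpha>(2) by simp
  finally show ?thesis using that \<alpha>(1) by blast
qed

lemma bisection_of_eq_iff:
  assumes a: "\<alpha> \<in> carrier T" and b: "\<beta> \<in> carrier T"
  shows "bisection_of \<alpha> = bisection_of \<beta> \<longleftrightarrow> (\<exists>n. \<forall>y \<in> level n. \<exists>x. \<alpha> y = Some x \<and> \<beta> y = Some x)"
proof
  assume eq: "bisection_of \<alpha> = bisection_of \<beta>"
  obtain n where "\<And>m. n \<le> m \<Longrightarrow> level m \<subseteq> dom \<alpha> \<inter> dom \<beta>" using T_common_dom_level[OF a b] by metis
  then have n: "level n \<subseteq> dom \<alpha> \<inter> dom \<beta>" by simp
  have "\<exists>x. \<alpha> y = Some x \<and> \<beta> y = Some x" if y: "y \<in> level n" for y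
  proof -
    obtain x x' where x: "\<alpha> y = Some x" "\<beta> y = Some x'" using n y by blast
    have S: "x \<in> carrier S" "x' \<in> carrier S" "y \<in> carrier S" using x RS_closed T_RS a b by blast+
    obtain w where w: "w \<in> X" using tilings_nonempty by blast
    let ?g = "arrow x w y"
    let ?h = "arrow x' w y"
    have gh: "?g \<in> Z x y" "?h \<in> Z x' y" using Z_I w by auto
    have "?g \<in> bisection_of \<beta>" "?h \<in> bisection_of \<beta>" using bisection_ofI gh x eq by blast+
    then have "?g = ?h" by (rule bisection_of_source_inj[OF T_RS[OF b]]) simp
    then have "?g \<in> Z x' y" using gh by metis
    then have "x = x'" using Z_unique(1)[OF S(1,3) S(2,3) gh(1)] by simp
    then show ?thesis using x by simp
  qed
  then show "\<exists>n. \<forall>y \<in> level n. \<exists>x. \<alpha> y = Some x \<and> \<beta> y = Some x" by blast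
next
  assume "\<exists>n. \<forall>y \<in> level n. \<exists>x. \<alpha> y = Some x \<and> \<beta> y = Some x"
  then obtain n where n: "\<forall>y \<in> level n. \<exists>x. \<alpha> y = Some x \<and> \<beta> y = Some x" by blast
  have "bisection_of \<alpha> = (\<Union>y \<in> level n. Z (the (\<alpha> y)) y)"
    by (rule bisection_of_level[OF T_RS[OF a]]) (use n in blast)
  also have "\<dots> = (\<Union>y \<in> level n. Z (the (\<beta> y)) y)"
    by (rule SUP_cong) (use n in force)+
  also have "\<dots> = bisection_of \<beta>"
    by (rule bisection_of_level[OF T_RS[OF b], symmetric]) (use n in blast)
  finally show "bisection_of \<alpha> = bisection_of \<beta>" .
qed

abbreviation full_group :: "('k, 's) tiling_arrow set monoid"
  where "full_group \<equiv> topological_full_group \<G> \<O>"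

lemma carrier_full_group: "bisection_of ` carrier T = carrier full_group"
proof (intro equalityI subsetI)
  fix A assume "A \<in> bisection_of ` carrier T"
  then show "A \<in> carrier full_group"
    using bisection_of_bisection bisection_of_compact bisection_of_open T_RS
    by (auto simp: topological_full_group_def)
next
  fix A assume "A \<in> carrier full_group"
  then have "bisection \<G> A" "compactin \<O> A" "openin \<O> A" by (simp_all add: topological_full_group_def)
  then obtain \<alpha> where "\<alpha> \<in> carrier T" "bisection_of \<alpha> = A" by (rule bisection_of_surj)
  then show "A \<in> bisection_of ` carrier T" by blast
qed

lemma mult_full_group:
  "\<alpha> \<in> carrier T \<Longrightarrow> \<beta> \<in> carrier T \<Longrightarrow>
    bisection_of \<alpha> \<otimes>\<^bsub>full_group\<^esub> bisection_of \<beta> = bisection_of (\<alpha> \<circ>\<^sub>m \<beta>)"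
  by (simp add: topological_full_group_def bisection_of_comp T_RS)

lemma one_full_group: "\<one>\<^bsub>full_group\<^esub> = bisection_of (partial_id (carrier S))"
  using bisection_of_identity[OF ideal_carrier] one_T_closed partial_id_T[OF ideal_carrier]
  by (simp add: topological_full_group_def)

lemma map_comp_assoc: "(f \<circ>\<^sub>m g) \<circ>\<^sub>m h = f \<circ>\<^sub>m (g \<circ>\<^sub>m h)"
  by (rule map_eqI) (auto simp: map_comp_Some_iff)

lemma group_full_group: "group full_group"
proof (rule groupI)
  fix A assume "A \<in> carrier full_group"
  then obtain \<alpha> where a: "\<alpha> \<in> carrier T" "A = bisection_of \<alpha>" using carrier_full_group by blast
  have dd: "ideal (dom \<alpha>)" "dense (dom \<alpha>)" using a RS_ideal[OF T_RS[OF a(1)]] by (auto simp: T_iff)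
  have "bisection_of (converse_map \<alpha>) \<otimes>\<^bsub>full_group\<^esub> A = \<one>\<^bsub>full_group\<^esub>"
    unfolding a(2) mult_full_group[OF converse_map_T[OF a(1)] a(1)] comp_converse[OF T_RS[OF a(1)]]
    using bisection_of_identity[OF dd] by (simp add: topological_full_group_def)
  then show "\<exists>B \<in> carrier full_group. B \<otimes>\<^bsub>full_group\<^esub> A = \<one>\<^bsub>full_group\<^esub>"
    using carrier_full_group converse_map_T[OF a(1)] by blast
  have "partial_id (carrier S) \<circ>\<^sub>m \<alpha> = \<alpha>"
    by (rule map_eqI) (use RS_closed[OF T_RS[OF a(1)]] in \<open>auto simp: comp_iff partial_id_iff\<close>)
  then show "\<one>\<^bsub>full_group\<^esub> \<otimes>\<^bsub>full_group\<^esub> A = A"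
    unfolding a(2) one_full_group mult_full_group[OF one_T_closed a(1)] by simp
  fix B assume "B \<in> carrier full_group"
  then obtain \<beta> where b: "\<beta> \<in> carrier T" "B = bisection_of \<beta>" using carrier_full_group by blast
  show "A \<otimes>\<^bsub>full_group\<^esub> B \<in> carrier full_group"
    unfolding a(2) b(2) mult_full_group[OF a(1) b(1)] using comp_T[OF a(1) b(1)] carrier_full_group by blast
  fix C assume "C \<in> carrier full_group"
  then obtain \<gamma> where c: "\<gamma> \<in> carrier T" "C = bisection_of \<gamma>" using carrier_full_group by blast
  show "A \<otimes>\<^bsub>full_group\<^esub> B \<otimes>\<^bsub>full_group\<^esub> C = A \<otimes>\<^bsub>full_group\<^esub> (B \<otimes>\<^bsub>full_group\<^esub> C)"
    unfolding a(2) b(2) c(2) using a(1) b(1) c(1)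
    by (simp add: mult_full_group comp_T map_comp_assoc)
next
  show "\<one>\<^bsub>full_group\<^esub> \<in> carrier full_group"
    unfolding one_full_group using one_T_closed carrier_full_group by blast
qed

lemma kernel_quotient_full_group: "kernel_quotient T full_group bisection_of"
proof (rule kernel_quotient.intro)
  show "min_group_cong T = {(s, t). s \<in> carrier T \<and> t \<in> carrier T \<and> bisection_of s = bisection_of t}"
  proof (rule Set.set_eqI)
    fix p show "p \<in> min_group_cong T \<longleftrightarrow>
        p \<in> {(s, t). s \<in> carrier T \<and> t \<in> carrier T \<and> bisection_of s = bisection_of t}"
      by (cases p) (simp add: min_group_cong_T bisection_of_eq_iff cong: conj_cong)
  qed
qed (simp_all add: one_T_closed comp_T carrier_full_group mult_full_group one_full_group group_full_group)

end

section \<open>The action on tilings\<close>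

locale aperiodic_k_monoid = branching_k_monoid S d
  for S :: "('s, 'b) monoid_scheme" (structure) and d :: "'s \<Rightarrow> nat ^ 'k::finite" +
  assumes aperiodic: "aperiodic S d"
begin

text \<open>
  If \<open>d x\<close> and \<open>d y\<close> are equal this is unique factorization. Otherwise let \<open>v = xw = yw\<close> for an aperiodic \<open>w\<close>: shifting
  \<open>v\<close> by \<open>d x\<close> and by \<open>d y\<close> gives the same tiling \<open>w\<close>, which therefore has the period \<open>d x - d y\<close>.
\<close>

lemma faithful:
  assumes S: "x \<in> carrier S" "y \<in> carrier S" and eq: "\<And>w. w \<in> X \<Longrightarrow> x \<rhd> w = y \<rhd> w"
  shows "x = y"
proof -
  obtain w where w: "w \<in> X" "\<not> eventually_periodic w" using aperiodic by (auto simp: aperiodic_def)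
  obtain v where v: "v = x \<rhd> w" by blast
  have sh: "shift (d x) v = w" "shift (d y) v = w"
    using prepend_props(3)[OF S(1) w(1)] prepend_props(3)[OF S(2) w(1)] eq[OF w(1)] v by simp_all
  have "d x = d y"
  proof (rule ccontr)
    assume ne: "d x \<noteq> d y"
    let ?p = "int_vec (d x) - int_vec (d y)"
    have "has_period w ?p"
      unfolding has_period_def
    proof (intro allI impI)
      fix m n m' n' :: "nat ^ 'k"
      assume a: "m \<le> n \<and> int_vec m' = int_vec m + ?p \<and> int_vec n' = int_vec n + ?p"
      have "int_vec (m' + d y) = int_vec (m + d x)" "int_vec (n' + d y) = int_vec (n + d x)"
        using a by (simp_all add: int_vec_add)
      then have mn: "m' + d y = m + d x" "n' + d y = n + d x" by (simp_all add: int_vec_inject)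
      have "m' + d y \<le> n' + d y" unfolding mn using a by (simp add: vec_diff_add_cancel)
      then have le: "m' \<le> n'" by (simp add: vec_diff_add_cancel)
      have "w (m', n') = shift (d y) v (m', n')" by (simp add: sh)
      also have "\<dots> = v (m + d x, n + d x)" by (simp add: shift_apply[OF le] mn)
      also have "\<dots> = shift (d x) v (m, n)" using a by (simp add: shift_apply)
      also have "\<dots> = w (m, n)" by (simp add: sh)
      finally show "w (m', n') = w (m, n)" .
    qed
    moreover have "?p \<noteq> 0" using ne by (simp add: int_vec_inject)
    ultimately have "periodic w" unfolding periodic_def by blast
    moreover have "shift 0 w = w"
      using prepend_props(3)[OF one_closed w(1)] w(1) by (simp add: degree_one)
    ultimately have "eventually_periodic w" unfolding eventually_periodic_def by metis
    then show False using w by simp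
  qed
  then show ?thesis using prepend_inject(1)[OF S w(1) w(1) eq[OF w(1)]] by simp
qed

definition act :: "('s \<rightharpoonup> 's) \<Rightarrow> ('k, 's) tiling \<Rightarrow> ('k, 's) tiling"
  where "act \<alpha> v = (if v \<in> X then fst (THE g. g \<in> bisection_of \<alpha> \<and> snd (snd g) = v) else v)"

lemma act_outside: "v \<notin> X \<Longrightarrow> act \<alpha> v = v"
  by (simp add: act_def)

lemma act_bisection:
  assumes a: "\<alpha> \<in> carrier T" and g: "g \<in> bisection_of \<alpha>"
  shows "act \<alpha> (snd (snd g)) = fst g"
proof -
  have "snd (snd g) \<in> X" using carrier_X bisection_of_carrier[OF T_RS[OF a]] g by blast
  moreover have "(THE h. h \<in> bisection_of \<alpha> \<and> snd (snd h) = snd (snd g)) = g"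
    using g by (intro the_equality bisection_of_source_inj[OF T_RS[OF a]]) auto
  ultimately show ?thesis by (simp add: act_def)
qed

lemma act_eq:
  assumes "\<alpha> \<in> carrier T" "\<alpha> y = Some x" "w \<in> X"
  shows "act \<alpha> (y \<rhd> w) = x \<rhd> w"
  using act_bisection[OF assms(1) bisection_ofI[of \<alpha>, OF assms(2) Z_I[OF assms(3)]]] by simp

lemma act_cases:
  assumes a: "\<alpha> \<in> carrier T" and v: "v \<in> X"
  obtains x y w where "\<alpha> y = Some x" "w \<in> X" "v = y \<rhd> w" "act \<alpha> v = x \<rhd> w" "x \<in> carrier S" "y \<in> carrier S"
proof -
  obtain n where "\<And>m. n \<le> m \<Longrightarrow> level m \<subseteq> dom \<alpha>" using T_dom_level[OF a] by metis
  then have "level n \<subseteq> dom \<alpha>" by simp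
  then have "v (0, n) \<in> dom \<alpha>" using head_level[OF v] by blast
  then obtain x where x: "\<alpha> (v (0, n)) = Some x" by blast
  have eq: "v (0, n) \<rhd> shift n v = v" by (rule head_shift[OF v])
  have "act \<alpha> v = x \<rhd> shift n v" using act_eq[OF a x shift_closed[OF v, of n]] unfolding eq .
  then show ?thesis using that[OF x shift_closed[OF v] eq[symmetric]] RS_closed[OF T_RS[OF a] x] by blast
qed

lemma act_closed: "\<alpha> \<in> carrier T \<Longrightarrow> v \<in> X \<Longrightarrow> act \<alpha> v \<in> X"
  by (metis act_cases prepend_closed)

lemma act_comp:
  assumes a: "\<alpha> \<in> carrier T" and b: "\<beta> \<in> carrier T"
  shows "act (\<alpha> \<circ>\<^sub>m \<beta>) = act \<alpha> \<circ> act \<beta>"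
proof
  fix v
  show "act (\<alpha> \<circ>\<^sub>m \<beta>) v = (act \<alpha> \<circ> act \<beta>) v"
  proof (cases "v \<in> X")
    case True
    obtain x y w where xyw: "\<beta> y = Some x" "w \<in> X" "v = y \<rhd> w" "act \<beta> v = x \<rhd> w"
      "x \<in> carrier S" "y \<in> carrier S" using act_cases[OF b True] by metis
    obtain p q u where pqu: "\<alpha> q = Some p" "u \<in> X" "x \<rhd> w = q \<rhd> u" "act \<alpha> (x \<rhd> w) = p \<rhd> u"
      "p \<in> carrier S" "q \<in> carrier S" using act_cases[OF a prepend_closed[OF xyw(5,2)]] by metis
    have "(arrow p u q, arrow x w y) \<in> composable \<G>"
      using arrowI[OF pqu(5,6,2)] arrowI[OF xyw(5,6,2)] pqu(3) by (simp add: composable_iff)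
    then have "gmult \<G> (arrow p u q) (arrow x w y) \<in> bisection_of (\<alpha> \<circ>\<^sub>m \<beta>)"
      unfolding bisection_of_comp[OF T_RS[OF a] T_RS[OF b], symmetric] gset_mult_def
      using bisection_ofI[of \<alpha>, OF pqu(1) Z_I[OF pqu(2)]] bisection_ofI[of \<beta>, OF xyw(1) Z_I[OF xyw(2)]]
      by blast
    from act_bisection[OF comp_T[OF a b] this] have "act (\<alpha> \<circ>\<^sub>m \<beta>) v = p \<rhd> u"
      by (simp add: gmult_eq xyw(3))
    then show ?thesis by (simp add: xyw(4) pqu(4))
  qed (simp add: act_outside)
qed

lemma act_partial_id:
  assumes "ideal I" "dense I"
  shows "act (partial_id I) = id"
proof
  fix v
  have I: "partial_id I \<in> carrier T" using partial_id_T assms by simp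
  show "act (partial_id I) v = id v"
  proof (cases "v \<in> X")
    case True
    obtain x y w where "partial_id I y = Some x" "v = y \<rhd> w" "act (partial_id I) v = x \<rhd> w"
      using act_cases[OF I True] by metis
    then show ?thesis by (simp add: partial_id_iff)
  qed (simp add: act_outside)
qed

lemma act_converse:
  assumes "\<alpha> \<in> carrier T"
  shows "act \<alpha> \<circ> act (converse_map \<alpha>) = id" "act (converse_map \<alpha>) \<circ> act \<alpha> = id"
  unfolding act_comp[OF assms converse_map_T[OF assms], symmetric]
    act_comp[OF converse_map_T[OF assms] assms, symmetric]
    comp_converse[OF T_RS[OF assms]] converse_comp[OF T_RS[OF assms]]
  using assms RS_ideal[OF T_RS[OF assms]] by (simp_all add: act_partial_id T_iff)

text \<open>
  Faithfulness up to the minimum group congruence; equality of the degrees of the two replacements of \<open>y\<close> comes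
  from aperiodicity.
\<close>

lemma act_eq_iff:
  assumes a: "\<alpha> \<in> carrier T" and b: "\<beta> \<in> carrier T"
  shows "act \<alpha> = act \<beta> \<longleftrightarrow> (\<exists>n. \<forall>y \<in> level n. \<exists>x. \<alpha> y = Some x \<and> \<beta> y = Some x)"
proof
  assume eq: "act \<alpha> = act \<beta>"
  obtain n where "\<And>m. n \<le> m \<Longrightarrow> level m \<subseteq> dom \<alpha> \<inter> dom \<beta>" using T_common_dom_level[OF a b] by metis
  then have n: "level n \<subseteq> dom \<alpha> \<inter> dom \<beta>" by simp
  have "\<exists>x. \<alpha> y = Some x \<and> \<beta> y = Some x" if y: "y \<in> level n" for y
  proof -
    obtain x x' where x: "\<alpha> y = Some x" "\<beta> y = Some x'" using n y by blast
    have "x = x'"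
    proof (rule faithful)
      show "x \<in> carrier S" "x' \<in> carrier S" using x RS_closed T_RS a b by blast+
      show "x \<rhd> w = x' \<rhd> w" if "w \<in> X" for w
        using act_eq[OF a x(1) that] act_eq[OF b x(2) that] eq by simp
    qed
    then show ?thesis using x by simp
  qed
  then show "\<exists>n. \<forall>y \<in> level n. \<exists>x. \<alpha> y = Some x \<and> \<beta> y = Some x" by blast
next
  assume "\<exists>n. \<forall>y \<in> level n. \<exists>x. \<alpha> y = Some x \<and> \<beta> y = Some x"
  then obtain n where n: "\<forall>y \<in> level n. \<exists>x. \<alpha> y = Some x \<and> \<beta> y = Some x" by blast
  show "act \<alpha> = act \<beta>"
  proof
    fix v show "act \<alpha> v = act \<beta> v"
    proof (cases "v \<in> X")
      case True
      obtain x where x: "\<alpha> (v (0, n)) = Some x" "\<beta> (v (0, n)) = Some x" using n head_level[OF True] by blast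
      show ?thesis
        using act_eq[OF a x(1) shift_closed[OF True]] act_eq[OF b x(2) shift_closed[OF True]]
          head_shift[OF True, of n] by metis
    qed (simp add: act_outside)
  qed
qed

definition homeos :: "(('k, 's) tiling \<Rightarrow> ('k, 's) tiling) set"
  where "homeos = act ` carrier T"

lemma inv_act: "\<alpha> \<in> carrier T \<Longrightarrow> inv_fun (act \<alpha>) = act (converse_map \<alpha>)"
  using act_converse by (rule inv_unique_comp)

lemma act_inject: "\<alpha> \<in> carrier T \<Longrightarrow> act \<alpha> v = act \<alpha> u \<longleftrightarrow> v = u"
  using act_converse(2) by (metis comp_apply id_apply)

text \<open>
  A permutation of the tilings that replaces prefixes of one fixed degree is induced by an element between
  essential ideals. That the prefix replacement extends injectively to the ideal uses aperiodicity again, as the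
  permutation itself only sees tilings.
\<close>

lemma homeosI:
  assumes outside: "\<And>v. v \<notin> X \<Longrightarrow> g v = v"
    and inj: "inj_on g X" and surj: "X \<subseteq> g ` X"
    and loc: "\<And>y. y \<in> level n \<Longrightarrow> \<exists>x \<in> carrier S. \<forall>w \<in> X. g (y \<rhd> w) = x \<rhd> w"
  shows "g \<in> homeos"
proof -
  obtain \<xi> where \<xi>: "\<And>y. y \<in> level n \<Longrightarrow> \<xi> y \<in> carrier S"
    "\<And>y w. y \<in> level n \<Longrightarrow> w \<in> X \<Longrightarrow> g (y \<rhd> w) = \<xi> y \<rhd> w" using loc by metis
  have "\<exists>\<alpha> \<in> carrier T. \<forall>y \<in> level n. \<alpha> y = Some (\<xi> y)"
  proof (rule extend_level)
    show "\<xi> y \<in> carrier S" if "y \<in> level n" for y using \<xi> that by blast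
    show "\<exists>y \<in> level n. \<exists>w \<in> X. v = \<xi> y \<rhd> w" if v: "v \<in> X" for v
    proof -
      obtain u where u: "u \<in> X" "v = g u" using v surj by blast
      have "v = \<xi> (u (0, n)) \<rhd> shift n u"
        using \<xi>(2)[OF head_level[OF u(1)] shift_closed[OF u(1)], of n] head_shift[OF u(1), of n] u(2) by simp
      then show ?thesis using head_level[OF u(1)] shift_closed[OF u(1)] by blast
    qed
    show "y \<otimes> s = y' \<otimes> s'"
      if y: "y \<in> level n" "y' \<in> level n" and s: "s \<in> carrier S" "s' \<in> carrier S" and eq: "\<xi> y \<otimes> s = \<xi> y' \<otimes> s'" for y y' s s'
    proof (rule faithful)
      have yS: "y \<in> carrier S" "y' \<in> carrier S" using y levelD by auto
      show "y \<otimes> s \<in> carrier S" "y' \<otimes> s' \<in> carrier S" using yS s by auto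
      fix w assume w: "w \<in> X"
      have "g (y \<rhd> s \<rhd> w) = (\<xi> y \<otimes> s) \<rhd> w"
        using \<xi>(2)[OF y(1) prepend_closed[OF s(1) w]] prepend_mult[OF \<xi>(1)[OF y(1)] s(1) w] by simp
      also have "\<dots> = g (y' \<rhd> s' \<rhd> w)"
        using \<xi>(2)[OF y(2) prepend_closed[OF s(2) w]] prepend_mult[OF \<xi>(1)[OF y(2)] s(2) w] eq by simp
      finally have "y \<rhd> s \<rhd> w = y' \<rhd> s' \<rhd> w"
        using inj_onD[OF inj] yS s w by simp
      then show "(y \<otimes> s) \<rhd> w = (y' \<otimes> s') \<rhd> w" using yS s w by (simp add: prepend_mult)
    qed
  qed
  then obtain \<alpha> where \<alpha>: "\<alpha> \<in> carrier T" "\<And>y. y \<in> level n \<Longrightarrow> \<alpha> y = Some (\<xi> y)" by blast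
  have "g = act \<alpha>"
  proof
    fix v show "g v = act \<alpha> v"
    proof (cases "v \<in> X")
      case True
      show ?thesis
        using act_eq[OF \<alpha>(1) \<alpha>(2)[OF head_level[OF True]] shift_closed[OF True], of n]
          \<xi>(2)[OF head_level[OF True] shift_closed[OF True], of n] head_shift[OF True, of n] by simp
    qed (simp add: outside act_outside)
  qed
  then show ?thesis using \<alpha>(1) by (simp add: homeos_def)
qed

text \<open>
  Given an injective prefix replacement \<open>h\<close> on \<open>P\<close> whose image is disjoint from \<open>P\<close>, the involution that exchanges \<open>P\<close> and
  \<open>h(P)\<close> is a prefix replacement at a degree that exceeds all degrees occurring in \<open>h\<close>. Both \<open>swap\<close> and
  \<open>compress\<close> for the group of tilings are instances.
\<close>

lemma swap_homeo:
  assumes P: "P \<subseteq> X" and hX: "h ` P \<subseteq> X" and disj: "h ` P \<inter> P = {}" and inj: "inj_on h P"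
    and loc: "\<And>y. y \<in> level n \<Longrightarrow>
      (\<exists>x \<in> carrier S. \<forall>w \<in> X. y \<rhd> w \<in> P \<and> h (y \<rhd> w) = x \<rhd> w) \<or> (\<forall>w \<in> X. y \<rhd> w \<notin> P)"
  obtains s where "s \<in> homeos" "\<And>v. v \<in> P \<Longrightarrow> s v = h v" "\<And>v. v \<notin> P \<union> h ` P \<Longrightarrow> s v = v"
proof -
  define s where "s v = (if v \<in> P then h v else if v \<in> h ` P then inv_into P h v else v)" for v
  have sP: "s v = h v" if "v \<in> P" for v using that by (simp add: s_def)
  have sh: "s (h v) = v" if "v \<in> P" for v
  proof -
    have "h v \<notin> P" using that disj by blast
    then show ?thesis using that inv_into_f_f[OF inj that] by (simp add: s_def)
  qed
  have so: "s v = v" if "v \<notin> P \<union> h ` P" for v using that by (simp add: s_def)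
  have ss: "s (s v) = v" for v
  proof -
    consider "v \<in> P" | u where "u \<in> P" "v = h u" | "v \<notin> P \<union> h ` P" by blast
    then show ?thesis by cases (simp_all add: sP sh so)
  qed
  have sX: "s v \<in> X" if v: "v \<in> X" for v
  proof -
    consider "v \<in> P" | u where "u \<in> P" "v = h u" | "v \<notin> P \<union> h ` P" by blast
    then show ?thesis
    proof cases
      case 1 then show ?thesis using sP hX by auto
    next
      case 2 then show ?thesis using sh P by auto
    next
      case 3 then show ?thesis using so v by simp
    qed
  qed
  define Y where "Y = {y \<in> level n. \<exists>w \<in> X. y \<rhd> w \<in> P}"
  have "\<forall>y \<in> Y. \<exists>x \<in> carrier S. \<forall>w \<in> X. y \<rhd> w \<in> P \<and> h (y \<rhd> w) = x \<rhd> w"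
    using loc by (auto simp: Y_def)
  then obtain \<xi> where \<xi>: "\<And>y. y \<in> Y \<Longrightarrow> \<xi> y \<in> carrier S" "\<And>y w. y \<in> Y \<Longrightarrow> w \<in> X \<Longrightarrow> y \<rhd> w \<in> P"
    "\<And>y w. y \<in> Y \<Longrightarrow> w \<in> X \<Longrightarrow> h (y \<rhd> w) = \<xi> y \<rhd> w" by metis
  have YS: "y \<in> carrier S" "d y = n" if "y \<in> Y" for y using that levelD by (auto simp: Y_def)
  have PY: "v (0, n) \<in> Y" if v: "v \<in> P" for v
    using head_shift[of v n] shift_closed[of v n] v P unfolding Y_def by (auto intro!: bexI[of _ "shift n v"])
  have "finite Y" by (simp add: Y_def)
  then obtain k where k: "\<And>y. y \<in> Y \<Longrightarrow> d (\<xi> y) \<le> k" using finite_vec_bounded[of Y "\<lambda>y. d (\<xi> y)"] by blast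
  have "s \<in> homeos"
  proof (rule homeosI)
    show "s v = v" if "v \<notin> X" for v using that P hX by (intro so) blast
    show "inj_on s X" by (rule inj_on_inverseI[of _ s]) (rule ss)
    show "X \<subseteq> s ` X"
    proof
      fix v assume "v \<in> X"
      then show "v \<in> s ` X" using sX ss by (metis imageI)
    qed
    fix z assume z: "z \<in> level (n + k)"
    then have zS: "z \<in> carrier S" "d z = n + k" using levelD by auto
    obtain y t where yt: "y \<in> level n" "t \<in> level (n + k - n)" "z = y \<otimes> t"
      using level_prefix[OF z vec_le_add] by metis
    have yS: "y \<in> carrier S" "t \<in> carrier S" using yt levelD by auto
    \<comment> \<open>\<open>z\<close> extends a replaced prefix, or a replacing one, or its tilings meet neither \<open>P\<close> nor \<open>h ` P\<close>.\<close>
    show "\<exists>x \<in> carrier S. \<forall>w \<in> X. s (z \<rhd> w) = x \<rhd> w"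
    proof (cases "y \<in> Y")
      case True
      have "s (z \<rhd> w) = (\<xi> y \<otimes> t) \<rhd> w" if w: "w \<in> X" for w
      proof -
        have tw: "t \<rhd> w \<in> X" using yS w by simp
        show ?thesis
          using sP[OF \<xi>(2)[OF True tw]] \<xi>(3)[OF True tw] prepend_mult[OF yS w]
            prepend_mult[OF \<xi>(1)[OF True] yS(2) w] yt(3) by simp
      qed
      then show ?thesis using \<xi>(1)[OF True] yS by (intro bexI[of _ "\<xi> y \<otimes> t"]) auto
    next
      case False
      show ?thesis
      proof (cases "\<exists>y' \<in> Y. \<xi> y' \<preceq> z")
        case True
        then obtain y' t' where y': "y' \<in> Y" "t' \<in> carrier S" "z = \<xi> y' \<otimes> t'" by (auto simp: is_prefix_def)
        have "s (z \<rhd> w) = (y' \<otimes> t') \<rhd> w" if w: "w \<in> X" for w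
        proof -
          have tw: "t' \<rhd> w \<in> X" using y' w by simp
          have "z \<rhd> w = h (y' \<rhd> t' \<rhd> w)"
            using \<xi>(3)[OF y'(1) tw] prepend_mult[OF \<xi>(1)[OF y'(1)] y'(2) w] y'(3) by simp
          then show ?thesis using sh[OF \<xi>(2)[OF y'(1) tw]] prepend_mult[OF YS(1)[OF y'(1)] y'(2) w] by simp
        qed
        then show ?thesis using YS y' by (intro bexI[of _ "y' \<otimes> t'"]) auto
      next
        case no: False
        have "s (z \<rhd> w) = z \<rhd> w" if w: "w \<in> X" for w
        proof (rule so, rule notI)
          assume "z \<rhd> w \<in> P \<union> h ` P"
          then show False
          proof
            assume zP: "z \<rhd> w \<in> P"
            have "y \<rhd> t \<rhd> w \<in> P" using zP prepend_mult[OF yS w] yt(3) by simp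
            then have "y \<in> Y" using yt(1) yS w by (auto simp: Y_def intro!: bexI[of _ "t \<rhd> w"])
            then show False using False by simp
          next
            assume "z \<rhd> w \<in> h ` P"
            then obtain v where v: "v \<in> P" "z \<rhd> w = h v" by blast
            have vX: "v \<in> X" using v P by blast
            define y' where "y' = v (0, n)"
            have y': "y' \<in> Y" using PY[OF v(1)] by (simp add: y'_def)
            have "h v = \<xi> y' \<rhd> shift n v"
              using \<xi>(3)[OF y' shift_closed[OF vX], of n] head_shift[OF vX, of n] by (simp add: y'_def)
            then have "z \<rhd> w = \<xi> y' \<rhd> shift n v" using v by simp
            moreover have "\<xi> y' \<preceq> (\<xi> y' \<rhd> shift n v) (0, n + k)"
              by (rule prepend_prefix[OF \<xi>(1)[OF y'] shift_closed[OF vX]])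
                (rule order_trans[OF k[OF y'] vec_le_add2])
            ultimately have "\<xi> y' \<preceq> (z \<rhd> w) (0, d z)" using zS by simp
            then have "\<xi> y' \<preceq> z" using prepend_props(2)[OF zS(1) w] by simp
            then show False using no y' by blast
          qed
        qed
        then show ?thesis using zS by blast
      qed
    qed
  qed
  then show ?thesis using that sP so by blast
qed

section \<open>Clopen sets of tilings\<close>

definition determined :: "nat ^ 'k \<Rightarrow> ('k, 's) tiling set \<Rightarrow> bool"
  where "determined n B \<longleftrightarrow> (\<forall>v \<in> B. \<forall>u \<in> X. u (0, n) = v (0, n) \<longrightarrow> u \<in> B)"

text \<open>
  By compactness these are the sets of tilings that are both open and closed.
\<close>

definition clopens :: "('k, 's) tiling set set"
  where "clopens = {B. B \<subseteq> X \<and> (\<exists>n. determined n B)}"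

lemma determinedD: "\<lbrakk>determined n B; v \<in> B; u \<in> X; u (0, n) = v (0, n)\<rbrakk> \<Longrightarrow> u \<in> B"
  by (auto simp: determined_def)

lemma determined_prepend:
  assumes "determined n B" "y \<in> level n" "w0 \<in> X" "y \<rhd> w0 \<in> B" "w \<in> X"
  shows "y \<rhd> w \<in> B"
proof (rule determinedD[OF assms(1,4)])
  have y: "y \<in> carrier S" "d y = n" using assms(2) levelD by auto
  show "y \<rhd> w \<in> X" using y assms(5) by simp
  show "(y \<rhd> w) (0, n) = (y \<rhd> w0) (0, n)"
    using prepend_props(2)[OF y(1) assms(3)] prepend_props(2)[OF y(1) assms(5)] y(2) by simp
qed

lemma determined_mono:
  assumes "determined n B" "B \<subseteq> X" "n \<le> m"
  shows "determined m B"
  unfolding determined_def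
proof (intro ballI impI)
  fix v u assume vu: "v \<in> B" "u \<in> X" "u (0, m) = v (0, m)"
  have "v \<in> X" using vu(1) assms(2) by blast
  then have "u (0, n) = v (0, n)" using head_eq_mono[of u v m n] vu(2,3) assms(3) by simp
  then show "u \<in> B" using determinedD[OF assms(1) vu(1,2)] by blast
qed

lemma clopens_common:
  assumes "A \<in> clopens" "B \<in> clopens"
  obtains n where "determined n A" "determined n B"
proof -
  obtain m n where "determined m A" "determined n B" using assms by (auto simp: clopens_def)
  then show ?thesis
    using that[of "m + n"] determined_mono[OF _ _ vec_le_add] determined_mono[OF _ _ vec_le_add2] assms
    by (auto simp: clopens_def)
qed

lemma clopens_Un:
  assumes "A \<in> clopens" "B \<in> clopens"
  shows "A \<union> B \<in> clopens"
proof -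
  obtain n where n: "determined n A" "determined n B" using clopens_common[OF assms] by metis
  have "determined n (A \<union> B)" using n unfolding determined_def by blast
  then show ?thesis using assms by (auto simp: clopens_def)
qed

lemma clopens_Diff:
  assumes "A \<in> clopens" "B \<in> clopens"
  shows "A - B \<in> clopens"
proof -
  obtain n where n: "determined n A" "determined n B" using clopens_common[OF assms] by metis
  have AX: "A \<subseteq> X" using assms by (simp add: clopens_def)
  have "determined n (A - B)"
    unfolding determined_def
  proof (intro ballI impI)
    fix v u assume vu: "v \<in> A - B" "u \<in> X" "u (0, n) = v (0, n)"
    have "u \<in> A" using determinedD[of n A v u] n(1) vu by blast
    moreover have "u \<notin> B" using determinedD[of n B u v] n(2) vu AX by auto
    ultimately show "u \<in> A - B" by blast
  qed
  then show ?thesis using assms by (auto simp: clopens_def)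
qed

lemma cylinder_clopen: "{v \<in> X. v (0, n) = y} \<in> clopens"
  by (auto simp: clopens_def determined_def)

text \<open>
  Membership of \<open>v\<close> in the image means that the inverse sends \<open>v\<close> into \<open>B\<close>. If the inverse is defined on level \<open>m\<close> and \<open>B\<close>
  is determined at \<open>n\<close>, the prefix of degree \<open>m + n\<close> decides this.
\<close>

lemma clopens_image:
  assumes a: "\<alpha> \<in> carrier T" and B: "B \<in> clopens"
  shows "act \<alpha> ` B \<in> clopens"
proof -
  let ?\<beta> = "converse_map \<alpha>"
  have b: "?\<beta> \<in> carrier T" by (rule converse_map_T[OF a])
  have ab: "act \<alpha> (act ?\<beta> v) = v" "act ?\<beta> (act \<alpha> v) = v" for v
    using act_converse[OF a] by (metis comp_apply id_apply)+
  have BX: "B \<subseteq> X" using B by (simp add: clopens_def)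
  obtain n where n: "determined n B" using B by (auto simp: clopens_def)
  obtain m where "\<And>m'. m \<le> m' \<Longrightarrow> level m' \<subseteq> dom ?\<beta>" using T_dom_level[OF b] by metis
  then have m: "level m \<subseteq> dom ?\<beta>" by simp
  have "determined (m + n) (act \<alpha> ` B)"
    unfolding determined_def
  proof (intro ballI impI)
    fix v u assume v: "v \<in> act \<alpha> ` B" and u: "u \<in> X" and eq: "u (0, m + n) = v (0, m + n)"
    have vB: "act ?\<beta> v \<in> B" using v ab by auto
    have vX: "v \<in> X" using v act_closed[OF a] BX by auto
    have hd: "u (0, m) = v (0, m)" by (rule head_eq_mono[OF u vX eq vec_le_add])
    obtain y where y: "?\<beta> (v (0, m)) = Some y" using m head_level[OF vX] by blast
    have yS: "y \<in> carrier S" using RS_closed(2)[OF T_RS[OF b] y] .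
    have "act ?\<beta> v = y \<rhd> shift m v"
      using act_eq[OF b y shift_closed[OF vX, of m]] head_shift[OF vX, of m] by simp
    moreover have "act ?\<beta> u = y \<rhd> shift m u"
      using act_eq[OF b y shift_closed[OF u, of m]] head_shift[OF u, of m] hd by simp
    moreover have "shift m u (0, n) = shift m v (0, n)"
      using shift_head[OF u, of m n] shift_head[OF vX, of m n] eq hd
        left_cancel[of "v (0, m)"] shift_closed u vX by simp
    ultimately have "act ?\<beta> u (0, d y + n) = act ?\<beta> v (0, d y + n)"
      using prepend_head_add[OF yS shift_closed[OF u]] prepend_head_add[OF yS shift_closed[OF vX]] by simp
    then have "act ?\<beta> u (0, n) = act ?\<beta> v (0, n)"
      using head_eq_mono[OF act_closed[OF b u] act_closed[OF b vX] _ vec_le_add2] by blast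
    then have "act ?\<beta> u \<in> B" using determinedD[OF n vB act_closed[OF b u]] by blast
    then show "u \<in> act \<alpha> ` B" using ab(1)[of u] by (metis imageI)
  qed
  then show ?thesis using act_closed[OF a] BX by (auto simp: clopens_def)
qed

lemma clopens_atomless:
  assumes B: "B \<in> clopens" "B \<noteq> {}"
  shows "\<exists>C \<in> clopens. C \<subset> B \<and> C \<noteq> {}"
proof -
  obtain v where v: "v \<in> B" using B by blast
  have vX: "v \<in> X" using v B by (auto simp: clopens_def)
  obtain n where n: "determined n B" using B by (auto simp: clopens_def)
  \<comment> \<open>Level \<open>vec 2\<close> has at least two elements by \<open>card_level_large\<close>, so refining by it splits \<open>B\<close>.\<close>
  let ?m = "n + vec 2" and ?w = "shift n v"
  have w: "?w \<in> X" by (rule shift_closed[OF vX])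
  have vh: "v (0, ?m) = v (0, n) \<otimes> ?w (0, vec 2)" using shift_head[OF vX] by simp
  have "level (vec 2) \<noteq> {?w (0, vec 2)}"
  proof
    assume "level (vec 2) = {?w (0, vec 2)}"
    then have "card (level (vec 2 :: nat ^ 'k)) = 1" by simp
    then show False using card_level_large[of 2] by simp
  qed
  then obtain b where b: "b \<in> level (vec 2)" "b \<noteq> ?w (0, vec 2)"
    using head_level[OF w, of "vec 2"] by blast
  have bS: "b \<in> carrier S" "d b = vec 2" using b levelD by auto
  define u where "u = v (0, n) \<rhd> b \<rhd> v"
  have uX: "u \<in> X" using vX bS by (simp add: u_def)
  have "u (0, n) = v (0, n)" using prepend_props(2)[of "v (0, n)" "b \<rhd> v"] vX bS by (simp add: u_def)
  then have uB: "u \<in> B" using determinedD[OF n v uX] by blast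
  have "u (0, ?m) = v (0, n) \<otimes> b"
    using prepend_head_add[of "v (0, n)" "b \<rhd> v" "vec 2"] prepend_props(2)[OF bS(1) vX] vX bS by (simp add: u_def)
  then have ne: "u (0, ?m) \<noteq> v (0, ?m)" using left_cancel[of "v (0, n)" b "?w (0, vec 2)"] b vh vX bS w by auto
  define C where "C = {x \<in> X. x (0, ?m) = v (0, ?m)}"
  have "C \<in> clopens" unfolding C_def by (rule cylinder_clopen)
  moreover have "v \<in> C" using vX by (simp add: C_def)
  moreover have "C \<subseteq> B"
  proof
    fix x assume x: "x \<in> C"
    then have "x (0, n) = v (0, n)" using head_eq_mono[OF _ vX _ vec_le_add] by (auto simp: C_def)
    then show "x \<in> B" using determinedD[OF n v] x by (auto simp: C_def)
  qed
  moreover have "u \<notin> C" using ne by (simp add: C_def)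
  ultimately show ?thesis using uB by blast
qed

text \<open>
  If \<open>\<alpha>\<close> moves \<open>v\<close>, then \<open>v\<close> and its image differ at some degree \<open>n\<close>. The tilings with the prefix \<open>y \<otimes> s\<close> of \<open>v\<close>, chosen so long
  that \<open>y \<otimes> s\<close> and its replacement both have degree at least \<open>n\<close>, are then displaced.
\<close>

lemma homeo_displaces:
  assumes a: "\<alpha> \<in> carrier T" and ne: "act \<alpha> \<noteq> id"
  shows "\<exists>B \<in> clopens. B \<noteq> {} \<and> act \<alpha> ` B \<inter> B = {}"
proof -
  obtain v where v: "act \<alpha> v \<noteq> v" using ne by (auto simp: fun_eq_iff)
  then have vX: "v \<in> X" using act_outside by blast
  obtain n where n: "act \<alpha> v (0, n) \<noteq> v (0, n)"
    using tiling_eqI[OF act_closed[OF a vX] vX, of 0] v by auto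
  obtain x y w where xyw: "\<alpha> y = Some x" "w \<in> X" "v = y \<rhd> w" "act \<alpha> v = x \<rhd> w" "x \<in> carrier S" "y \<in> carrier S"
    using act_cases[OF a vX] by metis
  define s where "s = w (0, n)"
  have s: "s \<in> carrier S" "d s = n" using xyw(2) by (simp_all add: s_def)
  have w: "w = s \<rhd> shift n w" using head_shift[OF xyw(2)] by (simp add: s_def)
  have sw: "shift n w \<in> X" by (rule shift_closed[OF xyw(2)])
  have \<alpha>s: "\<alpha> (y \<otimes> s) = Some (x \<otimes> s)" by (rule RS_mult[OF T_RS[OF a] xyw(1) s(1)])
  have xs: "x \<otimes> s \<in> carrier S" "n \<le> d (x \<otimes> s)" and ys: "y \<otimes> s \<in> carrier S" "n \<le> d (y \<otimes> s)"
    using xyw s by (simp_all add: degree_mult)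
  have v': "v = (y \<otimes> s) \<rhd> shift n w" "act \<alpha> v = (x \<otimes> s) \<rhd> shift n w"
    using prepend_mult[OF xyw(6) s(1) sw] prepend_mult[OF xyw(5) s(1) sw] xyw(3,4) w by simp_all
  define B where "B = {u \<in> X. u (0, d (y \<otimes> s)) = y \<otimes> s}"
  have vB: "v \<in> B" using prepend_props(2)[OF ys(1) sw] vX v'(1) by (simp add: B_def)
  have "act \<alpha> u \<notin> B" if u: "u \<in> B" for u
  proof
    assume auB: "act \<alpha> u \<in> B"
    have uX: "u \<in> X" and uh: "u (0, d (y \<otimes> s)) = y \<otimes> s" using u by (auto simp: B_def)
    have hn: "z (0, n) = v (0, n)" if "z \<in> B" for z
      using head_eq_mono[OF _ vX _ ys(2), of z] that vB by (auto simp: B_def)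
    obtain u' where u': "u' \<in> X" "u = (y \<otimes> s) \<rhd> u'" using head_shift[OF uX] uh shift_closed[OF uX] by metis
    have au: "act \<alpha> u = (x \<otimes> s) \<rhd> u'" using act_eq[OF a \<alpha>s u'(1)] u'(2) by simp
    have "act \<alpha> u (0, d (x \<otimes> s)) = act \<alpha> v (0, d (x \<otimes> s))"
      using prepend_props(2)[OF xs(1) u'(1)] prepend_props(2)[OF xs(1) sw] au v'(2) by simp
    then have "act \<alpha> u (0, n) = act \<alpha> v (0, n)"
      by (rule head_eq_mono[OF act_closed[OF a uX] act_closed[OF a vX] _ xs(2)])
    then show False using n hn[OF auB] by simp
  qed
  then have "act \<alpha> ` B \<inter> B = {}" by blast
  moreover have "B \<in> clopens" unfolding B_def by (rule cylinder_clopen)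
  ultimately show ?thesis using vB by blast
qed

lemma homeo_swap:
  assumes a: "\<alpha> \<in> carrier T" and B: "B \<in> clopens" and disj: "act \<alpha> ` B \<inter> B = {}"
  shows "\<exists>s \<in> homeos. (\<forall>v \<in> B. s v = act \<alpha> v) \<and> (\<forall>v. v \<notin> B \<union> act \<alpha> ` B \<longrightarrow> s v = v)"
proof -
  have BX: "B \<subseteq> X" using B by (simp add: clopens_def)
  obtain m where m: "determined m B" using B by (auto simp: clopens_def)
  obtain n where n: "\<And>m. n \<le> m \<Longrightarrow> level m \<subseteq> dom \<alpha>" using T_dom_level[OF a] by metis
  have m': "determined (m + n) B" by (rule determined_mono[OF m BX vec_le_add])
  have n': "level (m + n) \<subseteq> dom \<alpha>" by (rule n[OF vec_le_add2])
  have im: "act \<alpha> ` B \<subseteq> X" using act_closed[OF a] BX by auto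
  have inj: "inj_on (act \<alpha>) B" using act_inject[OF a] by (simp add: inj_on_def)
  have loc: "(\<exists>x \<in> carrier S. \<forall>w \<in> X. y \<rhd> w \<in> B \<and> act \<alpha> (y \<rhd> w) = x \<rhd> w) \<or> (\<forall>w \<in> X. y \<rhd> w \<notin> B)"
    if y: "y \<in> level (m + n)" for y
  proof (cases "\<exists>w \<in> X. y \<rhd> w \<in> B")
    case True
    then obtain w0 where w0: "w0 \<in> X" "y \<rhd> w0 \<in> B" by blast
    have inB: "y \<rhd> w \<in> B" if "w \<in> X" for w by (rule determined_prepend[OF m' y w0 that])
    obtain x where x: "\<alpha> y = Some x" using n' y by blast
    then show ?thesis using inB act_eq[OF a x] RS_closed(2)[OF T_RS[OF a] x] by blast
  qed blast
  obtain s where "s \<in> homeos" "\<And>v. v \<in> B \<Longrightarrow> s v = act \<alpha> v" "\<And>v. v \<notin> B \<union> act \<alpha> ` B \<Longrightarrow> s v = v"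
    using swap_homeo[OF BX im disj inj loc] by metis
  then show ?thesis by blast
qed

text \<open>
  Let \<open>P\<close> be determined at \<open>n\<close> and let \<open>C\<close> contain all tilings with prefix \<open>y0\<close>. There are enough elements
  \<open>\<theta> y\<close> of one large degree to send the prefixes \<open>y\<close> of degree \<open>n\<close> injectively to the extensions \<open>y0 \<otimes> \<theta> y\<close> of \<open>y0\<close>.
\<close>

lemma homeo_compress:
  assumes P: "P \<in> clopens" and C: "C \<in> clopens" "C \<noteq> {}" and disj: "P \<inter> C = {}"
  shows "\<exists>t \<in> homeos. t ` P \<subseteq> C \<and> (\<forall>v. v \<notin> P \<union> C \<longrightarrow> t v = v)"
proof -
  have PX: "P \<subseteq> X" and CX: "C \<subseteq> X" using P C by (auto simp: clopens_def)
  obtain n where n: "determined n P" using P by (auto simp: clopens_def)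
  obtain m where m: "determined m C" using C by (auto simp: clopens_def)
  obtain c where c: "c \<in> C" using C by blast
  define y0 where "y0 = c (0, m)"
  have cX: "c \<in> X" using c CX by blast
  have y0: "y0 \<in> carrier S" "d y0 = m" using cX by (simp_all add: y0_def)
  have c': "y0 \<rhd> shift m c \<in> C" using head_shift[OF cX] c by (simp add: y0_def)
  have y0C: "y0 \<rhd> w \<in> C" if "w \<in> X" for w
    by (rule determined_prepend[OF m _ shift_closed[OF cX] c' that]) (simp add: level_def y0)
  define j where "j = card (level n)"
  have "card (level n) \<le> card (level (vec j :: nat ^ 'k))" using card_level_large by (simp add: j_def)
  then obtain \<theta> where \<theta>: "\<theta> ` level n \<subseteq> level (vec j)" "inj_on \<theta> (level n)"
    using card_le_inj[OF finite_level finite_level] by metis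
  define h where "h v = (y0 \<otimes> \<theta> (v (0, n))) \<rhd> shift n v" for v
  have \<theta>S: "\<theta> y \<in> carrier S" "d (\<theta> y) = vec j" if "y \<in> level n" for y
    using \<theta>(1) that levelD by auto
  have hC: "h v \<in> C" if v: "v \<in> X" for v
  proof -
    have "h v = y0 \<rhd> \<theta> (v (0, n)) \<rhd> shift n v"
      unfolding h_def by (rule prepend_mult[OF y0(1) \<theta>S(1)[OF head_level[OF v]] shift_closed[OF v]])
    then show ?thesis using y0C \<theta>S(1)[OF head_level[OF v]] shift_closed[OF v] by simp
  qed
  have hy: "h (y \<rhd> w) = (y0 \<otimes> \<theta> y) \<rhd> w" if y: "y \<in> level n" and w: "w \<in> X" for y w
    using prepend_props(2,3)[OF levelD(1)[OF y] w] levelD(2)[OF y] by (simp add: h_def)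
  have imC: "h ` P \<subseteq> C" using hC PX by blast
  have imX: "h ` P \<subseteq> X" using imC CX by blast
  have disj': "h ` P \<inter> P = {}" using imC disj by blast
  have inj: "inj_on h P"
  proof (rule inj_onI)
    fix v u assume vu: "v \<in> P" "u \<in> P" "h v = h u"
    have X': "v \<in> X" "u \<in> X" using vu PX by auto
    have l: "v (0, n) \<in> level n" "u (0, n) \<in> level n" using X' by auto
    have S': "y0 \<otimes> \<theta> (v (0, n)) \<in> carrier S" "y0 \<otimes> \<theta> (u (0, n)) \<in> carrier S" using y0 \<theta>S(1)[OF l(1)] \<theta>S(1)[OF l(2)] by auto
    have dd: "d (y0 \<otimes> \<theta> (v (0, n))) = d (y0 \<otimes> \<theta> (u (0, n)))"
      using y0 \<theta>S[OF l(1)] \<theta>S[OF l(2)] by (simp add: degree_mult)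
    have e: "y0 \<otimes> \<theta> (v (0, n)) = y0 \<otimes> \<theta> (u (0, n))" "shift n v = shift n u"
      using prepend_inject[OF S' shift_closed[OF X'(1)] shift_closed[OF X'(2)] vu(3)[unfolded h_def] dd] .
    have "\<theta> (v (0, n)) = \<theta> (u (0, n))" by (rule left_cancel[OF y0(1) \<theta>S(1)[OF l(1)] \<theta>S(1)[OF l(2)] e(1)])
    then have "v (0, n) = u (0, n)" using inj_onD[OF \<theta>(2) _ l] by blast
    then show "v = u" using tiling_split_unique[OF X' _ e(2)] by blast
  qed
  have loc: "(\<exists>x \<in> carrier S. \<forall>w \<in> X. y \<rhd> w \<in> P \<and> h (y \<rhd> w) = x \<rhd> w) \<or> (\<forall>w \<in> X. y \<rhd> w \<notin> P)"
    if y: "y \<in> level n" for y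
  proof (cases "\<exists>w \<in> X. y \<rhd> w \<in> P")
    case True
    then obtain w0 where w0: "w0 \<in> X" "y \<rhd> w0 \<in> P" by blast
    have "y \<rhd> w \<in> P" if "w \<in> X" for w by (rule determined_prepend[OF n y w0 that])
    then show ?thesis using hy[OF y] y0 \<theta>S(1)[OF y] by (intro disjI1 bexI[of _ "y0 \<otimes> \<theta> y"]) auto
  qed blast
  obtain t where t: "t \<in> homeos" "\<And>v. v \<in> P \<Longrightarrow> t v = h v" "\<And>v. v \<notin> P \<union> h ` P \<Longrightarrow> t v = v"
    using swap_homeo[OF PX imX disj' inj loc] by metis
  have "t ` P \<subseteq> C" using t(2) imC by auto
  moreover have "t v = v" if "v \<notin> P \<union> C" for v using t(3) that imC by blast
  ultimately show ?thesis using t(1) by blast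
qed

lemma homeos_comp: "\<lbrakk>f \<in> homeos; g \<in> homeos\<rbrakk> \<Longrightarrow> f \<circ> g \<in> homeos"
proof -
  assume "f \<in> homeos" "g \<in> homeos"
  then obtain \<alpha> \<beta> where "\<alpha> \<in> carrier T" "f = act \<alpha>" "\<beta> \<in> carrier T" "g = act \<beta>"
    by (auto simp: homeos_def)
  then have "f \<circ> g = act (\<alpha> \<circ>\<^sub>m \<beta>)" "\<alpha> \<circ>\<^sub>m \<beta> \<in> carrier T"
    by (simp_all add: act_comp comp_T)
  then show ?thesis unfolding homeos_def by blast
qed

lemma homeos_id: "id \<in> homeos"
proof -
  have "act (partial_id (carrier S)) = id"
    using act_partial_id[OF ideal_carrier] one_T_closed partial_id_T[OF ideal_carrier] by simp
  then show ?thesis unfolding homeos_def using one_T_closed by (metis imageI)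
qed

lemma homeos_inv: "f \<in> homeos \<Longrightarrow> inv_fun f \<in> homeos"
  unfolding homeos_def using inv_act converse_map_T by auto

sublocale tilings: vigorous_group homeos clopens X
proof
  show "bij f" if "f \<in> homeos" for f
    using that act_converse o_bij unfolding homeos_def by blast
  show "X \<in> clopens" by (auto simp: clopens_def determined_def)
  show "f ` B \<in> clopens" if "f \<in> homeos" "B \<in> clopens" for f B
    using that clopens_image by (auto simp: homeos_def)
  show "\<exists>B \<in> clopens. B \<noteq> {} \<and> f ` B \<inter> B = {}" if "f \<in> homeos" "f \<noteq> id" for f
    using that homeo_displaces by (auto simp: homeos_def)
  show "\<exists>s \<in> homeos. (\<forall>v \<in> B. s v = f v) \<and> (\<forall>v. v \<notin> B \<union> f ` B \<longrightarrow> s v = v)"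
    if f: "f \<in> homeos" "B \<in> clopens" "f ` B \<inter> B = {}" for f B
  proof -
    obtain \<alpha> where "\<alpha> \<in> carrier T" "f = act \<alpha>" using f(1) by (auto simp: homeos_def)
    then show ?thesis using homeo_swap[of \<alpha> B] f by simp
  qed
  show "f v = v" if "f \<in> homeos" "v \<notin> X" for f v
    using that act_outside by (auto simp: homeos_def)
  show "B \<subseteq> X" if "B \<in> clopens" for B using that by (simp add: clopens_def)
  show "\<exists>t \<in> homeos. t ` P \<subseteq> C \<and> (\<forall>v. v \<notin> P \<union> C \<longrightarrow> t v = v)"
    if "P \<in> clopens" "C \<in> clopens" "P \<noteq> {}" "C \<noteq> {}" "P \<inter> C = {}" for P C
    by (rule homeo_compress[OF that(1,2,4,5)])
qed (fact homeos_id homeos_comp homeos_inv tilings_nonempty clopens_Un clopens_Diff clopens_atomless)+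

lemma kernel_quotient_homeos: "kernel_quotient T (permutation_group homeos) act"
proof (rule kernel_quotient.intro)
  show "min_group_cong T = {(s, t). s \<in> carrier T \<and> t \<in> carrier T \<and> act s = act t}"
  proof (rule Set.set_eqI)
    fix p show "p \<in> min_group_cong T \<longleftrightarrow>
        p \<in> {(s, t). s \<in> carrier T \<and> t \<in> carrier T \<and> act s = act t}"
      by (cases p) (simp add: min_group_cong_T act_eq_iff cong: conj_cong)
  qed
  show "act \<one>\<^bsub>T\<^esub> = \<one>\<^bsub>permutation_group homeos\<^esub>"
    using act_partial_id[OF ideal_carrier] one_T_closed partial_id_T[OF ideal_carrier]
    by (simp add: permutation_group_def)
qed (simp_all add: one_T_closed comp_T homeos_def permutation_group_def act_comp
    tilings.group_permutation_group[unfolded homeos_def permutation_group_def])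

end

section \<open>The group of an aperiodic k-monoid\<close>

theorem theorem1p1:
  fixes S :: "('s, 'b) monoid_scheme" and d :: "'s \<Rightarrow> nat ^ 'k::finite"
  assumes "k_monoid S d"
    and "aperiodic S d"
    and "\<And>i. finite (alphabet S d i)"
    and "\<And>i. card (alphabet S d i) \<ge> 2"
  shows "group (k_monoid_group S) \<and>
    countable (carrier (k_monoid_group S)) \<and>
    (\<exists>H. subgroup H (homeo_group cantor_space) \<and>
      k_monoid_group S \<cong> (homeo_group cantor_space)\<lparr>carrier := H\<rparr>) \<and>
    is_simple ((k_monoid_group S)
      \<lparr>carrier := derived (k_monoid_group S) (carrier (k_monoid_group S))\<rparr>) \<and>
    boolean_groupoid (tiling_groupoid S d) (tiling_groupoid_topology S d) \<and>
    group (topological_full_group (tiling_groupoid S d) (tiling_groupoid_topology S d)) \<and>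
    k_monoid_group S \<cong>
      topological_full_group (tiling_groupoid S d) (tiling_groupoid_topology S d)"
proof -
  interpret aperiodic_k_monoid S d
    using assms by (simp add: aperiodic_k_monoid_def branching_k_monoid_def
        branching_k_monoid_axioms_def aperiodic_k_monoid_axioms_def)
  interpret full: kernel_quotient T full_group bisection_of by (rule kernel_quotient_full_group)
  interpret perm: kernel_quotient T "permutation_group homeos" act by (rule kernel_quotient_homeos)
  have grp: "group (k_monoid_group S)" unfolding k_monoid_group_def by (rule full.quotient_group)
  have cnt: "countable (carrier (k_monoid_group S))"
    unfolding k_monoid_group_def full.carrier_quotient by (rule countable_image[OF countable_T])
  have "is_simple ((k_monoid_group S)
      \<lparr>carrier := derived (k_monoid_group S) (carrier (k_monoid_group S))\<rparr>)"
  proof (rule simple_derived_iso[OF _ grp tilings.group_permutation_group])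
    show "(\<lambda>A. the_elem (act ` A)) \<in> iso (k_monoid_group S) (permutation_group homeos)"
      unfolding k_monoid_group_def by (rule perm.quotient_iso)
    have "carrier (permutation_group homeos) = homeos" by (simp add: permutation_group_def)
    then show "is_simple ((permutation_group homeos)
        \<lparr>carrier := derived (permutation_group homeos) (carrier (permutation_group homeos))\<rparr>)"
      using tilings.simple_commutator_group by simp
  qed
  moreover have "k_monoid_group S \<cong> full_group"
    unfolding k_monoid_group_def using full.quotient_iso by (rule is_isoI)
  ultimately show ?thesis
    using grp cnt countable_group_embeds_homeo_cantor[OF grp cnt] boolean_groupoid_tilings group_full_group
    by blast
qed

end
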